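(* Let $X=Q_1\cap Q_2\subset\mathbb P^5$ be a smooth quadric complex defined over a number field. Let $D\subset X$ be, over that number field, either a hyperplane section of $X$, or the union $H_1\cup H_2$ of two hyperplane sections of $X$ which share a common line (i.e. there is a line $l\subset H_1\cap H_2$). Then the set of integral points of $X\setminus D$ is potentially dense.
   Context: A smooth quadric complex is a smooth threefold which is the complete intersection of two quadric hypersurfaces $Q_1,Q_2\subset\mathbb P^5$. Let $X\subset\mathbb P^n$ be a projective variety over a number field $\mathbb K$, let $D\subset X$ be a proper closed algebraic subset and let $X^o=X\setminus D$. For a finite set $S$ of places of $\mathbb K$ containing the archimedean ones, a point $P\in X^o(\mathbb K)$ is $S$-integral with respect to $D$ if for no place $\nu\notin S$ does $P$ reduce modulo $\nu$ to a point of $D$. The integral points of $X^o$ are potentially dense if, after replacing $\mathbb K$ by a suitable finite extension and enlarging the finite set $S$ suitably, the set of $S$-integral points of $X^o$ is Zariski-dense. *)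

theory Defs
  imports
    "HOL-Analysis.Cartesian_Space"
    "HOL-Library.Poly_Mapping"
    "HOL-Library.Numeral_Type"
    "HOL-Algebra.Algebraic_Closure_Type"
begin

no_notation Polynomials.var (\<open>X\<index>\<close>)

section \<open>Number fields and their places\<close>

type_synonym qbar = "rat alg_closure"

text \<open>
  Number fields are the subfields of a fixed algebraic closure of the rationals that have finite
  degree; a finite extension of such a \<open>K\<close> is a number field containing \<open>K\<close>.
\<close>

definition number_field :: "qbar set \<Rightarrow> bool" where
  "number_field K \<longleftrightarrow>
     0 \<in> K \<and> 1 \<in> K \<and>
     (\<forall>x\<in>K. \<forall>y\<in>K. x + y \<in> K \<and> x * y \<in> K) \<and>
     (\<forall>x\<in>K. - x \<in> K \<and> inverse x \<in> K) \<and>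
     (\<exists>B. finite B \<and> K = {(\<Sum>b\<in>B. of_rat (c b) * b) | c. True})"

definition nontrivial_absolute_value :: "qbar set \<Rightarrow> (qbar \<Rightarrow> real) \<Rightarrow> bool" where
  "nontrivial_absolute_value K v \<longleftrightarrow>
     (\<forall>x\<in>K. v x \<ge> 0 \<and> (v x = 0 \<longleftrightarrow> x = 0)) \<and>
     (\<forall>x\<in>K. \<forall>y\<in>K. v (x * y) = v x * v y \<and> v (x + y) \<le> v x + v y) \<and>
     (\<exists>x\<in>K. x \<noteq> 0 \<and> v x \<noteq> 1)"

definition equivalent_absolute_values ::
    "qbar set \<Rightarrow> (qbar \<Rightarrow> real) \<Rightarrow> (qbar \<Rightarrow> real) \<Rightarrow> bool" where
  "equivalent_absolute_values K v w \<longleftrightarrow> (\<exists>s>0. \<forall>x\<in>K. w x = v x powr s)"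

text \<open>
  Only the values on \<open>K\<close> matter; since a place is the full equivalence class, functions that
  differ merely outside \<open>K\<close> define the same place.
\<close>

type_synonym place = "(qbar \<Rightarrow> real) set"

definition places :: "qbar set \<Rightarrow> place set" where
  "places K =
     {{w. nontrivial_absolute_value K w \<and> equivalent_absolute_values K v w} | v.
        nontrivial_absolute_value K v}"

definition nonarchimedean :: "qbar set \<Rightarrow> place \<Rightarrow> bool" where
  "nonarchimedean K \<nu> \<longleftrightarrow> (\<forall>v\<in>\<nu>. \<forall>x\<in>K. \<forall>y\<in>K. v (x + y) \<le> max (v x) (v y))"

definition archimedean_places :: "qbar set \<Rightarrow> place set" where
  "archimedean_places K = {\<nu> \<in> places K. \<not> nonarchimedean K \<nu>}"

definition valuation_ring_of :: "qbar set \<Rightarrow> place \<Rightarrow> qbar set" where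
  "valuation_ring_of K \<nu> = {x \<in> K. \<forall>v\<in>\<nu>. v x \<le> 1}"

definition maximal_ideal_of :: "qbar set \<Rightarrow> place \<Rightarrow> qbar set" where
  "maximal_ideal_of K \<nu> = {x \<in> K. \<forall>v\<in>\<nu>. v x < 1}"


section \<open>Polynomials in the variables indexed by a finite type\<close>

type_synonym 'n mpol = "('n \<Rightarrow>\<^sub>0 nat) \<Rightarrow>\<^sub>0 qbar"

abbreviation (input) "lookup \<equiv> Poly_Mapping.lookup"
abbreviation (input) "keys \<equiv> Poly_Mapping.keys"

definition coeffs_in :: "qbar set \<Rightarrow> 'n mpol \<Rightarrow> bool" where
  "coeffs_in R f \<longleftrightarrow> (\<forall>m. lookup f m \<in> R)"

definition homogeneous_of_degree :: "nat \<Rightarrow> ('n::finite) mpol \<Rightarrow> bool" where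
  "homogeneous_of_degree d f \<longleftrightarrow> (\<forall>m\<in>keys f. (\<Sum>i\<in>UNIV. lookup m i) = d)"

definition peval :: "('n::finite) mpol \<Rightarrow> qbar ^ 'n \<Rightarrow> qbar" where
  "peval f x = (\<Sum>m\<in>keys f. lookup f m * (\<Prod>i\<in>UNIV. (x $ i) ^ lookup m i))"

definition partial_deriv :: "'n \<Rightarrow> 'n mpol \<Rightarrow> 'n mpol" where
  "partial_deriv i f =
     (\<Sum>m\<in>keys f. Poly_Mapping.single (m - Poly_Mapping.single i 1)
                      (of_nat (lookup m i) * lookup f m))"

definition gradient :: "('n::finite) mpol \<Rightarrow> qbar ^ 'n \<Rightarrow> qbar ^ 'n" where
  "gradient f x = (\<chi> i. peval (partial_deriv i f) x)"


section \<open>Projective space and closed subsets\<close>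

text \<open>
  Geometric points of the projective space with homogeneous coordinates indexed by \<open>'n\<close>, so of
  dimension \<open>CARD('n) - 1\<close>: one-dimensional subspaces.
\<close>

typedef ('n::finite) proj = "{L :: (qbar ^ 'n) set. \<exists>x. x \<noteq> 0 \<and> L = vec.span {x}}"
  morphisms subspace_of Abs_proj
proof -
  have "(\<chi> i. 1) \<noteq> (0 :: qbar ^ 'n)"
    by (simp add: vec_eq_iff)
  then show ?thesis by blast
qed

definition coords :: "('n::finite) proj \<Rightarrow> (qbar ^ 'n) set" where
  "coords p = subspace_of p - {0}"

definition rational_point :: "qbar set \<Rightarrow> ('n::finite) proj \<Rightarrow> bool" where
  "rational_point K p \<longleftrightarrow> (\<exists>x\<in>coords p. \<forall>i. x $ i \<in> K)"

definition zero_locus :: "('n::finite) mpol set \<Rightarrow> 'n proj set" where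
  "zero_locus F = {p. \<forall>f\<in>F. \<forall>x\<in>coords p. peval f x = 0}"

definition vanishing_ideal :: "('n::finite) proj set \<Rightarrow> 'n mpol set" where
  "vanishing_ideal Z = {f. \<forall>p\<in>Z. \<forall>x\<in>coords p. peval f x = 0}"

definition zariski_closed :: "('n::finite) proj set \<Rightarrow> bool" where
  "zariski_closed Z \<longleftrightarrow>
     (\<exists>F. (\<forall>f\<in>F. \<exists>d. homogeneous_of_degree d f) \<and> Z = zero_locus F)"

definition zariski_closure :: "('n::finite) proj set \<Rightarrow> 'n proj set" where
  "zariski_closure T = \<Inter>{Z. zariski_closed Z \<and> T \<subseteq> Z}"

definition irreducible_closed :: "('n::finite) proj set \<Rightarrow> bool" where
  "irreducible_closed Z \<longleftrightarrow>
     zariski_closed Z \<and> Z \<noteq> {} \<and>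
     (\<forall>A B. zariski_closed A \<longrightarrow> zariski_closed B \<longrightarrow> Z = A \<union> B \<longrightarrow> Z = A \<or> Z = B)"

definition chain_of_length :: "('n::finite) proj set \<Rightarrow> nat \<Rightarrow> bool" where
  "chain_of_length Z n \<longleftrightarrow>
     (\<exists>C :: nat \<Rightarrow> 'n proj set.
        (\<forall>i\<le>n. irreducible_closed (C i) \<and> C i \<subseteq> Z) \<and> (\<forall>i<n. C i \<subset> C (Suc i)))"

definition has_dimension :: "('n::finite) proj set \<Rightarrow> nat \<Rightarrow> bool" where
  "has_dimension Z d \<longleftrightarrow> chain_of_length Z d \<and> (\<forall>n>d. \<not> chain_of_length Z n)"

text \<open>
  Smoothness by the rank of the Jacobian matrix of the full vanishing ideal: at every point it
  must equal the codimension.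
\<close>

definition smooth_variety_of_dimension :: "('n::finite) proj set \<Rightarrow> nat \<Rightarrow> bool" where
  "smooth_variety_of_dimension Z d \<longleftrightarrow>
     irreducible_closed Z \<and> has_dimension Z d \<and>
     (\<forall>p\<in>Z. \<forall>x\<in>coords p.
        vec.dim {gradient f x | f. f \<in> vanishing_ideal Z} = CARD('n) - 1 - d)"

definition projective_line :: "('n::finite) proj set \<Rightarrow> bool" where
  "projective_line l \<longleftrightarrow>
     (\<exists>W. vec.subspace W \<and> vec.dim W = 2 \<and> l = {p. subspace_of p \<subseteq> W})"


section \<open>Integral points and potential density\<close>

text \<open>
  For \<open>D\<close> defined over \<open>K\<close>, reduction of \<open>D\<close> modulo \<open>\<nu>\<close> means the special fibre of the closure
  of \<open>D\<close> in projective space over the valuation ring, that is, the locus where the reductions of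
  all \<open>\<nu>\<close>-integral forms vanishing on \<open>D\<close> vanish.  A \<open>K\<close>-point is reduced via homogeneous
  coordinates that are \<open>\<nu>\<close>-integral and not all in the maximal ideal.
\<close>

definition reduces_into ::
    "qbar set \<Rightarrow> place \<Rightarrow> ('n::finite) proj set \<Rightarrow> 'n proj \<Rightarrow> bool" where
  "reduces_into K \<nu> D p \<longleftrightarrow>
     (\<exists>x\<in>coords p.
        (\<forall>i. x $ i \<in> valuation_ring_of K \<nu>) \<and> (\<exists>i. x $ i \<notin> maximal_ideal_of K \<nu>) \<and>
        (\<forall>f d. homogeneous_of_degree d f \<longrightarrow> coeffs_in (valuation_ring_of K \<nu>) f \<longrightarrow>
               f \<in> vanishing_ideal D \<longrightarrow> peval f x \<in> maximal_ideal_of K \<nu>))"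

definition integral_points ::
    "qbar set \<Rightarrow> place set \<Rightarrow> ('n::finite) proj set \<Rightarrow> 'n proj set \<Rightarrow> 'n proj set" where
  "integral_points K S X D =
     {p \<in> X - D. rational_point K p \<and> (\<forall>\<nu>\<in>places K - S. \<not> reduces_into K \<nu> D p)}"

definition integral_points_potentially_dense ::
    "qbar set \<Rightarrow> ('n::finite) proj set \<Rightarrow> 'n proj set \<Rightarrow> bool" where
  "integral_points_potentially_dense K X D \<longleftrightarrow>
     (\<exists>K' S. number_field K' \<and> K \<subseteq> K' \<and>
        finite S \<and> archimedean_places K' \<subseteq> S \<and> S \<subseteq> places K' \<and>
        X - D \<subseteq> zariski_closure (integral_points K' S X D))"


section \<open>Quadric complexes and hyperplane sections\<close>

text \<open>
  The intersection is meant scheme-theoretically: the two quadratic forms generate the full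
  vanishing ideal of \<open>X\<close>.
\<close>

definition smooth_quadric_complex :: "qbar set \<Rightarrow> 6 proj set \<Rightarrow> bool" where
  "smooth_quadric_complex K X \<longleftrightarrow>
     smooth_variety_of_dimension X 3 \<and>
     (\<exists>q1 q2 :: 6 mpol.
        q1 \<noteq> 0 \<and> homogeneous_of_degree 2 q1 \<and> coeffs_in K q1 \<and>
        q2 \<noteq> 0 \<and> homogeneous_of_degree 2 q2 \<and> coeffs_in K q2 \<and>
        X = zero_locus {q1} \<inter> zero_locus {q2} \<and>
        vanishing_ideal X = {a * q1 + b * q2 | a b. True})"

definition hyperplane_section ::
    "qbar set \<Rightarrow> ('n::finite) proj set \<Rightarrow> 'n proj set \<Rightarrow> bool" where
  "hyperplane_section K X H \<longleftrightarrow>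
     (\<exists>h. h \<noteq> 0 \<and> homogeneous_of_degree 1 h \<and> coeffs_in K h \<and> H = X \<inter> zero_locus {h})"

end

theory Submission
  imports Defs "HOL-Computational_Algebra.Primes" "HOL-Analysis.Determinants"
begin

text \<open>
  Let \<open>X\<close> contain a line \<open>l\<close> that lies in the two hyperplanes \<open>h1 = 0\<close> and \<open>h2 = 0\<close>, and let \<open>q1\<close>, \<open>q2\<close> be the
  two quadratic forms.  If \<open>D\<close> is a single hyperplane section, then \<open>l\<close> is a line in it, which exists because the
  section is an intersection of two quadrics in a projective 4-space, and \<open>h2\<close> is arbitrary.
  With coordinates \<open>x0, x1\<close> on \<open>l\<close> and \<open>y\<close> on a complement, in which \<open>h1 = y1\<close> and \<open>h2 = y2\<close>, the equations
  of \<open>X\<close> are linear in \<open>x0, x1\<close>, and their determinant is a quadratic form \<open>\<Delta>(y)\<close>: projecting from \<open>l\<close> is birational.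
  It suffices to find many \<open>S\<close>-integral solutions with \<open>y1 = 1\<close> and \<open>y2\<close> a unit; a form that vanishes on them vanishes on
  \<open>X\<close>, since \<open>X\<close> is irreducible and \<open>(y2, y3, y4)\<close> runs through a set that is infinite in a nested sense.

  Whenever \<open>\<Delta>\<close> is a unit, Cramer's rule gives integral \<open>x0, x1\<close>.  Enough such \<open>y\<close> exist if the restriction of \<open>\<Delta>\<close>
  to \<open>y1 = y2 = 0\<close> has rank 2 (then \<open>\<Delta> = y3 y4 + \<dots>\<close>), or if \<open>\<Delta>\<close> is linear in \<open>y4\<close>.  In the remaining case \<open>\<Delta>\<close>
  does not involve \<open>y4\<close>, and after a change of the pencil \<open>\<Delta> = a c - y3\<^sup>2\<close> with \<open>a, c\<close> linear in \<open>y1, y2\<close>.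
  Divisibility by \<open>\<Delta>\<close> then amounts to a quadratic congruence for \<open>y4\<close> modulo \<open>\<Delta>\<close>, and \<open>y3\<close> can be chosen so that its
  discriminant is a square modulo \<open>\<Delta>\<close>; each such \<open>y3\<close> yields a whole residue class of solutions \<open>y4\<close>.
\<close>

section \<open>Families of solutions over a ring\<close>

text \<open>No theorem about units of number fields is used. Since 1/2 lies in the ring, the powers
  of 2 are infinitely many units; and a power of a unit \<open>r\<close> is 1 modulo
  \<open>1 - r\<close>, so units can be produced in a prescribed residue class modulo
  \<open>1 - r\<close>. Invertibility modulo the determinant is always obtained by exchanging roles:
  \<open>x\<close> is invertible modulo \<open>m\<close> as soon as \<open>m\<close> is a unit
  modulo \<open>x\<close>. The obstacle is the remaining case. There y4 cannot influence the
  determinant, so asking it to be a unit would leave a Pell-type condition on y3 alone. Divisibility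
  by the determinant is asked instead, but then y3 fixes the modulus and also enters the quadratic
  that must have a root; an explicit choice of y3 satisfies both demands at once. Smoothness acts
  mostly as a ban on linear relations of rank one among the forms \<open>B1 e0\<close>,
  \<open>B1 e1\<close>, \<open>B2 e0\<close>, \<open>B2 e1\<close>: such a relation would be a
  member of the pencil that is singular at a point of the line. All constants are found over the
  algebraic closure and form a finite set; only then are the field and the places enlarged so that
  these constants become integral, which rests on the finiteness of the set of bad places.\<close>

definition nested_infinite :: "('a \<Rightarrow> 'a \<Rightarrow> 'a \<Rightarrow> bool) \<Rightarrow> bool" where
  "nested_infinite P \<longleftrightarrow> infinite {u. infinite {v. infinite {w. P u v w}}}"

lemma nested_infinite_mono:
  assumes "nested_infinite P" and "\<And>u v w. P u v w \<Longrightarrow> Q u v w"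
  shows "nested_infinite Q"
proof -
  have 1: "{w. P u v w} \<subseteq> {w. Q u v w}" for u v
    using assms(2) by auto
  have 2: "{v. infinite {w. P u v w}} \<subseteq> {v. infinite {w. Q u v w}}" for u
    using 1 infinite_super by blast
  have "{u. infinite {v. infinite {w. P u v w}}} \<subseteq> {u. infinite {v. infinite {w. Q u v w}}}"
    using 2 infinite_super by blast
  then show ?thesis
    using assms(1) infinite_super unfolding nested_infinite_def by blast
qed

lemma inj_power_2: "inj (\<lambda>i::nat. (2::'a::field_char_0) ^ i)"
proof (rule injI)
  fix i j :: nat assume "(2::'a) ^ i = 2 ^ j"
  then have "(of_nat (2 ^ i) :: 'a) = of_nat (2 ^ j)" by simp
  then have "(2::nat) ^ i = 2 ^ j" unfolding of_nat_eq_iff .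
  then show "i = j" by simp
qed

lemma infinite_Collect_inj:
  assumes "inj f" "\<And>i::nat. P (f i)"
  shows "infinite {x. P x}"
proof -
  have "range f \<subseteq> {x. P x}" using assms(2) by auto
  then show ?thesis using range_inj_infinite[OF assms(1)] infinite_super by blast
qed

lemma finite_quadratic_roots:
  fixes a b c :: "'a::field"
  assumes "a \<noteq> 0 \<or> b \<noteq> 0"
  shows "finite {x. a * x\<^sup>2 + b * x + c = 0}"
proof -
  have "finite {x. poly [:c, b, a:] x = 0}"
    by (rule poly_roots_finite) (use assms in auto)
  moreover have "poly [:c, b, a:] x = a * x\<^sup>2 + b * x + c" for x
    by (simp add: algebra_simps power2_eq_square)
  ultimately show ?thesis by (simp only:)
qed

section \<open>Rings containing 1/2: units, congruences, invertibility modulo an element\<close>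

locale half_ring =
  fixes R :: "'a::field_char_0 set"
  assumes zero [simp, intro]: "0 \<in> R" and one [simp, intro]: "1 \<in> R"
    and add [simp, intro]: "x \<in> R \<Longrightarrow> y \<in> R \<Longrightarrow> x + y \<in> R"
    and mult [simp, intro]: "x \<in> R \<Longrightarrow> y \<in> R \<Longrightarrow> x * y \<in> R"
    and minus [simp, intro]: "x \<in> R \<Longrightarrow> - x \<in> R"
    and half: "inverse 2 \<in> R"
begin

lemma diff [simp, intro]: "x \<in> R \<Longrightarrow> y \<in> R \<Longrightarrow> x - y \<in> R"
  using add[of x "- y"] by simp

lemma pow [simp, intro]: "x \<in> R \<Longrightarrow> x ^ n \<in> R"
  by (induction n) auto

lemma two [simp, intro]: "2 \<in> R"
  using add[OF one one] by simp

definition is_unit_in :: "'a \<Rightarrow> bool" where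
  "is_unit_in x \<longleftrightarrow> x \<noteq> 0 \<and> x \<in> R \<and> inverse x \<in> R"

lemma unit_mem: "is_unit_in x \<Longrightarrow> x \<in> R"
  and unit_nz: "is_unit_in x \<Longrightarrow> x \<noteq> 0"
  by (auto simp: is_unit_in_def)

lemma unit_div [simp, intro]: "is_unit_in x \<Longrightarrow> y \<in> R \<Longrightarrow> y / x \<in> R"
  by (auto simp: is_unit_in_def divide_inverse)

lemma unit_one [simp]: "is_unit_in 1"
  by (simp add: is_unit_in_def)

lemma unit_mult [simp, intro]: "is_unit_in x \<Longrightarrow> is_unit_in y \<Longrightarrow> is_unit_in (x * y)"
  by (auto simp: is_unit_in_def)

lemma unit_minus [simp]: "is_unit_in (- x) \<longleftrightarrow> is_unit_in x"
proof -
  have "- y \<in> R \<longleftrightarrow> y \<in> R" for y using minus[of y] minus[of "- y"] by auto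
  then show ?thesis by (simp add: is_unit_in_def inverse_minus_eq)
qed

lemma unit_pow [simp, intro]: "is_unit_in x \<Longrightarrow> is_unit_in (x ^ n)"
  by (induction n) auto

lemma unit_inverse [simp, intro]: "is_unit_in x \<Longrightarrow> is_unit_in (inverse x)"
  by (auto simp: is_unit_in_def)

lemma unit_two [simp]: "is_unit_in 2"
  using half by (simp add: is_unit_in_def)

declare unit_mem [simp]

lemma unit_four [simp]: "is_unit_in 4"
  using unit_mult[OF unit_two unit_two] by simp

lemma half_mem [simp, intro]: "x \<in> R \<Longrightarrow> x / 2 \<in> R" "x \<in> R \<Longrightarrow> x / 4 \<in> R"
  by auto

definition congr :: "'a \<Rightarrow> 'a \<Rightarrow> 'a \<Rightarrow> bool" where
  "congr m x y \<longleftrightarrow> x \<in> R \<and> y \<in> R \<and> (\<exists>z\<in>R. x - y = m * z)"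

lemma congr_refl [intro]: "x \<in> R \<Longrightarrow> congr m x x"
  unfolding congr_def by (auto intro: bexI[of _ 0])

lemma congr_sym: "congr m x y \<Longrightarrow> congr m y x"
  unfolding congr_def
proof (elim conjE bexE, intro conjI)
  fix z assume "z \<in> R" "x - y = m * z"
  then show "\<exists>z\<in>R. y - x = m * z" by (intro bexI[of _ "- z"]) (auto simp: algebra_simps)
qed auto

lemma congr_trans [trans]: "congr m x y \<Longrightarrow> congr m y z \<Longrightarrow> congr m x z"
  unfolding congr_def
proof (elim conjE bexE, intro conjI)
  fix k l assume "k \<in> R" "x - y = m * k" "l \<in> R" "y - z = m * l"
  then show "\<exists>w\<in>R. x - z = m * w" by (intro bexI[of _ "k + l"]) (auto simp: algebra_simps)
qed auto

lemma congr_add: "congr m x y \<Longrightarrow> congr m x' y' \<Longrightarrow> congr m (x + x') (y + y')"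
  unfolding congr_def
proof (elim conjE bexE, intro conjI)
  fix k l assume "k \<in> R" "x - y = m * k" "l \<in> R" "x' - y' = m * l"
  then show "\<exists>w\<in>R. x + x' - (y + y') = m * w" by (intro bexI[of _ "k + l"]) (auto simp: algebra_simps)
qed auto

lemma congr_mult: "congr m x y \<Longrightarrow> congr m x' y' \<Longrightarrow> congr m (x * x') (y * y')"
  unfolding congr_def
proof (elim conjE bexE, intro conjI)
  fix k l assume *: "k \<in> R" "x - y = m * k" "l \<in> R" "x' - y' = m * l" "x \<in> R" "y \<in> R" "x' \<in> R" "y' \<in> R"
  have "x * x' - y * y' = x * (x' - y') + (x - y) * y'" by (simp add: algebra_simps)
  also have "\<dots> = m * (x * l + k * y')" unfolding * by (simp add: algebra_simps)
  finally show "\<exists>w\<in>R. x * x' - (y * y') = m * w" using * by blast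
qed auto

lemma congr_minus: "congr m x y \<Longrightarrow> congr m (- x) (- y)"
  unfolding congr_def
proof (elim conjE bexE, intro conjI)
  fix z assume "z \<in> R" "x - y = m * z"
  then show "\<exists>z\<in>R. - x - - y = m * z" by (intro bexI[of _ "- z"]) (auto simp: algebra_simps)
qed auto

lemma congr_diff: "congr m x y \<Longrightarrow> congr m x' y' \<Longrightarrow> congr m (x - x') (y - y')"
  using congr_add[OF _ congr_minus, of m x y x' y'] by simp

lemma congr_pow: "congr m x y \<Longrightarrow> congr m (x ^ n) (y ^ n)"
  by (induction n) (auto intro: congr_mult)

lemma congr_dvd: "congr (m * k) x y \<Longrightarrow> k \<in> R \<Longrightarrow> congr m x y"
  unfolding congr_def using mult by (metis mult.assoc)

lemma congr_self: "m \<in> R \<Longrightarrow> k \<in> R \<Longrightarrow> congr m (m * k) 0"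
  unfolding congr_def by auto

lemmas congr_intros = congr_add congr_mult congr_minus congr_diff congr_pow

definition inv_mod :: "'a \<Rightarrow> 'a \<Rightarrow> bool" where
  "inv_mod m x \<longleftrightarrow> (\<exists>i\<in>R. congr m (x * i) 1)"

lemma inv_mod_unit: "is_unit_in x \<Longrightarrow> inv_mod m x"
  unfolding inv_mod_def
  by (rule bexI[of _ "inverse x"]) (auto simp: is_unit_in_def simp del: unit_mem intro: congr_refl)

lemma inv_mod_mult: "inv_mod m x \<Longrightarrow> inv_mod m y \<Longrightarrow> inv_mod m (x * y)"
  unfolding inv_mod_def
proof (elim bexE)
  fix i j assume *: "i \<in> R" "congr m (x * i) 1" "j \<in> R" "congr m (y * j) 1"
  from congr_mult[OF *(2,4)] have "congr m (x * y * (i * j)) 1"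
    by (simp add: algebra_simps)
  then show "\<exists>i\<in>R. congr m (x * y * i) 1" using * by blast
qed

text \<open>Coprimality is symmetric: from m = e + x z follows x (-z/e) = 1 - m/e. The determinant
  is later computed modulo some \<open>x\<close> and found to be a unit there; this turns the result
  into invertibility of \<open>x\<close> modulo the determinant.\<close>

lemma inv_mod_swap:
  assumes "congr x m e" "is_unit_in e" "x \<in> R"
  shows "inv_mod m x"
proof -
  obtain z where z: "z \<in> R" "m - e = x * z" using assms by (auto simp: congr_def)
  have m: "m \<in> R" using assms by (auto simp: congr_def)
  have e: "e \<noteq> 0" using assms unit_nz by auto
  define w k where "w = - z / e" and "k = - 1 / e"
  have "x * w - 1 = m * k"
    using z e by (simp add: field_simps w_def k_def)
  moreover have "w \<in> R" "k \<in> R" unfolding w_def k_def using assms z by (auto simp only: unit_div minus one)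
  ultimately show ?thesis unfolding inv_mod_def congr_def using assms(3)
    by (intro bexI[of _ w]) auto
qed

lemma inv_mod_factor:
  assumes "inv_mod m y" "congr m y (x * x')" "x \<in> R" "x' \<in> R"
  shows "inv_mod m x"
proof -
  obtain i where i: "i \<in> R" "congr m (y * i) 1" using assms by (auto simp: inv_mod_def)
  have "congr m (x * x' * i) (y * i)"
    by (intro congr_mult congr_sym[OF assms(2)] congr_refl i)
  then have "congr m (x * (x' * i)) 1" using congr_trans i by (simp add: mult.assoc)
  then show ?thesis unfolding inv_mod_def using assms i by blast
qed

lemma inv_mod_cancel:
  assumes "inv_mod m x" "congr m (x * y) 0" "y \<in> R"
  shows "congr m y 0"
proof -
  obtain i where i: "i \<in> R" "congr m (x * i) 1" using assms by (auto simp: inv_mod_def)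
  have "congr m (x * i * y) (1 * y)" by (intro congr_mult i congr_refl assms)
  then have 1: "congr m y (x * i * y)" using congr_sym by simp
  have "congr m (x * y * i) (0 * i)" by (intro congr_mult i congr_refl assms)
  moreover have "x * y * i = x * i * y" by (simp add: mult_ac)
  ultimately have "congr m (x * i * y) 0" by simp
  with 1 show ?thesis by (rule congr_trans)
qed

text \<open>The element \<open>1 - r\<close> divides \<open>1 - r ^ n\<close>. Multiplying by powers
  of a unit \<open>r\<close> therefore varies a unit without leaving its class modulo
  \<open>1 - r\<close>.\<close>

lemma unit_power_congr:
  assumes "r \<in> R" shows "congr (1 - r) (r ^ n) 1"
proof -
  have "congr (1 - r) r 1" unfolding congr_def using assms by (auto intro!: bexI[of _ "-1"])
  from congr_pow[OF this, of n] show ?thesis by simp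
qed


text \<open>
  Here \<open>\<Delta> = 2^k\<close> is a unit, so Cramer's rule produces integral points.
\<close>

lemma hyperbolic_family:
  assumes "{l0, l1, m0, m1, q0, q1, q2} \<subseteq> R"
  shows "nested_infinite (\<lambda>u v w. is_unit_in u \<and> v \<in> R \<and> w \<in> R \<and>
      is_unit_in (v * w + (l0 + l1 * u) * v + (m0 + m1 * u) * w + (q0 + q1 * u + q2 * u\<^sup>2)))"
  unfolding nested_infinite_def
proof (rule infinite_Collect_inj[OF inj_power_2])
  fix i :: nat
  define u :: 'a where "u = 2 ^ i"
  define L where "L = l0 + l1 * u"
  define M where "M = m0 + m1 * u"
  define Q where "Q = q0 + q1 * u + q2 * u\<^sup>2"
  have uR: "is_unit_in u" by (simp add: u_def)
  then have LMQ: "L \<in> R" "M \<in> R" "Q \<in> R" using assms by (auto simp: L_def M_def Q_def)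
  \<comment> \<open>The form is (v + M) (w + L) + Q - L M. Taking v + M = 2^j makes the first factor
    a unit, and then w is solved for so that the total is 2^k.\<close>
  have "infinite {v. infinite {w. is_unit_in u \<and> v \<in> R \<and> w \<in> R \<and> is_unit_in (v * w + L * v + M * w + Q)}}"
  proof (rule infinite_Collect_inj[where f = "\<lambda>j. 2 ^ j - M"])
    show "inj (\<lambda>j::nat. 2 ^ j - M)" using inj_power_2[where 'a='a] by (auto simp: inj_def)
    fix j :: nat
    define s :: 'a where "s = 2 ^ j"
    have s: "is_unit_in s" "s \<noteq> 0" by (auto simp: s_def)
    show "infinite {w. is_unit_in u \<and> 2 ^ j - M \<in> R \<and> w \<in> R \<and> is_unit_in ((2 ^ j - M) * w + L * (2 ^ j - M) + M * w + Q)}"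
    proof (rule infinite_Collect_inj[where f = "\<lambda>k. (2 ^ k + L * M - Q) / s - L"])
      show "inj (\<lambda>k::nat. (2 ^ k + L * M - Q) / s - L)"
        using inj_power_2[where 'a='a] s by (auto simp: inj_def)
      fix k :: nat
      have "(s - M) * ((2 ^ k + L * M - Q) / s - L) + L * (s - M) + M * ((2 ^ k + L * M - Q) / s - L) + Q = 2 ^ k"
        using s by (simp add: field_simps)
      then show "is_unit_in u \<and> 2 ^ j - M \<in> R \<and> (2 ^ k + L * M - Q) / s - L \<in> R \<and>
        is_unit_in ((2 ^ j - M) * ((2 ^ k + L * M - Q) / s - L) + L * (2 ^ j - M) + M * ((2 ^ k + L * M - Q) / s - L) + Q)"
        unfolding s_def[symmetric] using s LMQ uR by auto
    qed
  qed
  then show "infinite {v. infinite {w. is_unit_in (2 ^ i) \<and> v \<in> R \<and> w \<in> R \<and>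
      is_unit_in (v * w + (l0 + l1 * 2 ^ i) * v + (m0 + m1 * 2 ^ i) * w + (q0 + q1 * 2 ^ i + q2 * (2 ^ i)\<^sup>2))}}"
    by (simp add: L_def M_def Q_def u_def)
qed

text \<open>If the coefficient a + b u of w is a unit (b = 0 or a = 0), one solves for w directly.
  Otherwise u = s r near the root s makes this coefficient a (1 - r); modulo 1 - r the remaining
  terms reduce to their value g at (s, c), and so does every target g r^k, so the quotient defining
  w is integral.\<close>

lemma linear_family:
  assumes R: "{a, b, p, l0, l1, q0, q1, q2, c} \<subseteq> R" and s0: "is_unit_in s" and g0: "is_unit_in g"
    and cs: "(is_unit_in a \<and> a + b * s = 0 \<and> p * c\<^sup>2 + (l0 + l1 * s) * c + (q0 + q1 * s + q2 * s\<^sup>2) = g)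
             \<or> (is_unit_in a \<and> b = 0) \<or> (a = 0 \<and> is_unit_in b)"
  shows "nested_infinite (\<lambda>u v w. is_unit_in u \<and> v \<in> R \<and> w \<in> R \<and>
      is_unit_in (w * (a + b * u) + (p * v\<^sup>2 + (l0 + l1 * u) * v + (q0 + q1 * u + q2 * u\<^sup>2))))"
  unfolding nested_infinite_def
proof (rule infinite_Collect_inj[where f = "\<lambda>i. s * 2 ^ Suc i"])
  show "inj (\<lambda>i. s * 2 ^ Suc i)" using inj_power_2[where 'a='a] unit_nz[OF s0] by (auto simp: inj_def)
  fix i :: nat
  \<comment> \<open>The exponent \<open>Suc i\<close> keeps \<open>r\<close> different from 1, so
    that \<open>1 - r\<close> can be a divisor.\<close>
  define r :: 'a where "r = 2 ^ Suc i"
  define u where "u = s * r"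
  define G where "G v = p * v\<^sup>2 + (l0 + l1 * u) * v + (q0 + q1 * u + q2 * u\<^sup>2)" for v
  have r: "is_unit_in r" unfolding r_def using unit_pow[OF unit_two] .
  have r1: "1 - r \<noteq> 0"
  proof
    assume "1 - r = 0"
    then have "(2::'a) ^ Suc i = 2 ^ 0" by (simp add: r_def)
    from injD[OF inj_power_2 this] show False by simp
  qed
  have u: "is_unit_in u" using r s0 by (auto simp: u_def)
  have rR: "1 - r \<in> R" using r by auto
  have s1: "congr (1 - r) (s * r) s" unfolding congr_def using r s0
    by (auto intro!: bexI[of _ "-s"] simp: algebra_simps)
  have "infinite {v. infinite {w. is_unit_in u \<and> v \<in> R \<and> w \<in> R \<and> is_unit_in (w * (a + b * u) + G v)}}"
  proof (rule infinite_Collect_inj[where f = "\<lambda>j. c + (1 - r) * 2 ^ j"])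
    show "inj (\<lambda>j::nat. c + (1 - r) * 2 ^ j)" using inj_power_2[where 'a='a] r1 by (auto simp: inj_def)
    fix j :: nat
    define v where "v = c + (1 - r) * 2 ^ j"
    have vR: "v \<in> R" using rR R by (auto simp: v_def)
    have vc: "congr (1 - r) v c" unfolding congr_def using vR R
      by (auto simp: v_def)
    have GR: "G v \<in> R" using vR u R by (auto simp: G_def)
    have M0: "a + b * u \<noteq> 0" and
      div: "(g * r ^ k - G v) / (a + b * u) \<in> R" for k
    proof -
      have "a + b * u \<noteq> 0 \<and> (g * r ^ k - G v) / (a + b * u) \<in> R"
        using cs
      proof (elim disjE conjE)
        assume *: "is_unit_in a" "a + b * s = 0" "p * c\<^sup>2 + (l0 + l1 * s) * c + (q0 + q1 * s + q2 * s\<^sup>2) = g"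
        have bs: "b * s = - a" using *(2) by (simp add: add_eq_0_iff)
        have M: "a + b * u = a * (1 - r)" unfolding u_def mult.assoc[symmetric] bs by (simp add: algebra_simps)
        have "congr (1 - r) (G v) (p * c\<^sup>2 + (l0 + l1 * s) * c + (q0 + q1 * s + q2 * s\<^sup>2))"
          unfolding G_def u_def using R by (intro congr_intros vc s1 congr_refl) auto
        then have "congr (1 - r) (g * r ^ k - G v) (g * 1 - g)"
          using *(3) g0 r by (intro congr_diff congr_mult unit_power_congr congr_refl) auto
        then obtain z where z: "z \<in> R" "g * r ^ k - G v = (1 - r) * z" by (auto simp: congr_def)
        have "a \<noteq> 0" using * unit_nz by auto
        then have "(g * r ^ k - G v) / (a + b * u) = z / a" unfolding z M using r1 by (simp add: field_simps)
        then show ?thesis using z * M r1 \<open>a \<noteq> 0\<close> by auto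
      next
        assume *: "is_unit_in a" "b = 0"
        then show ?thesis using GR g0 r unit_nz[OF *(1)] by auto
      next
        assume *: "a = 0" "is_unit_in b"
        have "is_unit_in (b * u)" using * u by auto
        then show ?thesis using * GR g0 r unit_nz[of "b * u"] by auto
      qed
      then show "a + b * u \<noteq> 0" "(g * r ^ k - G v) / (a + b * u) \<in> R" by auto
    qed
    show "infinite {w. is_unit_in u \<and> c + (1 - r) * 2 ^ j \<in> R \<and> w \<in> R \<and> is_unit_in (w * (a + b * u) + G (c + (1 - r) * 2 ^ j))}"
      unfolding v_def[symmetric]
    proof (rule infinite_Collect_inj[where f = "\<lambda>k. (g * r ^ k - G v) / (a + b * u)"])
      have "inj (\<lambda>k. r ^ k)"
      proof (rule injI)
        fix x y :: nat assume "r ^ x = r ^ y"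
        then have "(2::'a) ^ (Suc i * x) = 2 ^ (Suc i * y)" by (simp add: r_def power_mult del: power_Suc mult_Suc)
        from injD[OF inj_power_2 this] show "x = y" by (simp del: mult_Suc)
      qed
      then show "inj (\<lambda>k. (g * r ^ k - G v) / (a + b * u))"
        using M0 unit_nz[OF g0] by (auto simp: inj_def)
      fix k
      have "(g * r ^ k - G v) / (a + b * u) * (a + b * u) + G v = g * r ^ k" using M0 by simp
      then show "is_unit_in u \<and> v \<in> R \<and> (g * r ^ k - G v) / (a + b * u) \<in> R \<and>
         is_unit_in ((g * r ^ k - G v) / (a + b * u) * (a + b * u) + G v)"
        using u vR div g0 r by auto
    qed
  qed
  then show "infinite {v. infinite {w. is_unit_in (s * 2 ^ Suc i) \<and> v \<in> R \<and> w \<in> R \<and>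
      is_unit_in (w * (a + b * (s * 2 ^ Suc i)) + (p * v\<^sup>2 + (l0 + l1 * (s * 2 ^ Suc i)) * v + (q0 + q1 * (s * 2 ^ Suc i) + q2 * (s * 2 ^ Suc i)\<^sup>2)))}}"
    by (simp add: G_def u_def r_def)
qed

text \<open>
  Modulo \<open>\<delta> = a c - b\<^sup>2\<close> the number \<open>b\<close> plays the role of a square root \<open>\<theta>\<close> of \<open>a c\<close>.  The choice of \<open>b\<close>
  makes \<open>\<epsilon> (\<theta> - b) = (1 + x2 \<theta>)\<^sup>2 - d \<nu>\<^sup>2\<close>, where \<open>d\<close> is the discriminant of the quadratic polynomial in \<open>t\<close>
  that has to vanish modulo \<open>\<delta>\<close>; so \<open>d\<close> becomes a square modulo \<open>\<delta>\<close>.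
\<close>

lemma fibre_solutions:
  assumes R: "{a, c, g1, g2, L1, L2, M1, M2, d0, d1, b} \<subseteq> R"
    and eps: "is_unit_in eps" and e: "is_unit_in e"
    and nu: "nu = a * g2\<^sup>2 - c * g1\<^sup>2" and x2: "x2 = (eps + a * d1 * nu\<^sup>2) / 2"
    and b: "b = - (1 + a * c * x2\<^sup>2 - a * d0 * nu\<^sup>2) / eps"
    and dlt: "dlt = a * c - b\<^sup>2" and dlt0: "dlt \<noteq> 0"
    and disc: "congr dlt ((a * L2 - b * L1)\<^sup>2 - 4 * (a * g2 - b * g1) * (a * M2 - b * M1)) (a * (d0 + d1 * b))"
    and nue: "congr nu (1 - a * c * eps\<^sup>2 / 4) e"
  obtains t0 where "t0 \<in> R"
    "\<And>z. z \<in> R \<Longrightarrow> \<exists>x0\<in>R. \<exists>x1\<in>R. let t = t0 + dlt * z in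
       a * x0 + b * x1 + (g1 * t\<^sup>2 + L1 * t + M1) = 0 \<and> b * x0 + c * x1 + (g2 * t\<^sup>2 + L2 * t + M2) = 0"
proof -
  have mem: "a \<in> R" "c \<in> R" "g1 \<in> R" "g2 \<in> R" "L1 \<in> R" "L2 \<in> R" "M1 \<in> R" "M2 \<in> R" "d0 \<in> R" "d1 \<in> R" "b \<in> R"
    using R by auto
  have epsR: "eps \<in> R" "eps \<noteq> 0" using eps unit_nz by auto
  have nuR: "nu \<in> R" using mem nu by simp
  have x2R: "x2 \<in> R" unfolding x2 using mem nuR epsR by (intro half_mem) simp
  have dR: "dlt \<in> R" using mem dlt by simp
  define n0 where "n0 = 1 + a * c * x2\<^sup>2 - a * d0 * nu\<^sup>2"
  have n0R: "n0 \<in> R" using mem nuR x2R by (simp add: n0_def)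
  have beps: "b * eps = - n0" using b epsR by (simp add: n0_def)
  have x22: "2 * x2 = eps + a * d1 * nu\<^sup>2" unfolding x2 by simp
  define A B C X where "A = a * g2 - b * g1" and "B = a * L2 - b * L1" and "C = a * M2 - b * M1"
    and "X = 1 + x2 * b"
  have ABC: "A \<in> R" "B \<in> R" "C \<in> R" "X \<in> R" using mem x2R by (auto simp: A_def B_def C_def X_def)
  \<comment> \<open>All corrections to 1 in \<open>n0\<close> are multiples of \<open>a\<close>;
    this is why the discriminant is wanted with the factor \<open>a\<close> split off. The
    congruence is also the Bezout relation of \<open>a\<close> and \<open>b\<close> used at the
    end.\<close>
  have ba: "congr a (b * eps) (- 1)"
  proof -
    have "- n0 - - 1 = a * (d0 * nu\<^sup>2 - c * x2\<^sup>2)" by (simp add: n0_def algebra_simps)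
    moreover have "- n0 \<in> R" "d0 * nu\<^sup>2 - c * x2\<^sup>2 \<in> R" using n0R mem nuR x2R by auto
    ultimately show ?thesis unfolding beps congr_def by blast
  qed
  \<comment> \<open>Modulo \<open>a\<close> the determinant is -b^2, and b eps is -1. So the
    determinant is a unit modulo \<open>a\<close>, and swapping makes \<open>a\<close> invertible
    modulo the determinant.\<close>
  have "congr a (dlt * eps\<^sup>2) (- 1)"
  proof -
    have "congr a (a * (c * eps\<^sup>2) - (b * eps)\<^sup>2) (0 - (- 1)\<^sup>2)"
      by (intro congr_diff congr_pow ba congr_self) (use mem epsR in auto)
    then show ?thesis by (simp add: dlt algebra_simps power_mult_distrib)
  qed
  then have "congr a (dlt * eps\<^sup>2 * inverse (eps\<^sup>2)) (- 1 * inverse (eps\<^sup>2))"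
    by (intro congr_mult congr_refl) (use eps in auto)
  moreover have cancel: "dlt * eps\<^sup>2 * inverse (eps\<^sup>2) = dlt" using epsR by simp
  ultimately have "congr a dlt (- inverse (eps\<^sup>2))" by (simp only: cancel mult_minus1)
  then have inva: "inv_mod dlt a" by (rule inv_mod_swap) (use eps mem in auto)
  \<comment> \<open>Modulo \<open>nu\<close>, \<open>x2\<close> is eps/2. With y = a c eps^2 / 4 the
    left side becomes 4 y - (1 + y)^2 = -(1 - y)^2, and 1 - y is the unit \<open>e\<close>
    there.\<close>
  have "congr nu (dlt * (eps\<^sup>2)) (- (e\<^sup>2))"
  proof -
    have "congr nu (x2 * 2) eps"
      unfolding congr_def using x2R epsR x22
      by (auto simp: algebra_simps power2_eq_square intro!: bexI[of _ "a * d1 * nu"] mem nuR mult)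
    then have "congr nu (x2 * 2 * (1 / 2)) (eps * (1 / 2))"
      by (intro congr_mult congr_refl) auto
    then have x2n: "congr nu x2 (eps / 2)" by simp
    have "congr nu (1 + a * c * x2\<^sup>2 - nu * (a * d0 * nu)) (1 + a * c * (eps / 2)\<^sup>2 - 0)"
      by (intro congr_intros congr_refl x2n congr_self) (use mem nuR in auto)
    then have n0n: "congr nu n0 (1 + a * c * (eps / 2)\<^sup>2)"
      by (simp add: n0_def power2_eq_square mult_ac)
    have "congr nu (a * c * eps\<^sup>2 - n0\<^sup>2) (a * c * eps\<^sup>2 - (1 + a * c * (eps / 2)\<^sup>2)\<^sup>2)"
      by (intro congr_intros congr_refl n0n) (use mem epsR in auto)
    moreover have "a * c * eps\<^sup>2 - (1 + a * c * (eps / 2)\<^sup>2)\<^sup>2 = - ((1 - a * c * eps\<^sup>2 / 4)\<^sup>2)"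
      by (simp add: power2_eq_square field_simps)
    moreover have "a * c * eps\<^sup>2 - n0\<^sup>2 = dlt * (eps\<^sup>2)"
    proof -
      have "n0\<^sup>2 = (b * eps)\<^sup>2" unfolding beps by simp
      then show ?thesis by (simp add: dlt algebra_simps power_mult_distrib)
    qed
    ultimately have "congr nu (dlt * (eps\<^sup>2)) (- ((1 - a * c * eps\<^sup>2 / 4)\<^sup>2))" by simp
    also have "congr nu \<dots> (- (e\<^sup>2))" by (intro congr_minus congr_pow nue)
    finally show ?thesis .
  qed
  then have "congr nu (dlt * eps\<^sup>2 * inverse (eps\<^sup>2)) (- (e\<^sup>2) * inverse (eps\<^sup>2))"
    by (intro congr_mult congr_refl) (use eps in auto)
  then have "congr nu dlt (- (e\<^sup>2 * inverse (eps\<^sup>2)))" by (simp only: cancel mult_minus_left)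
  then have invnu: "inv_mod dlt nu"
    by (rule inv_mod_swap) (use eps e nuR in \<open>auto simp only: unit_minus intro!: unit_mult unit_pow unit_inverse\<close>)
  \<comment> \<open>The product \<open>a * nu\<close> is the norm of the leading coefficient
    \<open>A\<close>: the second factor has -b in place of b, and b^2 is a c modulo
    \<open>dlt\<close>.\<close>
  have "congr dlt (a * nu) (A * (a * g2 + b * g1))"
    unfolding congr_def using mem nuR ABC
    by (auto simp: A_def nu dlt power2_eq_square algebra_simps intro!: bexI[of _ "- (g1\<^sup>2)"])
  then have invA: "inv_mod dlt A"
    by (rule inv_mod_factor[OF inv_mod_mult[OF inva invnu]]) (use ABC mem in auto)
  have sq: "congr dlt (X\<^sup>2) ((B\<^sup>2 - 4 * A * C) * nu\<^sup>2)"
  proof -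
    have "X\<^sup>2 - a * (d0 + d1 * b) * nu\<^sup>2 = n0 + eps * b - x2\<^sup>2 * dlt"
    proof -
      have "X\<^sup>2 - a * (d0 + d1 * b) * nu\<^sup>2 = 1 + (2 * x2) * b + x2\<^sup>2 * b\<^sup>2 - a * (d0 + d1 * b) * nu\<^sup>2"
        by (simp add: X_def power2_eq_square algebra_simps)
      also have "\<dots> = n0 + eps * b - x2\<^sup>2 * dlt"
        unfolding x22 by (simp add: n0_def dlt algebra_simps)
      finally show ?thesis .
    qed
    also have "\<dots> = dlt * (- (x2\<^sup>2))" using beps by (simp add: algebra_simps)
    finally have "congr dlt (X\<^sup>2) (a * (d0 + d1 * b) * nu\<^sup>2)"
      unfolding congr_def using mem ABC nuR x2R by (auto intro!: bexI[of _ "- (x2\<^sup>2)"])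
    also have "congr dlt (a * (d0 + d1 * b) * nu\<^sup>2) ((B\<^sup>2 - 4 * A * C) * nu\<^sup>2)"
      using disc unfolding A_def B_def C_def by (intro congr_mult congr_refl congr_sym[OF disc]) (use nuR in auto)
    finally show ?thesis .
  qed
  obtain i where i: "i \<in> R" "congr dlt (2 * A * nu * i) 1"
    using inv_mod_mult[OF inv_mod_mult[OF inv_mod_unit[OF unit_two] invA] invnu] by (auto simp: inv_mod_def)
  \<comment> \<open>The quadratic formula, with X / nu as square root of the discriminant and
    \<open>i\<close> as inverse of 2 A nu.\<close>
  define t0 where "t0 = (X - B * nu) * i"
  have t0R: "t0 \<in> R" using ABC nuR i by (simp add: t0_def)
  have root: "congr dlt (A * t0\<^sup>2 + B * t0 + C) 0"
  proof -
    have "congr dlt (2 * A * nu * i * (X - B * nu)) (1 * (X - B * nu))"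
      by (intro congr_mult i congr_refl) (use ABC nuR in auto)
    then have "congr dlt (2 * A * nu * t0) (X - B * nu)" by (simp add: t0_def mult_ac)
    then have "congr dlt (2 * A * nu * t0 + B * nu) (X - B * nu + B * nu)"
      by (intro congr_add congr_refl) (use ABC nuR in auto)
    then have "congr dlt ((2 * A * nu * t0 + B * nu)\<^sup>2) (X\<^sup>2)" by (intro congr_pow) simp
    also note sq
    finally have "congr dlt ((2 * A * nu * t0 + B * nu)\<^sup>2 - (B\<^sup>2 - 4 * A * C) * nu\<^sup>2)
        ((B\<^sup>2 - 4 * A * C) * nu\<^sup>2 - (B\<^sup>2 - 4 * A * C) * nu\<^sup>2)"
      by (intro congr_diff congr_refl) (use ABC nuR in auto)
    moreover have "(2 * A * nu * t0 + B * nu)\<^sup>2 - (B\<^sup>2 - 4 * A * C) * nu\<^sup>2 = (4 * A * (nu * nu)) * (A * t0\<^sup>2 + B * t0 + C)"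
      by (simp add: power2_eq_square algebra_simps)
    ultimately have "congr dlt ((4 * A * (nu * nu)) * (A * t0\<^sup>2 + B * t0 + C)) 0" by simp
    then show ?thesis
      by (rule inv_mod_cancel[OF inv_mod_mult[OF inv_mod_mult[OF inv_mod_unit[OF unit_four] invA] inv_mod_mult[OF invnu invnu]]])
        (use ABC t0R in auto)
  qed
  show thesis
  proof (rule that[OF t0R])
    fix z assume z: "z \<in> R"
    define t where "t = t0 + dlt * z"
    have tR: "t \<in> R" using t0R dR z by (simp add: t_def)
    have tt: "congr dlt t t0" unfolding congr_def t_def using t0R dR z by auto
    have "congr dlt (A * t\<^sup>2 + B * t + C) (A * t0\<^sup>2 + B * t0 + C)"
      by (intro congr_intros tt congr_refl) (use ABC in auto)
    also note root
    finally obtain k where k: "k \<in> R" "A * t\<^sup>2 + B * t + C = dlt * k" by (auto simp: congr_def)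
    obtain w where w: "w \<in> R" "b * eps + 1 = a * w" using ba by (auto simp: congr_def)
    define F1 F2 where "F1 = g1 * t\<^sup>2 + L1 * t + M1" and "F2 = g2 * t\<^sup>2 + L2 * t + M2"
    have FR: "F1 \<in> R" "F2 \<in> R" using mem tR by (auto simp: F1_def F2_def)
    have F: "a * F2 - b * F1 = dlt * k" unfolding k(2)[symmetric]
      by (simp add: F1_def F2_def A_def B_def C_def algebra_simps)
    define x1 where "x1 = - k"
    \<comment> \<open>With x1 = -k the two right-hand sides are proportional to (a, b). The relation
      a w - b eps = 1 then yields one x0 that solves both equations.\<close>
    define x0 where "x0 = w * (- F1 - b * x1) - eps * (- F2 - c * x1)"
    have one: "a * w - b * eps = 1" using w(2) by (simp add: algebra_simps)
    have cross: "b * (- F1 - b * x1) = a * (- F2 - c * x1)"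
      using F by (simp add: x1_def dlt algebra_simps power2_eq_square)
    have "a * x0 = a * w * (- F1 - b * x1) - eps * (a * (- F2 - c * x1))"
      by (simp add: x0_def algebra_simps)
    also have "\<dots> = (a * w - b * eps) * (- F1 - b * x1)" unfolding cross[symmetric] by (simp add: algebra_simps)
    finally have e1: "a * x0 + b * x1 + F1 = 0" unfolding one by simp
    have "b * x0 = w * (b * (- F1 - b * x1)) - b * eps * (- F2 - c * x1)"
      by (simp add: x0_def algebra_simps)
    also have "\<dots> = (a * w - b * eps) * (- F2 - c * x1)" unfolding cross by (simp add: algebra_simps)
    finally have e2: "b * x0 + c * x1 + F2 = 0" unfolding one by simp
    have "x0 \<in> R" "x1 \<in> R" using FR mem w k epsR by (auto simp: x0_def x1_def)
    then show "\<exists>x0\<in>R. \<exists>x1\<in>R. let t = t0 + dlt * z in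
       a * x0 + b * x1 + (g1 * t\<^sup>2 + L1 * t + M1) = 0 \<and> b * x0 + c * x1 + (g2 * t\<^sup>2 + L2 * t + M2) = 0"
      using e1 e2 unfolding F1_def F2_def t_def Let_def by blast
  qed
qed

text \<open>Reduction in R[b] / (b^2 - q). The coefficients must not depend on \<open>b\<close>,
  because \<open>b\<close> is chosen afterwards in terms of them and fixes the modulus at the same
  time.\<close>

definition affine_mod :: "'a \<Rightarrow> ('a \<Rightarrow> 'a) \<Rightarrow> bool" where
  "affine_mod q f \<longleftrightarrow> (\<exists>f0\<in>R. \<exists>f1\<in>R. \<forall>b\<in>R. congr (q - b\<^sup>2) (f b) (f0 + f1 * b))"

lemma affine_mod_const: "x \<in> R \<Longrightarrow> affine_mod q (\<lambda>b. x)"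
  unfolding affine_mod_def by (rule bexI[of _ x], rule bexI[of _ 0]) (auto intro: congr_refl)

lemma affine_mod_id: "affine_mod q (\<lambda>b. b)"
  unfolding affine_mod_def by (rule bexI[of _ 0], rule bexI[of _ 1]) (auto intro: congr_refl)

lemma affine_mod_add:
  assumes "affine_mod q f" "affine_mod q g" shows "affine_mod q (\<lambda>b. f b + g b)"
proof -
  obtain f0 f1 g0 g1 where *: "f0 \<in> R" "f1 \<in> R" "g0 \<in> R" "g1 \<in> R"
    "\<forall>b\<in>R. congr (q - b\<^sup>2) (f b) (f0 + f1 * b)" "\<forall>b\<in>R. congr (q - b\<^sup>2) (g b) (g0 + g1 * b)"
    using assms unfolding affine_mod_def by blast
  have "congr (q - b\<^sup>2) (f b + g b) ((f0 + g0) + (f1 + g1) * b)" if "b \<in> R" for b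
    using congr_add[of "q - b\<^sup>2" "f b" "f0 + f1 * b" "g b" "g0 + g1 * b"] * that by (simp add: algebra_simps)
  then show ?thesis unfolding affine_mod_def using * add by blast
qed

lemma affine_mod_mult:
  assumes "affine_mod q f" "affine_mod q g" "q \<in> R" shows "affine_mod q (\<lambda>b. f b * g b)"
proof -
  obtain f0 f1 g0 g1 where *: "f0 \<in> R" "f1 \<in> R" "g0 \<in> R" "g1 \<in> R"
    "\<forall>b\<in>R. congr (q - b\<^sup>2) (f b) (f0 + f1 * b)" "\<forall>b\<in>R. congr (q - b\<^sup>2) (g b) (g0 + g1 * b)"
    using assms unfolding affine_mod_def by blast
  have "congr (q - b\<^sup>2) (f b * g b) ((f0 * g0 + f1 * g1 * q) + (f0 * g1 + f1 * g0) * b)" if "b \<in> R" for b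
  proof -
    have "congr (q - b\<^sup>2) (f b * g b) ((f0 + f1 * b) * (g0 + g1 * b))"
      using * that by (intro congr_mult) auto
    also have "congr (q - b\<^sup>2) ((f0 + f1 * b) * (g0 + g1 * b)) ((f0 * g0 + f1 * g1 * q) + (f0 * g1 + f1 * g0) * b)"
      unfolding congr_def using * that assms(3)
      by (auto intro!: bexI[of _ "- (f1 * g1)"] simp: algebra_simps power2_eq_square)
    finally show ?thesis .
  qed
  then show ?thesis unfolding affine_mod_def
    using * assms(3) add mult by (intro bexI[of _ "f0 * g0 + f1 * g1 * q"] bexI[of _ "f0 * g1 + f1 * g0"]) auto
qed

lemma affine_mod_diff:
  assumes "affine_mod q f" "affine_mod q g" "q \<in> R" shows "affine_mod q (\<lambda>b. f b - g b)"
  using affine_mod_add[OF assms(1) affine_mod_mult[OF affine_mod_const[of "-1"] assms(2,3)]] by simp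

text \<open>After expansion every term contains \<open>a\<close> or b^2, and b^2 is a c modulo the
  determinant; so a factor \<open>a\<close> splits off, and the cofactor \<open>D\<close> reduces to
  an affine function of \<open>b\<close>.\<close>

lemma discriminant_mod:
  assumes R: "{a, c, g1, g2} \<subseteq> R" and L: "affine_mod (a * c) L1" "affine_mod (a * c) L2"
    "affine_mod (a * c) M1" "affine_mod (a * c) M2"
    and LR: "\<And>b. b \<in> R \<Longrightarrow> L1 b \<in> R \<and> L2 b \<in> R \<and> M1 b \<in> R \<and> M2 b \<in> R"
  obtains d0 d1 where "d0 \<in> R" "d1 \<in> R"
    "\<And>b. b \<in> R \<Longrightarrow> congr (a * c - b\<^sup>2) ((a * L2 b - b * L1 b)\<^sup>2 - 4 * (a * g2 - b * g1) * (a * M2 b - b * M1 b))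
       (a * (d0 + d1 * b))"
proof -
  define D where "D b = a * (L2 b * L2 b) - 2 * (b * (L1 b * L2 b)) + c * (L1 b * L1 b)
     - 4 * (a * g2 * M2 b - b * (g2 * M1 b) - b * (g1 * M2 b) + c * g1 * M1 b)" for b
  have mem: "a \<in> R" "c \<in> R" "g1 \<in> R" "g2 \<in> R" using R by auto
  have "affine_mod (a * c) D" unfolding D_def
    by (intro affine_mod_add affine_mod_diff affine_mod_mult affine_mod_const affine_mod_id L) (use mem in auto)
  then obtain d0 d1 where d: "d0 \<in> R" "d1 \<in> R" "\<And>b. b \<in> R \<Longrightarrow> congr (a * c - b\<^sup>2) (D b) (d0 + d1 * b)"
    unfolding affine_mod_def by blast
  show thesis
  proof (rule that[OF d(1,2)])
    fix b assume b: "b \<in> R"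
    have "congr (a * c - b\<^sup>2) ((a * L2 b - b * L1 b)\<^sup>2 - 4 * (a * g2 - b * g1) * (a * M2 b - b * M1 b)) (a * D b)"
      unfolding congr_def using mem LR[OF b] b
      by (auto intro!: bexI[of _ "- (L1 b * L1 b) + 4 * (g1 * M1 b)"] simp: D_def algebra_simps power2_eq_square)
    also have "congr (a * c - b\<^sup>2) (a * D b) (a * (d0 + d1 * b))"
      by (intro congr_mult d congr_refl mem b)
    finally show "congr (a * c - b\<^sup>2) ((a * L2 b - b * L1 b)\<^sup>2 - 4 * (a * g2 - b * g1) * (a * M2 b - b * M1 b)) (a * (d0 + d1 * b))" .
  qed
qed

text \<open>By \<open>nudvd\<close>, \<open>nu\<close> divides 1 - r for u = us r; hence u is
  \<open>us\<close> and every power of \<open>r\<close> is 1 modulo \<open>nu\<close>. So eps = kap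
  r^j meets the unit condition of \<open>fibre_solutions\<close> for every j. Each j yields a value
  of \<open>b\<close>, and each such \<open>b\<close> with nonzero determinant yields a residue
  class of t.\<close>

lemma exceptional_family:
  fixes L1 L2 M1 M2 :: "'a \<Rightarrow> 'a \<Rightarrow> 'a"
    and a0 a1 c0 c1 :: 'a
  defines "a \<equiv> \<lambda>u. a0 + a1 * u" and "c \<equiv> \<lambda>u. c0 + c1 * u"
  assumes R: "{a0, a1, c0, c1, g1, g2} \<subseteq> R"
    and us: "is_unit_in us" and kap: "is_unit_in kap" and e: "is_unit_in (1 - a us * c us * kap\<^sup>2 / 4)"
    and nz: "a0 \<noteq> 0 \<or> a1 \<noteq> 0" "c0 \<noteq> 0 \<or> c1 \<noteq> 0"
    and nudvd: "\<And>r. is_unit_in r \<Longrightarrow> \<exists>w\<in>R. 1 - r = (a (us * r) * g2\<^sup>2 - c (us * r) * g1\<^sup>2) * w"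
    and L: "\<And>u q. u \<in> R \<Longrightarrow> q \<in> R \<Longrightarrow> affine_mod q (L1 u) \<and> affine_mod q (L2 u) \<and> affine_mod q (M1 u) \<and> affine_mod q (M2 u)"
    and LR: "\<And>u b. u \<in> R \<Longrightarrow> b \<in> R \<Longrightarrow> L1 u b \<in> R \<and> L2 u b \<in> R \<and> M1 u b \<in> R \<and> M2 u b \<in> R"
  shows "nested_infinite (\<lambda>u b t. is_unit_in u \<and> b \<in> R \<and> t \<in> R \<and> a u * c u - b\<^sup>2 \<noteq> 0 \<and>
    (\<exists>x0\<in>R. \<exists>x1\<in>R. a u * x0 + b * x1 + (g1 * t\<^sup>2 + L1 u b * t + M1 u b) = 0 \<and>
       b * x0 + c u * x1 + (g2 * t\<^sup>2 + L2 u b * t + M2 u b) = 0))" (is "nested_infinite ?P")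
proof -
  have mem: "a0 \<in> R" "a1 \<in> R" "c0 \<in> R" "c1 \<in> R" "g1 \<in> R" "g2 \<in> R" using R by auto
  have us0: "us \<noteq> 0" and usR: "us \<in> R" and kap0: "kap \<noteq> 0" and kapR: "kap \<in> R" using us kap unit_nz by auto
  \<comment> \<open>Zeros of \<open>a\<close> and \<open>c\<close> are discarded because the
    quadratic equation for the \<open>s\<close> that lead to a given \<open>b\<close> has leading
    coefficient a c kap^2 / 4; it has to be nonzero for \<open>b\<close> to take infinitely many
    values.\<close>
  define U where "U = range (\<lambda>i. us * 2 ^ Suc i) - {u. a u = 0} - {u. c u = 0}"
  have "finite {u. a u = 0}" "finite {u. c u = 0}"
    using finite_quadratic_roots[of 0 a1 a0] finite_quadratic_roots[of 0 c1 c0] nz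
    by (cases "a1 = 0"; cases "c1 = 0"; simp add: a_def c_def add.commute)+
  moreover have "inj (\<lambda>i. us * 2 ^ Suc i)"
    using inj_power_2[where 'a='a] us0 by (auto simp: inj_def)
  ultimately have Uinf: "infinite U"
    unfolding U_def by (intro Diff_infinite_finite range_inj_infinite)
  have "infinite {b. infinite {t. ?P u b t}}" if uU: "u \<in> U" for u
  proof -
    obtain i where u: "u = us * 2 ^ Suc i" using uU unfolding U_def by blast
    define r :: 'a where "r = 2 ^ Suc i"
    have r: "is_unit_in r" unfolding r_def using unit_pow[OF unit_two] .
    have ur: "u = us * r" by (simp add: u r_def)
    have uu: "is_unit_in u" unfolding ur using us r by auto
    have ac0: "a u \<noteq> 0" "c u \<noteq> 0" using uU by (auto simp: U_def)
    have acR: "a u \<in> R" "c u \<in> R" using mem uu by (auto simp: a_def c_def)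
    define nu where "nu = a u * g2\<^sup>2 - c u * g1\<^sup>2"
    have nuR: "nu \<in> R" using mem acR by (simp add: nu_def)
    obtain w where w: "w \<in> R" "1 - r = nu * w" using nudvd[OF r] by (auto simp: nu_def ur)
    obtain d0 d1 where d: "d0 \<in> R" "d1 \<in> R"
      "\<And>b. b \<in> R \<Longrightarrow> congr (a u * c u - b\<^sup>2) ((a u * L2 u b - b * L1 u b)\<^sup>2
         - 4 * (a u * g2 - b * g1) * (a u * M2 u b - b * M1 u b)) (a u * (d0 + d1 * b))"
      by (rule discriminant_mod[of "a u" "c u" g1 g2 "L1 u" "L2 u" "M1 u" "M2 u"])
        (use acR mem L LR uu in auto)
    define D where "D = a u * d1 * nu\<^sup>2"
    \<comment> \<open>The value of \<open>b\<close> that \<open>fibre_solutions\<close> imposes when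
      eps = kap s.\<close>
    define f where "f s = - (1 + a u * c u * ((kap * s + D) / 2)\<^sup>2 - a u * d0 * nu\<^sup>2) / (kap * s)" for s
    define S where "S = range (\<lambda>j. r ^ j)"
    have "inj (\<lambda>k. r ^ k)"
    proof (rule injI)
      fix x y :: nat assume "r ^ x = r ^ y"
      then have "(2::'a) ^ (Suc i * x) = 2 ^ (Suc i * y)" by (simp add: r_def power_mult del: power_Suc mult_Suc)
      from injD[OF inj_power_2 this] show "x = y" by (simp del: mult_Suc)
    qed
    then have Sinf: "infinite S" unfolding S_def by (rule range_inj_infinite)
    have fib: "finite {s \<in> S. f s = b}" for b
    proof (rule finite_subset)
      show "{s \<in> S. f s = b} \<subseteq> {s. (a u * c u * kap\<^sup>2 / 4) * s\<^sup>2 + (a u * c u * kap * D / 2 + kap * b) * s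
          + (1 + a u * c u * D\<^sup>2 / 4 - a u * d0 * nu\<^sup>2) = 0}"
      proof
        fix s assume "s \<in> {s \<in> S. f s = b}"
        then have s: "s \<in> S" "f s = b" by auto
        then obtain j where "s = r ^ j" by (auto simp: S_def)
        then have "s \<noteq> 0" using unit_nz[OF unit_pow[OF r, of j]] by simp
        then have "kap * s * b = - (1 + a u * c u * ((kap * s + D) / 2)\<^sup>2 - a u * d0 * nu\<^sup>2)"
          using s(2) kap0 by (auto simp: f_def)
        moreover have "(a u * c u * kap\<^sup>2 / 4) * s\<^sup>2 + (a u * c u * kap * D / 2 + kap * b) * s
            + (1 + a u * c u * D\<^sup>2 / 4 - a u * d0 * nu\<^sup>2)
          = kap * s * b + (1 + a u * c u * ((kap * s + D) / 2)\<^sup>2 - a u * d0 * nu\<^sup>2)"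
          by (simp add: power2_eq_square field_simps)
        ultimately show "s \<in> {s. (a u * c u * kap\<^sup>2 / 4) * s\<^sup>2 + (a u * c u * kap * D / 2 + kap * b) * s
          + (1 + a u * c u * D\<^sup>2 / 4 - a u * d0 * nu\<^sup>2) = 0}"
          by simp
      qed
      show "finite {s. (a u * c u * kap\<^sup>2 / 4) * s\<^sup>2 + (a u * c u * kap * D / 2 + kap * b) * s
          + (1 + a u * c u * D\<^sup>2 / 4 - a u * d0 * nu\<^sup>2) = 0}"
        by (rule finite_quadratic_roots) (use ac0 kap0 in auto)
    qed
    have "infinite (f ` S)"
    proof
      assume "finite (f ` S)"
      from pigeonhole_infinite[OF Sinf this] obtain s0 where "infinite {s \<in> S. f s = f s0}" by auto
      with fib show False by blast
    qed
    moreover have "finite {b. a u * c u - b\<^sup>2 = 0}"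
      using finite_quadratic_roots[of "-1" 0 "a u * c u"] by simp
    ultimately have "infinite (f ` S - {b. a u * c u - b\<^sup>2 = 0})" by (rule Diff_infinite_finite[rotated])
    moreover have "f ` S - {b. a u * c u - b\<^sup>2 = 0} \<subseteq> {b. infinite {t. ?P u b t}}"
    proof
      fix b assume b: "b \<in> f ` S - {b. a u * c u - b\<^sup>2 = 0}"
      then obtain j where j: "b = f (r ^ j)" by (auto simp: S_def)
      define s where "s = r ^ j"
      define eps where "eps = kap * s"
      have sU: "is_unit_in s" unfolding s_def using r by auto
      have epsU: "is_unit_in eps" unfolding eps_def using kap sU by auto
      define dlt where "dlt = a u * c u - b\<^sup>2"
      define x2 where "x2 = (eps + a u * d1 * nu\<^sup>2) / 2"
      have dlt0: "dlt \<noteq> 0" using b by (auto simp: dlt_def)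
      have bb: "b = - (1 + a u * c u * x2\<^sup>2 - a u * d0 * nu\<^sup>2) / eps"
        by (simp add: j f_def s_def[symmetric] eps_def x2_def D_def)
      have x2R: "x2 \<in> R" unfolding x2_def using acR d nuR epsU by (intro half_mem) auto
      have bR: "b \<in> R" unfolding bb using acR x2R d nuR epsU by (intro unit_div) auto
      have "congr (1 - r) s 1" unfolding s_def using r by (intro unit_power_congr) auto
      then have s1: "congr nu s 1" unfolding w(2) using w(1) congr_dvd by blast
      have r1: "congr nu r 1" unfolding congr_def using r w by (auto intro!: bexI[of _ "- w"] simp: algebra_simps)
      have u1: "congr nu u us"
      proof -
        have "congr nu (us * r) (us * 1)" by (intro congr_mult r1 congr_refl usR)
        then show ?thesis by (simp add: ur)
      qed
      have nue: "congr nu (1 - a u * c u * eps\<^sup>2 / 4) (1 - a us * c us * kap\<^sup>2 / 4)"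
      proof -
        have "congr nu (1 - (a0 + a1 * u) * (c0 + c1 * u) * (kap * s)\<^sup>2 * (1 / 4)) (1 - (a0 + a1 * us) * (c0 + c1 * us) * (kap * 1)\<^sup>2 * (1 / 4))"
          by (intro congr_intros congr_refl s1 u1) (use mem kapR in auto)
        then show ?thesis by (simp add: a_def c_def eps_def)
      qed
      obtain t0 where t0: "t0 \<in> R"
        "\<And>z. z \<in> R \<Longrightarrow> \<exists>x0\<in>R. \<exists>x1\<in>R. let t = t0 + dlt * z in
          a u * x0 + b * x1 + (g1 * t\<^sup>2 + L1 u b * t + M1 u b) = 0 \<and> b * x0 + c u * x1 + (g2 * t\<^sup>2 + L2 u b * t + M2 u b) = 0"
        by (rule fibre_solutions[of "a u" "c u" g1 g2 "L1 u b" "L2 u b" "M1 u b" "M2 u b" d0 d1 b eps _ nu x2 dlt,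
              OF _ epsU e nu_def x2_def bb dlt_def dlt0 d(3)[OF bR, folded dlt_def] nue])
          (use acR mem LR[OF unit_mem[OF uu] bR] d bR in auto)
      have "infinite {t. ?P u b t}"
      proof (rule infinite_Collect_inj[where f = "\<lambda>n. t0 + dlt * 2 ^ n"])
        show "inj (\<lambda>n::nat. t0 + dlt * 2 ^ n)" using inj_power_2[where 'a='a] dlt0 by (auto simp: inj_def)
        fix n :: nat
        have "t0 + dlt * 2 ^ n \<in> R" using t0 acR bR by (simp add: dlt_def)
        then show "?P u b (t0 + dlt * 2 ^ n)" using t0(2)[of "2 ^ n"] uu bR dlt0
          unfolding Let_def dlt_def by auto
      qed
      then show "b \<in> {b. infinite {t. ?P u b t}}" by simp
    qed
    ultimately show ?thesis using infinite_super by blast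
  qed
  then have "U \<subseteq> {u. infinite {b. infinite {t. ?P u b t}}}" by blast
  then show ?thesis unfolding nested_infinite_def using Uinf infinite_super by blast
qed

end

section \<open>Number fields\<close>

interpretation Q: vector_space "\<lambda>(q::rat) (x::qbar). of_rat q * x"
  by standard (simp_all add: of_rat_add of_rat_mult algebra_simps)

lemma number_field_span:
  assumes "number_field K"
  obtains B where "finite B" "K = Q.span B"
proof -
  obtain B where B: "finite B" "K = {(\<Sum>b\<in>B. of_rat (c b) * b) | c. True}"
    using assms unfolding number_field_def by blast
  have "K = Q.span B" unfolding B(2) Q.span_finite[OF B(1)] by blast
  then show thesis using that B(1) by blast
qed

lemma number_fieldD:
  assumes "number_field K"
  shows number_field_0: "0 \<in> K" and number_field_1: "1 \<in> K"
    and number_field_add: "x \<in> K \<Longrightarrow> y \<in> K \<Longrightarrow> x + y \<in> K"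
    and number_field_mult: "x \<in> K \<Longrightarrow> y \<in> K \<Longrightarrow> x * y \<in> K"
    and number_field_minus: "x \<in> K \<Longrightarrow> - x \<in> K"
    and number_field_inverse: "x \<in> K \<Longrightarrow> inverse x \<in> K"
proof -
  note * = assms[unfolded number_field_def]
  note ** = *[THEN conjunct1] *[THEN conjunct2, THEN conjunct1] *[THEN conjunct2, THEN conjunct2, THEN conjunct1]
    *[THEN conjunct2, THEN conjunct2, THEN conjunct2, THEN conjunct1]
  show "0 \<in> K" "1 \<in> K" "x \<in> K \<Longrightarrow> y \<in> K \<Longrightarrow> x + y \<in> K" "x \<in> K \<Longrightarrow> y \<in> K \<Longrightarrow> x * y \<in> K"
    "x \<in> K \<Longrightarrow> - x \<in> K" "x \<in> K \<Longrightarrow> inverse x \<in> K"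
    using ** by blast+
qed

lemma number_field_of_rat:
  assumes "number_field K" shows "of_rat q \<in> K"
proof -
  obtain B where B: "finite B" "K = Q.span B" using number_field_span[OF assms] .
  have "of_rat q * 1 \<in> Q.span B" using number_field_1[OF assms] B Q.span_scale by blast
  then show ?thesis using B by simp
qed

lemma to_ac_eq_of_rat: "to_ac (q::rat) = of_rat q"
proof -
  obtain a b where ab: "quotient_of q = (a, b)" by fastforce
  have q: "q = of_int a / of_int b" using quotient_of_div[OF ab] .
  show ?thesis unfolding q by (simp add: of_rat_divide)
qed

lemma qbar_algebraic:
  fixes x :: qbar
  obtains p :: "rat poly" where "p \<noteq> 0" "(\<Sum>i\<le>degree p. of_rat (coeff p i) * x ^ i) = 0"
proof -
  obtain p :: "rat poly" where p: "p \<noteq> 0" "poly (map_poly to_ac p) x = 0"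
    using alg_closure_algebraic by blast
  have "degree (map_poly to_ac p) = degree p"
    by (rule degree_map_poly) auto
  then have "poly (map_poly to_ac p) x = (\<Sum>i\<le>degree p. of_rat (coeff p i) * x ^ i)"
    by (simp add: poly_altdef coeff_map_poly to_ac_eq_of_rat)
  with p show thesis using that by simp
qed

text \<open>Strip the lowest power of \<open>x\<close> from an algebraic relation and solve for the
  constant term. A ring of algebraic numbers containing the rationals is thus closed under
  inversion.\<close>

lemma qbar_inverse_relation:
  fixes x :: qbar
  assumes "x \<noteq> 0"
  obtains n and c :: "nat \<Rightarrow> rat" where "inverse x = (\<Sum>i<n. of_rat (c i) * x ^ i)"
proof -
  have "\<exists>n (c :: nat \<Rightarrow> rat). inverse x = (\<Sum>i<n. of_rat (c i) * x ^ i)"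
    if "\<exists>c :: nat \<Rightarrow> rat. c n \<noteq> 0 \<and> (\<Sum>i\<le>n. of_rat (c i) * x ^ i) = 0" for n
    using that
  proof (induction n)
    case 0
    then show ?case by auto
  next
    case (Suc n)
    then obtain c :: "nat \<Rightarrow> rat" where c: "c (Suc n) \<noteq> 0" "(\<Sum>i\<le>Suc n. of_rat (c i) * x ^ i) = 0" by blast
    have eq: "of_rat (c 0) + x * (\<Sum>i\<le>n. of_rat (c (Suc i)) * x ^ i) = 0"
      using c(2) by (subst (asm) sum.atMost_Suc_shift) (simp add: sum_distrib_left mult_ac)
    show ?case
    proof (cases "c 0 = 0")
      case True
      then have "(\<Sum>i\<le>n. of_rat (c (Suc i)) * x ^ i) = 0" using eq assms by simp
      then show ?thesis using Suc.IH[OF exI[of _ "\<lambda>i. c (Suc i)"]] c(1) by simp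
    next
      case False
      define T where "T = (\<Sum>i\<le>n. of_rat (c (Suc i)) * x ^ i)"
      have "x * T = - of_rat (c 0)" using eq by (simp add: T_def eq_neg_iff_add_eq_0 add.commute)
      then have "T = - of_rat (c 0) * inverse x" using assms by (simp add: field_simps)
      then have "inverse x = of_rat (- 1 / c 0) * T" using False by (simp add: of_rat_divide of_rat_minus field_simps)
      also have "\<dots> = (\<Sum>i<Suc n. of_rat (- 1 / c 0 * c (Suc i)) * x ^ i)"
        by (simp only: T_def sum_distrib_left of_rat_mult mult.assoc lessThan_Suc_atMost)
      finally show ?thesis by (intro exI[of _ "Suc n"] exI[of _ "\<lambda>i. - 1 / c 0 * c (Suc i)"])
    qed
  qed
  moreover obtain p :: "rat poly" where "p \<noteq> 0" "(\<Sum>i\<le>degree p. of_rat (coeff p i) * x ^ i) = 0"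
    using qbar_algebraic by blast
  ultimately show thesis using that by (meson leading_coeff_neq_0)
qed

lemma span_mult_closed:
  assumes "\<And>b. b \<in> B \<Longrightarrow> k * b \<in> Q.span C" "x \<in> Q.span B"
  shows "k * x \<in> Q.span C"
  using assms(2)
proof (induction rule: Q.span_induct_alt)
  case base
  then show ?case by (simp add: Q.span_zero)
next
  case (step c x y)
  have "k * (of_rat c * x + y) = of_rat c * (k * x) + k * y" by (simp add: algebra_simps)
  then show ?case using step assms(1) Q.span_add Q.span_scale by metis
qed

text \<open>The ring K[a] is spanned over the rationals by the products b a^i with i below the
  degree of some rational equation of \<open>a\<close>. A spanning set is all that the definition of
  a number field asks, so the equation may be reducible over \<open>K\<close>.\<close>

lemma number_field_adjoin:
  assumes K: "number_field K"
  obtains K' where "number_field K'" "K \<subseteq> K'" "a \<in> K'"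
proof -
  obtain B where B: "finite B" "K = Q.span B" using number_field_span[OF K] .
  obtain p :: "rat poly" where p: "p \<noteq> 0" "(\<Sum>i\<le>degree p. of_rat (coeff p i) * a ^ i) = 0"
    using qbar_algebraic by blast
  define n where "n = degree p"
  define S where "S = (\<lambda>(b, i). b * a ^ i) ` (B \<times> {..<n})"
  define M where "M = Q.span S"
  have finS: "finite S" using B by (simp add: S_def)
  have cn: "coeff p n \<noteq> 0" using p by (simp add: n_def)
  \<comment> \<open>A nonzero constant polynomial has no root; the power a^0 then puts
    \<open>K\<close> itself into the span.\<close>
  have n0: "n > 0"
  proof (rule ccontr)
    assume "\<not> n > 0"
    then have "degree p = 0" by (simp add: n_def)
    then show False using p cn by (simp add: n_def)
  qed
  have rel: "a ^ n = (\<Sum>i<n. of_rat (- coeff p i / coeff p n) * a ^ i)"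
  proof -
    have "(\<Sum>i<n. of_rat (coeff p i) * a ^ i) + of_rat (coeff p n) * a ^ n = 0"
      using p(2) unfolding n_def[symmetric] by (metis lessThan_Suc_atMost sum.lessThan_Suc)
    then have "of_rat (coeff p n) * a ^ n = - (\<Sum>i<n. of_rat (coeff p i) * a ^ i)"
      by (simp only: eq_neg_iff_add_eq_0 add.commute)
    then have "a ^ n = of_rat (- 1 / coeff p n) * (\<Sum>i<n. of_rat (coeff p i) * a ^ i)"
      using cn by (simp add: of_rat_divide of_rat_minus field_simps)
    then show ?thesis by (simp add: sum_distrib_left of_rat_divide of_rat_minus of_rat_mult mult_ac)
  qed
  have gen: "b * a ^ i \<in> M" if "b \<in> B" "i < n" for b i
    unfolding M_def using that by (intro Q.span_base) (auto simp: S_def)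
  have genK: "k * a ^ i \<in> M" if "k \<in> K" "i < n" for k i
  proof -
    have "a ^ i * k \<in> Q.span S"
      by (rule span_mult_closed[where B = B]) (use gen[OF _ that(2)] that(1) B in \<open>auto simp: M_def mult.commute\<close>)
    then show ?thesis by (simp add: M_def mult.commute)
  qed
  have genn: "b * a ^ n \<in> M" if "b \<in> B" for b
  proof -
    have "b * a ^ n = (\<Sum>i<n. of_rat (- coeff p i / coeff p n) * (b * a ^ i))"
      unfolding rel sum_distrib_left by (simp add: mult_ac)
    also have "\<dots> \<in> Q.span S"
      using gen[OF that] unfolding M_def by (intro Q.span_sum Q.span_scale) auto
    finally show ?thesis by (simp add: M_def)
  qed
  have multa: "a * x \<in> M" if "x \<in> M" for x
    using that unfolding M_def
  proof (rule span_mult_closed[rotated])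
    fix s assume "s \<in> S"
    then obtain b i where bi: "b \<in> B" "i < n" "s = b * a ^ i" by (auto simp: S_def)
    have "b * a ^ Suc i \<in> M"
    proof (cases "Suc i = n")
      case True
      then show ?thesis by (simp only: True genn[OF bi(1)])
    next
      case False
      then show ?thesis using bi by (intro gen) auto
    qed
    then show "a * s \<in> Q.span S" using bi by (simp add: M_def mult_ac)
  qed
  have multK: "k * x \<in> M" if "k \<in> K" "x \<in> M" for k x
    using that(2) unfolding M_def
  proof (rule span_mult_closed[rotated])
    fix s assume "s \<in> S"
    then obtain b i where bi: "b \<in> B" "i < n" "s = b * a ^ i" by (auto simp: S_def)
    have "b \<in> K" using bi B Q.span_base by auto
    then have "k * b \<in> K" using number_field_mult[OF K that(1)] by auto
    then have "k * b * a ^ i \<in> M" using bi(2) by (rule genK)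
    then show "k * s \<in> Q.span S" using bi by (simp add: M_def mult.assoc)
  qed
  have multp: "a ^ i * x \<in> M" if "x \<in> M" for i x
    using that multa by (induction i) (auto simp: mult.assoc)
  have mult: "y * x \<in> M" if "x \<in> M" "y \<in> M" for x y
  proof -
    have "x * y \<in> Q.span S"
      using that(2)[unfolded M_def]
    proof (rule span_mult_closed[rotated])
      fix s assume "s \<in> S"
      then obtain b i where bi: "b \<in> B" "i < n" "s = b * a ^ i" by (auto simp: S_def)
      have "b \<in> K" using bi B Q.span_base by auto
      then have "b * (a ^ i * x) \<in> M" using multK multp that by blast
      then show "x * s \<in> Q.span S" using bi by (simp add: M_def mult_ac)
    qed
    then show ?thesis by (simp add: M_def mult.commute)
  qed
  have KM: "K \<subseteq> M" using genK[OF _ n0] by auto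
  have oneM: "1 \<in> M" using KM number_field_1[OF K] by auto
  have pow: "x ^ i \<in> M" if "x \<in> M" for x i
    by (induction i) (use oneM mult that in auto)
  have inv: "inverse x \<in> M" if "x \<in> M" for x
  proof (cases "x = 0")
    case True
    then show ?thesis by (simp add: M_def Q.span_zero)
  next
    case False
    from qbar_inverse_relation[OF this] obtain k and c :: "nat \<Rightarrow> rat"
      where "inverse x = (\<Sum>i<k. of_rat (c i) * x ^ i)" .
    also have "\<dots> \<in> M" unfolding M_def
      by (intro Q.span_sum Q.span_scale) (use pow[OF that] in \<open>simp add: M_def\<close>)
    finally show ?thesis .
  qed
  have "M = {\<Sum>b\<in>S. of_rat (c b) * b |c. True}"
    unfolding M_def using Q.span_finite[OF finS] by auto
  then have form: "\<exists>B. finite B \<and> M = {\<Sum>b\<in>B. of_rat (c b) * b |c. True}" using finS by blast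
  have zero: "0 \<in> M" and add: "x + y \<in> M" and neg: "- x \<in> M" if "x \<in> M" "y \<in> M" for x y
    using that Q.span_zero Q.span_add Q.span_neg unfolding M_def by auto
  have "number_field M"
    unfolding number_field_def
    by (intro conjI ballI form zero[OF oneM oneM] oneM add mult neg inv; assumption)
  moreover have "a \<in> M" using multa[OF oneM] by simp
  ultimately show thesis using that KM by blast
qed

lemma number_field_finite_extension:
  assumes "finite A" "number_field K"
  shows "\<exists>K'. number_field K' \<and> K \<subseteq> K' \<and> A \<subseteq> K'"
  using assms
proof (induction A)
  case empty
  then show ?case by auto
next
  case (insert a A)
  then obtain K1 where K1: "number_field K1" "K \<subseteq> K1" "A \<subseteq> K1" by blast
  obtain K2 where "number_field K2" "K1 \<subseteq> K2" "a \<in> K2" using number_field_adjoin[OF K1(1)] .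
  then show ?case using K1 by blast
qed


section \<open>Absolute values\<close>

locale absolute_value =
  fixes K :: "qbar set" and v :: "qbar \<Rightarrow> real"
  assumes K: "number_field K" and nontrivial: "nontrivial_absolute_value K v"
begin

lemmas K_closed [simp, intro] =
  number_field_0[OF K] number_field_1[OF K] number_field_add[OF K] number_field_mult[OF K]
  number_field_minus[OF K] number_field_inverse[OF K] number_field_of_rat[OF K]

lemma K_diff [simp, intro]: "x \<in> K \<Longrightarrow> y \<in> K \<Longrightarrow> x - y \<in> K"
  using K_closed(3)[of x "- y"] by simp

lemma K_divide [simp, intro]: "x \<in> K \<Longrightarrow> y \<in> K \<Longrightarrow> x / y \<in> K"
  by (simp add: divide_inverse)

lemma K_power [simp, intro]: "x \<in> K \<Longrightarrow> x ^ n \<in> K"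
  by (induction n) auto

lemma K_of_nat [simp, intro]: "of_nat n \<in> K" and K_of_int [simp, intro]: "of_int i \<in> K"
  using number_field_of_rat[OF K, of "of_nat n"] number_field_of_rat[OF K, of "of_int i"] by auto

lemma K_sum [intro]: "(\<And>i. i \<in> I \<Longrightarrow> f i \<in> K) \<Longrightarrow> (\<Sum>i\<in>I. f i) \<in> K"
  by (induction I rule: infinite_finite_induct) auto

lemma nonneg [simp, intro]: "x \<in> K \<Longrightarrow> 0 \<le> v x"
  and eq_0_iff [simp]: "x \<in> K \<Longrightarrow> v x = 0 \<longleftrightarrow> x = 0"
  and mult: "x \<in> K \<Longrightarrow> y \<in> K \<Longrightarrow> v (x * y) = v x * v y"
  and triangle: "x \<in> K \<Longrightarrow> y \<in> K \<Longrightarrow> v (x + y) \<le> v x + v y"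
  using nontrivial unfolding nontrivial_absolute_value_def by auto

lemma at_0 [simp]: "v 0 = 0" by simp

lemma pos: "x \<in> K \<Longrightarrow> x \<noteq> 0 \<Longrightarrow> 0 < v x"
  using nonneg eq_0_iff by (metis less_eq_real_def)

lemma at_1 [simp]: "v 1 = 1"
proof -
  have "v 1 = v 1 * v 1" using mult[of 1 1] by simp
  then show ?thesis using eq_0_iff[of 1] by simp
qed

lemma at_minus [simp]: assumes "x \<in> K" shows "v (- x) = v x"
proof -
  have "v (- 1) * v (- 1) = 1" using mult[of "- 1" "- 1"] by simp
  then have "v (- 1) = 1" using nonneg[of "- 1"] by (metis K_closed(2,5) abs_of_nonneg real_sqrt_abs2 real_sqrt_one)
  then show ?thesis using mult[of "- 1" x] assms by simp
qed

lemma at_inverse: assumes "x \<in> K" shows "v (inverse x) = inverse (v x)"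
proof (cases "x = 0")
  case False
  then have "v x * v (inverse x) = 1" using mult[of x "inverse x"] assms by simp
  then show ?thesis by (metis inverse_unique)
qed simp

lemma at_divide: "x \<in> K \<Longrightarrow> y \<in> K \<Longrightarrow> v (x / y) = v x / v y"
  by (simp add: divide_inverse mult at_inverse)

lemma at_power: "x \<in> K \<Longrightarrow> v (x ^ n) = v x ^ n"
  by (induction n) (auto simp: mult)

lemma K_powi [simp, intro]: "x \<in> K \<Longrightarrow> x powi m \<in> K"
  by (auto simp: power_int_def)

lemma at_powi: "x \<in> K \<Longrightarrow> v (x powi m) = v x powi m"
  by (simp add: power_int_def at_power at_inverse)

lemma at_sum: "(\<And>i. i \<in> I \<Longrightarrow> f i \<in> K) \<Longrightarrow> v (\<Sum>i\<in>I. f i) \<le> (\<Sum>i\<in>I. v (f i))"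
proof (induction I rule: infinite_finite_induct)
  case (insert i I)
  have "v (f i + sum f I) \<le> v (f i) + v (sum f I)" using insert by (intro triangle K_sum) simp_all
  also have "v (sum f I) \<le> (\<Sum>i\<in>I. v (f i))" using insert by simp
  finally show ?case using insert by simp
qed simp_all

lemma reverse_triangle: "x \<in> K \<Longrightarrow> y \<in> K \<Longrightarrow> v x - v y \<le> v (x + y)"
  using triangle[of "x + y" "- y"] by simp

lemma at_of_nat_le: "v (of_nat n) \<le> real n"
proof (induction n)
  case (Suc n)
  have "v (of_nat n + 1) \<le> v (of_nat n) + v 1" by (rule triangle) auto
  then show ?case using Suc by (simp add: add.commute)
qed simp

lemma ex_gt_1: "\<exists>a\<in>K. a \<noteq> 0 \<and> v a > 1"
proof -
  obtain x where x: "x \<in> K" "x \<noteq> 0" "v x \<noteq> 1"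
    using nontrivial unfolding nontrivial_absolute_value_def by auto
  show ?thesis
  proof (cases "v x > 1")
    case False
    then have "v (inverse x) > 1" using x pos[of x] by (simp add: at_inverse one_less_inverse)
    then show ?thesis using x by (intro bexI[of _ "inverse x"]) auto
  qed (use x in auto)
qed

end

text \<open>Fix \<open>a\<close> with v a > 1. If ln (w x) / ln (w a) exceeded ln (v x) / ln (v a),
  a rational m/n in between would give x^n / a^m, small for v and large for w. The same inequality
  for 1/x yields equality, so one inclusion of the open unit balls suffices.\<close>

lemma equivalentI:
  assumes "absolute_value K v" "absolute_value K w"
    and imp: "\<And>x. x \<in> K \<Longrightarrow> v x < 1 \<Longrightarrow> w x < 1"
  shows "equivalent_absolute_values K v w"
proof -
  interpret v: absolute_value K v by fact
  interpret w: absolute_value K w by fact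
  obtain a where a: "a \<in> K" "a \<noteq> 0" "v a > 1" using v.ex_gt_1 by blast
  have "w (inverse a) < 1" using a by (intro imp) (auto simp: v.at_inverse inverse_less_1_iff)
  then have wa: "w a > 1" using a w.pos[of a] by (simp add: w.at_inverse inverse_less_1_iff)
  have la: "ln (v a) > 0" "ln (w a) > 0" using a wa by auto
  have le: "ln (w x) / ln (w a) \<le> ln (v x) / ln (v a)" if x: "x \<in> K" "x \<noteq> 0" for x
  proof (rule field_le_epsilon, rule ccontr)
    fix e :: real assume "e > 0" and n: "\<not> ln (w x) / ln (w a) \<le> ln (v x) / ln (v a) + e"
    have lt: "ln (v x) / ln (v a) < ln (w x) / ln (w a)" using n \<open>e > 0\<close> by linarith
    obtain q where q: "ln (v x) / ln (v a) < of_rat q" "of_rat q < ln (w x) / ln (w a)"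
      using of_rat_dense[OF lt] by blast
    obtain m n where mn: "quotient_of q = (m, n)" by fastforce
    have n: "n > 0" using quotient_of_denom_pos[OF mn] .
    have qr: "(of_rat q :: real) = of_int m / of_int n" using quotient_of_div[OF mn] by (simp add: of_rat_divide)
    define k where "k = nat n"
    have k: "k > 0" "real k = of_int n" using n by (auto simp: k_def)
    define z where "z = x ^ k / a powi m"
    have zK: "z \<in> K" using x a by (simp add: z_def)
    have ln: "ln (u z) = real k * ln (u x) - of_int m * ln (u a)" if "absolute_value K u" for u
    proof -
      interpret u: absolute_value K u by fact
      have "u x > 0" "u a > 0" using u.pos x a by auto
      moreover have "ln (u a powi m) = of_int m * ln (u a)"
        using \<open>u a > 0\<close> by (metis powr_real_of_int' ln_powr less_imp_le less_irrefl)
      ultimately show ?thesis using x a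
        by (simp add: z_def u.at_divide u.at_power u.at_powi ln_div ln_realpow)
    qed
    have "real k * ln (v x) - of_int m * ln (v a) < 0"
      using q(1) la n by (simp add: qr k field_simps)
    then have "ln (v z) < 0" using ln[OF v.absolute_value_axioms] by simp
    moreover have "v z > 0" using v.pos[OF zK] x a by (simp add: z_def)
    ultimately have "v z < 1" by simp
    then have "w z < 1" by (rule imp[OF zK])
    moreover have "w z > 0" using w.pos[OF zK] x a by (simp add: z_def)
    ultimately have "ln (w z) < 0" by simp
    then have "real k * ln (w x) < of_int m * ln (w a)" using ln[OF w.absolute_value_axioms] by simp
    then show False using q(2) la n by (simp add: qr k field_simps)
  qed
  define s where "s = ln (w a) / ln (v a)"
  have s: "s > 0" using la by (simp add: s_def)
  have "w x = v x powr s" if x: "x \<in> K" for x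
  proof (cases "x = 0")
    case False
    have p: "v x > 0" "w x > 0" using v.pos w.pos x False by auto
    have "ln (w (inverse x)) / ln (w a) \<le> ln (v (inverse x)) / ln (v a)"
      using x False by (intro le) auto
    then have "ln (v x) / ln (v a) \<le> ln (w x) / ln (w a)"
      using p by (simp add: v.at_inverse w.at_inverse x ln_inverse)
    with le[OF x False] have "ln (w x) / ln (w a) = ln (v x) / ln (v a)" by simp
    then have "ln (w x) = s * ln (v x)" using la by (simp add: s_def field_simps)
    then have "w x = exp (s * ln (v x))" using p by (metis exp_ln)
    then show ?thesis using p by (simp add: powr_def)
  qed simp
  then show ?thesis using s unfolding equivalent_absolute_values_def by blast
qed

lemma equivalent_refl: "absolute_value K v \<Longrightarrow> equivalent_absolute_values K v v"
  by (rule equivalentI) simp_all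

lemma equivalent_sym:
  assumes "absolute_value K v" "absolute_value K w" "equivalent_absolute_values K v w"
  shows "equivalent_absolute_values K w v"
proof (rule equivalentI[OF assms(2,1)])
  interpret v: absolute_value K v by fact
  fix x assume x: "x \<in> K" "w x < 1"
  obtain s where s: "s > 0" "w x = v x powr s" using assms(3) x unfolding equivalent_absolute_values_def by auto
  show "v x < 1"
  proof (rule ccontr)
    assume "\<not> v x < 1"
    then have "v x powr s \<ge> 1" using s by (simp add: ge_one_powr_ge_zero)
    then show False using s x by simp
  qed
qed

lemma equivalent_trans:
  assumes "equivalent_absolute_values K u v" "equivalent_absolute_values K v w"
  shows "equivalent_absolute_values K u w"
proof -
  obtain s t where "s > 0" "\<forall>x\<in>K. v x = u x powr s" "t > 0" "\<forall>x\<in>K. w x = v x powr t"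
    using assms unfolding equivalent_absolute_values_def by auto
  then show ?thesis unfolding equivalent_absolute_values_def
    by (intro exI[of _ "s * t"]) (auto simp: powr_powr)
qed

lemma separate_two:
  assumes v: "absolute_value K v" and w: "absolute_value K w"
    and ne: "\<not> equivalent_absolute_values K v w"
  shows "\<exists>x\<in>K. v x > 1 \<and> w x < 1"
proof -
  interpret v: absolute_value K v by fact
  interpret w: absolute_value K w by fact
  obtain x where x: "x \<in> K" "v x < 1" "w x \<ge> 1" using equivalentI[OF v w] ne by force
  have "\<not> equivalent_absolute_values K w v" using ne equivalent_sym[OF w v] by blast
  then obtain y where y: "y \<in> K" "w y < 1" "v y \<ge> 1" using equivalentI[OF w v] by force
  have "x \<noteq> 0" using x by auto
  then have "v x > 0" using v.pos x by auto
  then have "v (y / x) > 1" using x y by (simp add: v.at_divide)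
  moreover have "w (y / x) < 1" using x y by (simp add: w.at_divide)
  ultimately show ?thesis using x y by (intro bexI[of _ "y / x"]) auto
qed

text \<open>The induction of Artin and Whaples. If x is not small at the new w, the element y
  separating v from w is multiplied by x^m when w x = 1, and by x^m / (1 + x^m) when w x > 1: this
  factor tends to 1 where x is large and to 0 where x is small.\<close>

lemma separate:
  assumes v: "absolute_value K v" and "finite W"
    and "\<And>w. w \<in> W \<Longrightarrow> absolute_value K w \<and> \<not> equivalent_absolute_values K v w"
  shows "\<exists>x\<in>K. v x > 1 \<and> (\<forall>w\<in>W. w x < 1)"
  using assms(2,3)
proof (induction W)
  case empty
  interpret v: absolute_value K v by fact
  show ?case using v.ex_gt_1 by auto
next
  case (insert w W)
  interpret v: absolute_value K v by fact
  interpret w: absolute_value K w using insert by auto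
  obtain x where x: "x \<in> K" "v x > 1" "\<forall>w\<in>W. w x < 1" using insert by auto
  obtain y where y: "y \<in> K" "v y > 1" "w y < 1"
    using separate_two[OF v w.absolute_value_axioms] insert by auto
  consider "w x < 1" | "w x = 1" | "w x > 1" by linarith
  then show ?case
  proof cases
    case 1
    then show ?thesis using x by auto
  next
    case 2
    have "eventually (\<lambda>m. u x ^ m * u y < 1) sequentially" if "u \<in> W" for u
    proof -
      interpret u: absolute_value K u using insert that by auto
      have "(\<lambda>m. u x ^ m * u y) \<longlonglongrightarrow> 0 * u y"
        using x that u.nonneg[of x] by (intro tendsto_mult LIMSEQ_power_zero tendsto_const) auto
      then show ?thesis by (intro order_tendstoD(2)[where y = "0 * u y"]) auto
    qed
    then have "eventually (\<lambda>m. \<forall>u\<in>W. u x ^ m * u y < 1) sequentially"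
      using insert by (intro eventually_ball_finite) auto
    then obtain m where m: "\<forall>u\<in>W. u x ^ m * u y < 1" by (auto simp: eventually_sequentially)
    have eq: "u (x ^ m * y) = u x ^ m * u y" if "absolute_value K u" for u
    proof -
      interpret u: absolute_value K u by fact
      show ?thesis using x y by (simp add: u.mult u.at_power)
    qed
    have "v x ^ m * v y > 1"
    proof -
      have "v x ^ m \<ge> 1" using x by (simp add: one_le_power)
      then show ?thesis using y by (smt (verit) mult_le_cancel_right1)
    qed
    then have "v (x ^ m * y) > 1" using eq[OF v] by simp
    moreover have "w (x ^ m * y) < 1" using eq[OF w.absolute_value_axioms] 2 y by simp
    moreover have "\<forall>u\<in>W. u (x ^ m * y) < 1" using eq m insert.prems by auto
    moreover have "x ^ m * y \<in> K" using x y by simp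
    ultimately show ?thesis by blast
  next
    case 3
    define t where "t m = x ^ m * y / (1 + x ^ m)" for m
    have tK: "t m \<in> K" for m using x y by (auto simp: t_def)
    have up: "(\<lambda>m. (inverse (u x)) ^ m) \<longlonglongrightarrow> 0" if "u x > 1" for u :: "qbar \<Rightarrow> real"
      using that by (intro LIMSEQ_power_zero) (auto simp: inverse_less_1_iff)
    have big: "x \<noteq> 0 \<and> 1 + x ^ m \<noteq> 0 \<and> t m = y / (1 + inverse x ^ m)" if m: "m > 0" for m
    proof -
      have x0: "x \<noteq> 0" using x by auto
      have "1 + x ^ m \<noteq> 0"
      proof
        assume "1 + x ^ m = 0"
        then have "x ^ m = - 1" by (simp add: add_eq_0_iff)
        then have "v x ^ m = 1" using v.at_power[OF x(1), of m] by simp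
        moreover have "v x ^ m > 1" using x m by (simp add: one_less_power)
        ultimately show False by simp
      qed
      then show ?thesis using x0 by (simp add: t_def field_simps)
    qed
    have "(\<lambda>m. v y / (1 + inverse (v x) ^ m)) \<longlonglongrightarrow> v y / (1 + 0)"
      using x by (intro tendsto_divide tendsto_add tendsto_diff tendsto_const up) auto
    then have e1: "eventually (\<lambda>m. v y / (1 + inverse (v x) ^ m) > 1) sequentially"
      using y by (intro order_tendstoD(1)[where y = "v y / (1 + 0)"]) auto
    have "(\<lambda>m. w y / (1 - inverse (w x) ^ m)) \<longlonglongrightarrow> w y / (1 - 0)"
      using 3 by (intro tendsto_divide tendsto_add tendsto_diff tendsto_const up) auto
    then have e2: "eventually (\<lambda>m. w y / (1 - inverse (w x) ^ m) < 1) sequentially"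
      using y by (intro order_tendstoD(2)[where y = "w y / (1 - 0)"]) auto
    have "eventually (\<lambda>m. u x ^ m * u y / (1 - u x ^ m) < 1) sequentially" if "u \<in> W" for u
    proof -
      interpret u: absolute_value K u using insert that by auto
      have *: "(\<lambda>m. u x ^ m) \<longlonglongrightarrow> 0" using x that u.nonneg[of x] by (intro LIMSEQ_power_zero) auto
      have "(\<lambda>m. u x ^ m * u y / (1 - u x ^ m)) \<longlonglongrightarrow> 0 * u y / (1 - 0)"
        by (intro tendsto_divide tendsto_mult tendsto_diff tendsto_const *) simp
      then show ?thesis by (intro order_tendstoD(2)[where y = "0 * u y / (1 - 0)"]) auto
    qed
    then have e3: "eventually (\<lambda>m. \<forall>u\<in>W. u x ^ m * u y / (1 - u x ^ m) < 1) sequentially"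
      using insert by (intro eventually_ball_finite) auto
    have "eventually (\<lambda>m::nat. m > 0) sequentially" by (rule eventually_gt_at_top)
    with e1 e2 e3 have "eventually (\<lambda>m. m > 0 \<and> v y / (1 + inverse (v x) ^ m) > 1 \<and> w y / (1 - inverse (w x) ^ m) < 1
      \<and> (\<forall>u\<in>W. u x ^ m * u y / (1 - u x ^ m) < 1)) sequentially"
      by (intro eventually_conj)
    then obtain m where m: "m > 0" "v y / (1 + inverse (v x) ^ m) > 1" "w y / (1 - inverse (w x) ^ m) < 1"
      "\<forall>u\<in>W. u x ^ m * u y / (1 - u x ^ m) < 1"
      using eventually_happens by (metis (mono_tags, lifting) trivial_limit_sequentially)
    note big = big[OF m(1)]
    have ne: "1 + inverse x ^ m \<noteq> 0"
    proof
      assume "1 + inverse x ^ m = 0"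
      then have "x ^ m * (1 + inverse x ^ m) = 0" by simp
      then show False using big by (simp add: algebra_simps power_inverse)
    qed
    have "v (t m) > 1"
    proof -
      have "v (1 + inverse x ^ m) \<le> 1 + inverse (v x) ^ m"
        using v.triangle[of 1 "inverse x ^ m"] x by (simp add: v.at_power v.at_inverse)
      moreover have "v (1 + inverse x ^ m) > 0" using ne x by (intro v.pos) auto
      ultimately have "v y / (1 + inverse (v x) ^ m) \<le> v y / v (1 + inverse x ^ m)"
        using y by (intro divide_left_mono) auto
      also have "\<dots> = v (t m)" using big x y by (simp add: v.at_divide)
      finally show ?thesis using m by simp
    qed
    moreover have "w (t m) < 1"
    proof -
      have "1 - inverse (w x) ^ m \<le> w (1 + inverse x ^ m)"
        using w.reverse_triangle[of 1 "inverse x ^ m"] x by (simp add: w.at_power w.at_inverse)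
      moreover have "inverse (w x) ^ m < 1" using 3 m(1) by (intro power_Suc_less_one[THEN less_le_trans] power_less_one_iff[THEN iffD2]) (auto simp: inverse_less_1_iff)
      ultimately have "w y / w (1 + inverse x ^ m) \<le> w y / (1 - inverse (w x) ^ m)"
        using y by (intro divide_left_mono) (auto intro!: mult_pos_pos)
      moreover have "w (t m) = w y / w (1 + inverse x ^ m)" using big x y by (simp add: w.at_divide)
      ultimately show ?thesis using m by simp
    qed
    moreover have "u (t m) < 1" if "u \<in> W" for u
    proof -
      interpret u: absolute_value K u using insert that by auto
      have "1 - u x ^ m \<le> u (1 + x ^ m)"
        using u.reverse_triangle[of 1 "x ^ m"] x by (simp add: u.at_power)
      moreover have "u x ^ m < 1" using x that m(1) u.nonneg[of x] by (simp add: power_less_one_iff)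
      ultimately have "u x ^ m * u y / u (1 + x ^ m) \<le> u x ^ m * u y / (1 - u x ^ m)"
        using y x by (intro divide_left_mono) (auto intro!: mult_pos_pos)
      moreover have "u (t m) = u x ^ m * u y / u (1 + x ^ m)" using x y by (simp add: t_def u.at_divide u.mult u.at_power)
      ultimately show ?thesis using m that by force
    qed
    ultimately show ?thesis using tK by auto
  qed
qed

section \<open>Finitely many places over each place of the rationals\<close>

definition rational_unit_ball :: "(qbar \<Rightarrow> real) \<Rightarrow> rat set" where
  "rational_unit_ball v = {r. v (of_rat r) \<le> 1}"

text \<open>Elements \<open>y v\<close> that exceed 1 at v and are below 1 / card V at the other
  members are independent over the rationals: divide a relation by its largest coefficient and
  estimate at the corresponding member. Only the triangle inequality is used, hence the bound 1 /
  card V, so archimedean and nonarchimedean absolute values are handled together.\<close>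

lemma card_inequivalent_le:
  assumes B: "finite B" "K = Q.span B" and "finite V"
    and V: "\<And>v. v \<in> V \<Longrightarrow> absolute_value K v"
    and ne: "\<And>v w. v \<in> V \<Longrightarrow> w \<in> V \<Longrightarrow> v \<noteq> w \<Longrightarrow> \<not> equivalent_absolute_values K v w"
    and ball: "\<And>v. v \<in> V \<Longrightarrow> rational_unit_ball v = T"
  shows "card V \<le> card B"
proof (cases "V = {}")
  case False
  have "\<exists>y. y \<in> K \<and> v y > 1 \<and> (\<forall>w\<in>V - {v}. w y < 1 / real (card V))" if v: "v \<in> V" for v
  proof -
    interpret v: absolute_value K v using V v by auto
    obtain x where x: "x \<in> K" "v x > 1" "\<forall>w\<in>V - {v}. w x < 1"
      using separate[of K v "V - {v}"] v V ne \<open>finite V\<close> by (metis DiffE finite_Diff insertI1)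
    have "eventually (\<lambda>m. w x ^ m < 1 / real (card V)) sequentially" if "w \<in> V - {v}" for w
    proof -
      interpret w: absolute_value K w using V that by auto
      have "(\<lambda>m. w x ^ m) \<longlonglongrightarrow> 0" using x that w.nonneg[of x] by (intro LIMSEQ_power_zero) auto
      then show ?thesis using False \<open>finite V\<close> by (intro order_tendstoD(2)[where y = 0]) (auto simp: card_gt_0_iff)
    qed
    then have "eventually (\<lambda>m. \<forall>w\<in>V - {v}. w x ^ m < 1 / real (card V)) sequentially"
      using \<open>finite V\<close> by (intro eventually_ball_finite) auto
    with eventually_gt_at_top[of "0::nat"]
    have "eventually (\<lambda>m. m > 0 \<and> (\<forall>w\<in>V - {v}. w x ^ m < 1 / real (card V))) sequentially"
      by (rule eventually_conj)
    then obtain m where m: "m > 0" "\<forall>w\<in>V - {v}. w x ^ m < 1 / real (card V)"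
      using eventually_happens by (metis (mono_tags, lifting) trivial_limit_sequentially)
    have "w (x ^ m) < 1 / real (card V)" if "w \<in> V - {v}" for w
    proof -
      interpret w: absolute_value K w using V that by auto
      show ?thesis using m that x by (simp add: w.at_power)
    qed
    moreover have "v (x ^ m) > 1" using x m(1) by (simp add: v.at_power one_less_power)
    ultimately show ?thesis using x by blast
  qed
  then obtain y where y: "\<And>v. v \<in> V \<Longrightarrow> y v \<in> K" "\<And>v. v \<in> V \<Longrightarrow> v (y v) > 1"
    "\<And>v w. v \<in> V \<Longrightarrow> w \<in> V \<Longrightarrow> w \<noteq> v \<Longrightarrow> w (y v) < 1 / real (card V)"
    by (metis DiffI singletonD)
  have c1: "1 / real (card V) \<le> 1" using False \<open>finite V\<close> by (simp add: Suc_leI card_gt_0_iff)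
  have inj: "inj_on y V"
  proof (rule inj_onI, rule ccontr)
    fix v w assume "v \<in> V" "w \<in> V" "y v = y w" "v \<noteq> w"
    then have "v (y v) > 1" "v (y v) < 1 / real (card V)" using y(2)[of v] y(3)[of w v] by auto
    with c1 show False by simp
  qed
  have "Q.independent (y ` V)"
  proof
    assume "Q.dependent (y ` V)"
    then obtain u where u: "\<exists>z\<in>y ` V. u z \<noteq> 0" "(\<Sum>z\<in>y ` V. of_rat (u z) * z) = 0"
      using Q.dependent_finite[of "y ` V"] \<open>finite V\<close> by blast
    define c where "c v = u (y v)" for v
    have rel: "(\<Sum>v\<in>V. of_rat (c v) * y v) = 0" using u(2) inj by (simp add: sum.reindex c_def)
    obtain v1 where v1: "v1 \<in> V" "c v1 \<noteq> 0" using u(1) by (auto simp: c_def)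
    interpret w: absolute_value K v1 using V v1 by auto
    \<comment> \<open>The absolute value \<open>v1\<close> is the yardstick for the rational
      coefficients. Since all members share the unit ball \<open>T\<close>, a ratio of size at most
      1 for \<open>v1\<close> has this property for every member.\<close>
    define f where "f v = v1 (of_rat (c v))" for v
    have "\<exists>v0\<in>V. \<forall>v\<in>V. f v \<le> f v0"
    proof -
      have "Max (f ` V) \<in> f ` V" using \<open>finite V\<close> False by (intro Max_in) auto
      then obtain v0 where "v0 \<in> V" "f v0 = Max (f ` V)" by auto
      then show ?thesis using \<open>finite V\<close> by (metis Max_ge finite_imageI imageI)
    qed
    then obtain v0 where v0: "v0 \<in> V" "\<And>v. v \<in> V \<Longrightarrow> f v \<le> f v0" by auto
    have "f v1 > 0" unfolding f_def using v1 by (intro w.pos) auto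
    then have "f v0 > 0" using v0(2)[OF v1(1)] by simp
    then have c0: "c v0 \<noteq> 0" by (auto simp: f_def)
    have "c v / c v0 \<in> T" if "v \<in> V" for v
    proof -
      have "v1 (of_rat (c v / c v0)) = f v / f v0" by (simp add: f_def of_rat_divide w.at_divide)
      also have "\<dots> \<le> 1" using v0(2)[OF that] \<open>f v0 > 0\<close> by simp
      finally show ?thesis using ball[OF v1(1)] by (auto simp: rational_unit_ball_def)
    qed
    then have le: "v0 (of_rat (c v / c v0)) \<le> 1" if "v \<in> V" for v
      using ball[OF v0(1)] that by (auto simp: rational_unit_ball_def)
    interpret v0: absolute_value K v0 using V v0 by auto
    have "of_rat (c v0) * y v0 + (\<Sum>v\<in>V - {v0}. of_rat (c v) * y v) = 0"
      using rel sum.remove[OF \<open>finite V\<close> v0(1), of "\<lambda>v. of_rat (c v) * y v"] by simp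
    then have "of_rat (c v0) * y v0 = - (\<Sum>v\<in>V - {v0}. of_rat (c v) * y v)"
      by (simp only: eq_neg_iff_add_eq_0)
    then have "y v0 = - (\<Sum>v\<in>V - {v0}. of_rat (c v) * y v) / of_rat (c v0)" using c0 by (simp add: field_simps)
    also have "\<dots> = - (\<Sum>v\<in>V - {v0}. of_rat (c v / c v0) * y v)"
      by (simp add: sum_divide_distrib of_rat_divide)
    finally have y0: "y v0 = - (\<Sum>v\<in>V - {v0}. of_rat (c v / c v0) * y v)" .
    have "v0 (y v0) = v0 (\<Sum>v\<in>V - {v0}. of_rat (c v / c v0) * y v)"
      unfolding y0 using y(1) by (intro v0.at_minus v0.K_sum v0.K_closed) auto
    also have "\<dots> \<le> (\<Sum>v\<in>V - {v0}. v0 (of_rat (c v / c v0) * y v))"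
      using y(1) by (intro v0.at_sum) auto
    also have "\<dots> \<le> (\<Sum>v\<in>V - {v0}. 1 / real (card V))"
    proof (rule sum_mono)
      fix v assume v: "v \<in> V - {v0}"
      have "v0 (of_rat (c v / c v0) * y v) = v0 (of_rat (c v / c v0)) * v0 (y v)"
        using v y(1) by (intro v0.mult) auto
      also have "\<dots> \<le> 1 * v0 (y v)" using v le y(1) by (intro mult_right_mono) auto
      also have "\<dots> \<le> 1 / real (card V)" using y(3)[of v v0] v v0 by auto
      finally show "v0 (of_rat (c v / c v0) * y v) \<le> 1 / real (card V)" .
    qed
    also have "\<dots> \<le> 1"
      using \<open>finite V\<close> v0(1) by (simp add: card_Diff_singleton divide_le_eq)
    finally show False using y(2)[OF v0(1)] by simp
  qed
  moreover have "y ` V \<subseteq> Q.span B" using y(1) B by auto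
  ultimately have "card (y ` V) \<le> card B" using Q.independent_span_bound[OF B(1)] by blast
  then show ?thesis using card_image[OF inj] by simp
qed simp

lemma places_absolute_value:
  "number_field K \<Longrightarrow> \<nu> \<in> places K \<Longrightarrow> v \<in> \<nu> \<Longrightarrow> absolute_value K v"
  by (auto simp: places_def absolute_value_def)

lemma place_eqI:
  assumes "number_field K" "\<nu> \<in> places K" "\<mu> \<in> places K" "v \<in> \<nu>" "w \<in> \<mu>" "equivalent_absolute_values K v w"
  shows "\<nu> = \<mu>"
proof -
  have char: "\<rho> = {w. nontrivial_absolute_value K w \<and> equivalent_absolute_values K v w}" if r: "\<rho> \<in> places K" "v \<in> \<rho>" for \<rho> v
  proof -
    obtain u where u: "nontrivial_absolute_value K u" "\<rho> = {w. nontrivial_absolute_value K w \<and> equivalent_absolute_values K u w}"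
      using r by (auto simp: places_def)
    have au: "absolute_value K u" using u assms(1) by (simp add: absolute_value_def)
    have uv: "equivalent_absolute_values K u v" using u r by auto
    have vu: "equivalent_absolute_values K v u"
      by (rule equivalent_sym[OF au places_absolute_value[OF assms(1) r] uv])
    have "equivalent_absolute_values K u w \<longleftrightarrow> equivalent_absolute_values K v w" for w
      using equivalent_trans[OF uv] equivalent_trans[OF vu] by metis
    then show ?thesis using u by simp
  qed
  have "w \<in> \<nu>" using char[OF assms(2,4)] assms(6) places_absolute_value[OF assms(1,3,5)] by (auto simp: absolute_value_def)
  then show ?thesis using char[OF assms(2), of w] char[OF assms(3,5)] by simp
qed

lemma finite_places_over:
  assumes K: "number_field K"
    and P: "\<And>\<nu>. \<nu> \<in> P \<Longrightarrow> \<nu> \<in> places K \<and> (\<exists>v\<in>\<nu>. rational_unit_ball v = T)"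
  shows "finite P"
proof (rule ccontr)
  assume "infinite P"
  obtain B where B: "finite B" "K = Q.span B" using number_field_span[OF K] .
  obtain F where F: "F \<subseteq> P" "finite F" "card F = Suc (card B)"
    using \<open>infinite P\<close> infinite_arbitrarily_large by metis
  obtain f where f: "\<And>\<nu>. \<nu> \<in> P \<Longrightarrow> f \<nu> \<in> \<nu> \<and> rational_unit_ball (f \<nu>) = T" using P by metis
  have inj: "inj_on f F"
  proof (rule inj_onI)
    fix x y assume *: "x \<in> F" "y \<in> F" "f x = f y"
    then have "x \<in> P" "y \<in> P" using F by auto
    then have "x \<in> places K" "y \<in> places K" "f x \<in> x" "f y \<in> y" using P f by blast+
    moreover have "equivalent_absolute_values K (f x) (f y)"
      using * equivalent_refl places_absolute_value[OF K] calculation by metis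
    ultimately show "x = y" using place_eqI[OF K] by blast
  qed
  have "card (f ` F) \<le> card B"
  proof (rule card_inequivalent_le[OF B, where T = T])
    show "finite (f ` F)" using F by simp
    show "absolute_value K v" if v: "v \<in> f ` F" for v
    proof -
      obtain x where "x \<in> F" "v = f x" using v by auto
      then have "x \<in> P" "v = f x" using F by auto
      then have "x \<in> places K" "v \<in> x" using P f by blast+
      then show ?thesis by (rule places_absolute_value[OF K])
    qed
    show "\<not> equivalent_absolute_values K v w" if vw: "v \<in> f ` F" "w \<in> f ` F" "v \<noteq> w" for v w
    proof
      assume e: "equivalent_absolute_values K v w"
      obtain x y where xy: "x \<in> F" "y \<in> F" "v = f x" "w = f y" using vw by auto
      then have "x \<in> P" "y \<in> P" using F by auto
      then have "x \<in> places K" "y \<in> places K" "f x \<in> x" "f y \<in> y" using P f by blast+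
      then have "x = y" using place_eqI[OF K] e xy by blast
      then show False using vw xy by simp
    qed
    show "rational_unit_ball v = T" if "v \<in> f ` F" for v using that F f by auto
  qed
  then show False using card_image[OF inj] F by simp
qed

text \<open>Exponential growth beats linear growth. Estimates for n-th powers may thus lose a factor
  linear in n: the number of binomial terms in the ultrametric inequality, the number of digits in
  the bound of Ostrowski.\<close>

lemma linear_bounded_powers:
  fixes q A :: real
  assumes "\<And>n. q ^ n \<le> A * (real n + 1)" shows "q \<le> 1"
proof (rule ccontr)
  assume "\<not> q \<le> 1"
  then have q: "q > 1" by simp
  define x where "x = 1 / q"
  have x: "\<bar>x\<bar> < 1" "x > 0" "q * x = 1" using q by (auto simp: x_def)
  have "(\<lambda>n. real n * x ^ n) \<longlonglongrightarrow> 0" using powser_times_n_limit_0[of x] x by simp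
  moreover have "(\<lambda>n. x ^ n) \<longlonglongrightarrow> 0" using x by (intro LIMSEQ_power_zero) auto
  ultimately have "(\<lambda>n. A * (real n * x ^ n + x ^ n)) \<longlonglongrightarrow> A * (0 + 0)" by (intro tendsto_mult tendsto_add tendsto_const)
  then have "eventually (\<lambda>n. A * (real n * x ^ n + x ^ n) < 1) sequentially"
    by (intro order_tendstoD(2)[where y = "A * (0 + 0)"]) auto
  then obtain n where n: "A * (real n * x ^ n + x ^ n) < 1" by (auto simp: eventually_sequentially)
  have "q ^ n * x ^ n \<le> A * (real n + 1) * x ^ n" using assms x by (intro mult_right_mono) auto
  moreover have "q ^ n * x ^ n = 1" using x by (simp add: power_mult_distrib[symmetric])
  ultimately show False using n by (simp add: algebra_simps)
qed

section \<open>Ostrowski: the restriction of an absolute value to the rationals\<close>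

context absolute_value
begin

lemma ultrametricI:
  assumes nat: "\<And>n. v (of_nat n) \<le> 1" and x: "x \<in> K" and y: "y \<in> K"
  shows "v (x + y) \<le> max (v x) (v y)"
proof (cases "max (v x) (v y) = 0")
  case True
  have "v x \<ge> 0" "v y \<ge> 0" using x y by auto
  then have "v x = 0" "v y = 0" using True by (auto simp: max_def split: if_splits)
  then show ?thesis using x y by simp
next
  case False
  define M where "M = max (v x) (v y)"
  have M: "M > 0" "v x \<le> M" "v y \<le> M" "0 \<le> v x" "0 \<le> v y"
    using False nonneg[OF x] nonneg[OF y] by (auto simp: M_def max_def)
  have "(v (x + y) / M) ^ n \<le> 1 * (real n + 1)" for n
  proof -
    have "v (x + y) ^ n = v ((x + y) ^ n)" using x y by (simp add: at_power)
    also have "(x + y) ^ n = (\<Sum>k\<le>n. of_nat (n choose k) * x ^ k * y ^ (n - k))" by (rule binomial_ring)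
    also have "v \<dots> \<le> (\<Sum>k\<le>n. v (of_nat (n choose k) * x ^ k * y ^ (n - k)))"
      using x y by (intro at_sum) auto
    also have "\<dots> \<le> (\<Sum>k\<le>n. M ^ n)"
    proof (rule sum_mono)
      fix k assume k: "k \<in> {..n}"
      have "v (of_nat (n choose k) * x ^ k * y ^ (n - k)) = v (of_nat (n choose k)) * v x ^ k * v y ^ (n - k)"
        using x y by (simp add: mult at_power)
      also have "\<dots> \<le> 1 * M ^ k * M ^ (n - k)"
        using M nat nonneg[of "of_nat (n choose k)"] by (intro mult_mono power_mono) auto
      also have "\<dots> = M ^ n" using k by (simp add: power_add[symmetric])
      finally show "v (of_nat (n choose k) * x ^ k * y ^ (n - k)) \<le> M ^ n" .
    qed
    also have "\<dots> = (real n + 1) * M ^ n" by simp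
    finally show ?thesis using M by (simp add: power_divide divide_le_eq)
  qed
  then have "v (x + y) / M \<le> 1" by (rule linear_bounded_powers)
  then show ?thesis using M by (simp add: M_def[symmetric])
qed

text \<open>In base m such an n has L + 1 digits, each of absolute value at most m by the triangle
  inequality.\<close>

lemma base_expansion_bound:
  assumes "m \<ge> 2"
  shows "n < m ^ Suc L \<Longrightarrow> v (of_nat n) \<le> real m * (real L + 1) * max 1 (v (of_nat m)) ^ L"
proof (induction L arbitrary: n)
  case 0
  then have "real n \<le> real m" by simp
  then show ?case using at_of_nat_le[of n] by simp
next
  case (Suc L)
  define M where "M = max 1 (v (of_nat m))"
  have M: "M \<ge> 1" "v (of_nat m) \<le> M" by (auto simp: M_def)
  have lt: "n div m < m ^ Suc L" using Suc.prems by (simp add: less_mult_imp_div_less mult.commute)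
  have "of_nat n = of_nat (n div m) * of_nat m + (of_nat (n mod m) :: qbar)"
    by (metis div_mult_mod_eq of_nat_add of_nat_mult)
  then have "v (of_nat n) \<le> v (of_nat (n div m)) * v (of_nat m) + v (of_nat (n mod m))"
    using triangle[of "of_nat (n div m) * of_nat m" "of_nat (n mod m)"] by (simp add: mult)
  also have "\<dots> \<le> real m * (real L + 1) * M ^ L * M + real m * M ^ Suc L"
  proof (rule add_mono)
    show "v (of_nat (n div m)) * v (of_nat m) \<le> real m * (real L + 1) * M ^ L * M"
      using Suc.IH[OF lt] M by (intro mult_mono) (auto simp: M_def[symmetric])
    have "v (of_nat (n mod m)) \<le> real (n mod m)" by (rule at_of_nat_le)
    also have "\<dots> \<le> real m * 1" using assms by simp
    also have "\<dots> \<le> real m * M ^ Suc L" using M(1) by (intro mult_left_mono one_le_power) auto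
    finally show "v (of_nat (n mod m)) \<le> real m * M ^ Suc L" .
  qed
  also have "\<dots> = real m * (real (Suc L) + 1) * M ^ Suc L" by (simp add: algebra_simps)
  finally show ?case by (simp add: M_def)
qed

text \<open>The digit bound is applied to a^k, which has about k ln a / ln m digits in base m; the
  linear factor disappears on passing to k-th roots.\<close>

lemma ostrowski_bound:
  assumes a: "a \<ge> 2" and m: "m \<ge> 2"
  shows "v (of_nat a) \<le> max 1 (v (of_nat m)) powr (ln (real a) / ln (real m))"
proof -
  define M where "M = max 1 (v (of_nat m))"
  define \<alpha> where "\<alpha> = ln (real a) / ln (real m)"
  have M: "M \<ge> 1" by (simp add: M_def)
  have lm: "ln (real m) > 0" "ln (real a) > 0" using m a by auto
  have \<alpha>: "\<alpha> > 0" using lm by (simp add: \<alpha>_def)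
  have "(v (of_nat a) / (M powr \<alpha>)) ^ k \<le> (real m * (\<alpha> + 1)) * (real k + 1)" for k
  proof -
    define L where "L = nat \<lfloor>real k * \<alpha>\<rfloor>"
    have L: "real L \<le> real k * \<alpha>" "real k * \<alpha> < real L + 1"
      using \<alpha> by (auto simp: L_def)
    have "real k * ln (real a) < (real L + 1) * ln (real m)"
      using L(2) lm by (simp add: \<alpha>_def field_simps)
    then have "ln (real a ^ k) < ln (real m ^ Suc L)"
      using a m by (simp add: ln_realpow algebra_simps del: power_Suc)
    then have "real a ^ k < real m ^ Suc L" using a m by (subst (asm) ln_less_cancel_iff) auto
    then have "real (a ^ k) < real (m ^ Suc L)" by (simp only: of_nat_power)
    then have "a ^ k < m ^ Suc L" by (simp only: of_nat_less_iff)
    from base_expansion_bound[OF m this]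
    have "v (of_nat a) ^ k \<le> real m * (real L + 1) * M ^ L" by (simp add: at_power M_def)
    also have "M ^ L = M powr real L" using M by (simp add: powr_realpow)
    also have "real m * (real L + 1) * M powr real L \<le> real m * (real k * \<alpha> + 1) * M powr (real k * \<alpha>)"
      using L(1) M \<alpha> by (intro mult_mono powr_mono) auto
    also have "\<dots> \<le> (real m * (\<alpha> + 1) * (real k + 1)) * M powr (real k * \<alpha>)"
    proof (intro mult_right_mono)
      have "real m * (real k * \<alpha> + 1) \<le> real m * ((\<alpha> + 1) * (real k + 1))"
        using \<alpha> by (intro mult_left_mono) (auto simp: algebra_simps)
      then show "real m * (real k * \<alpha> + 1) \<le> real m * (\<alpha> + 1) * (real k + 1)" by (simp add: mult.assoc)
    qed simp
    also have "M powr (real k * \<alpha>) = (M powr \<alpha>) ^ k"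
      using M by (simp add: powr_realpow[symmetric] powr_powr mult.commute)
    finally show ?thesis using M by (simp add: power_divide divide_le_eq)
  qed
  then have "v (of_nat a) / (M powr \<alpha>) \<le> 1" by (rule linear_bounded_powers)
  then show ?thesis using M by (simp add: M_def[symmetric] \<alpha>_def[symmetric])
qed

text \<open>A failure of the ultrametric inequality forces \<open>v\<close> above 1 at some natural
  number, and by the bound of Ostrowski at all of them from 2 on. The bound taken in both directions
  then makes ln (v a) / ln a constant, so \<open>v\<close> is strictly increasing on the positive
  integers.\<close>

lemma archimedean_unit_ball:
  assumes "x \<in> K" "y \<in> K" "v (x + y) > max (v x) (v y)"
  shows "rational_unit_ball v = {r. \<bar>r\<bar> \<le> 1}"
proof -
  obtain n where n: "v (of_nat n) > 1" using ultrametricI[OF _ assms(1,2)] assms(3) by (metis not_le)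
  have n2: "n \<ge> 2"
  proof (rule ccontr)
    assume "\<not> n \<ge> 2"
    then have "n = 0 \<or> n = 1" by auto
    then show False using n by auto
  qed
  have gt: "v (of_nat m) > 1" if "m \<ge> 2" for m
  proof (rule ccontr)
    assume "\<not> v (of_nat m) > 1"
    then have "max 1 (v (of_nat m)) = 1" by simp
    then show False using ostrowski_bound[OF n2 that] n by simp
  qed
  have le: "ln (v (of_nat a)) / ln a \<le> ln (v (of_nat m)) / ln m" if am: "a \<ge> 2" "m \<ge> 2" for a m :: nat
  proof -
    have "v (of_nat a) \<le> v (of_nat m) powr (ln (real a) / ln (real m))"
      using ostrowski_bound[OF am] gt[OF am(2)] by (simp add: max_def)
    then have "ln (v (of_nat a)) \<le> ln (v (of_nat m) powr (ln (real a) / ln (real m)))"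
      using gt[OF am(1)] by (intro ln_mono) auto
    also have "\<dots> = ln (real a) / ln (real m) * ln (v (of_nat m))" using gt[OF am(2)] by (simp add: ln_powr)
    finally show ?thesis using am by (simp add: field_simps)
  qed
  have mono: "v (of_nat a) < v (of_nat b)" if "a < b" "a \<ge> 1" for a b :: nat
  proof (cases "a = 1")
    case True
    then show ?thesis using gt[of b] that by simp
  next
    case False
    then have ab: "a \<ge> 2" "b \<ge> 2" using that by auto
    have eq: "ln (v (of_nat a)) / ln a = ln (v (of_nat b)) / ln b" using le[OF ab] le[OF ab(2,1)] by simp
    have "ln (v (of_nat b)) > 0" using gt[OF ab(2)] by simp
    have "ln (v (of_nat a)) = ln (v (of_nat b)) / ln b * ln a" using eq ab by (simp add: field_simps)
    also have "\<dots> < ln (v (of_nat b)) / ln b * ln b"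
      using \<open>ln (v (of_nat b)) > 0\<close> ab that by (intro mult_strict_left_mono) auto
    also have "\<dots> = ln (v (of_nat b))" using ab by simp
    finally show ?thesis using gt[OF ab(1)] gt[OF ab(2)] by (subst (asm) ln_less_cancel_iff) auto
  qed
  have "v (of_rat r) \<le> 1 \<longleftrightarrow> \<bar>r\<bar> \<le> 1" for r
  proof -
    obtain p q where pq: "quotient_of r = (p, q)" by fastforce
    have q: "q > 0" using quotient_of_denom_pos[OF pq] .
    have r: "r = of_int p / of_int q" using quotient_of_div[OF pq] .
    define a b where "a = nat \<bar>p\<bar>" and "b = nat q"
    have b: "b \<ge> 1" using q by (simp add: b_def)
    have "v (of_int p) = v (of_nat a)"
    proof (cases "p \<ge> 0")
      case True
      then have "of_int p = (of_nat a :: qbar)" by (simp add: a_def)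
      then show ?thesis by simp
    next
      case False
      then have "of_int p = - (of_nat a :: qbar)" by (simp add: a_def)
      then show ?thesis by simp
    qed
    moreover have "of_int q = (of_nat b :: qbar)" using q by (simp add: b_def)
    ultimately have "v (of_rat r) = v (of_nat a) / v (of_nat b)"
      by (simp add: r of_rat_divide at_divide)
    moreover have "v (of_nat b) > 0" using b by (intro pos) auto
    ultimately have "v (of_rat r) \<le> 1 \<longleftrightarrow> v (of_nat a) \<le> v (of_nat b)" by simp
    also have "\<dots> \<longleftrightarrow> a \<le> b"
    proof
      assume "v (of_nat a) \<le> v (of_nat b)"
      then show "a \<le> b" using mono[of b a] b by force
    next
      assume "a \<le> b"
      then show "v (of_nat a) \<le> v (of_nat b)"
        using mono[of a b] nonneg[of "of_nat b"] by (cases "a = 0"; cases "a = b") auto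
    qed
    also have "\<dots> \<longleftrightarrow> \<bar>r\<bar> \<le> 1" using q by (auto simp: r a_def b_def abs_divide of_int_abs[symmetric] simp del: of_int_abs)
    finally show ?thesis .
  qed
  then show ?thesis by (auto simp: rational_unit_ball_def)
qed

context
  assumes ultra: "\<And>x y. x \<in> K \<Longrightarrow> y \<in> K \<Longrightarrow> v (x + y) \<le> max (v x) (v y)"
begin

lemma ultrametric_of_nat: "v (of_nat n) \<le> 1"
proof (induction n)
  case (Suc n)
  have "v (of_nat n + 1) \<le> max (v (of_nat n)) (v 1)" by (rule ultra) auto
  then show ?case using Suc by (simp add: add.commute)
qed simp

lemma ultrametric_of_int: "v (of_int n) \<le> 1"
proof (cases n rule: int_cases2)
  case (nonneg k)
  then show ?thesis using ultrametric_of_nat[of k] by simp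
next
  case (nonpos k)
  then show ?thesis using ultrametric_of_nat[of k] by simp
qed

lemma ultrametric_sum:
  assumes "\<And>i. i \<in> I \<Longrightarrow> f i \<in> K \<and> v (f i) \<le> C" "C \<ge> 0"
  shows "v (\<Sum>i\<in>I. f i) \<le> C"
  using assms(1)
proof (induction I rule: infinite_finite_induct)
  case (insert i I)
  have "v (f i + sum f I) \<le> max (v (f i)) (v (sum f I))" using insert by (intro ultra K_sum) simp_all
  also have "\<dots> \<le> C" using insert by simp
  finally show ?case using insert by simp
qed (use assms(2) in simp_all)

text \<open>Otherwise Bezout would write 1 as a sum of two elements of size below 1.\<close>

lemma coprime_unit:
  assumes "prime p" "v (of_int p) < 1" "\<not> p dvd n"
  shows "v (of_int n) = 1"
proof (rule ccontr)
  assume "v (of_int n) \<noteq> 1"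
  then have n: "v (of_int n) < 1" using ultrametric_of_int[of n] by simp
  have "coprime p n" using assms by (simp add: prime_imp_coprime)
  then obtain x y where "x * p + y * n = 1" by (metis bezout_int coprime_imp_gcd_eq_1)
  then have 1: "(1 :: qbar) = of_int x * of_int p + of_int y * of_int n" by (metis of_int_1 of_int_add of_int_mult)
  have lt: "v (of_int k * of_int l) < 1" if "v (of_int l) < 1" for k l :: int
  proof -
    have "v (of_int k * of_int l) = v (of_int k) * v (of_int l)" by (simp add: mult)
    also have "\<dots> \<le> 1 * v (of_int l)" using ultrametric_of_int by (intro mult_right_mono) auto
    finally show ?thesis using that by simp
  qed
  have "v 1 \<le> max (v (of_int x * of_int p)) (v (of_int y * of_int n))"
    by (subst 1, rule ultra) auto
  then show False using lt[OF n, of y] lt[OF assms(2), of x] by simp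
qed

lemma nonarchimedean_unit_ball:
  assumes "prime p" "v (of_int p) < 1"
  shows "rational_unit_ball v = {r. \<not> p dvd snd (quotient_of r)}"
proof -
  have "v (of_rat r) \<le> 1 \<longleftrightarrow> \<not> p dvd snd (quotient_of r)" for r
  proof -
    obtain a b where ab: "quotient_of r = (a, b)" by fastforce
    have q: "b > 0" using quotient_of_denom_pos[OF ab] .
    have cop: "coprime a b" using quotient_of_coprime[OF ab] .
    have r: "r = of_int a / of_int b" using quotient_of_div[OF ab] .
    have vr: "v (of_rat r) = v (of_int a) / v (of_int b)" by (simp add: r of_rat_divide at_divide)
    have vb: "v (of_int b) > 0" using q by (intro pos) auto
    show ?thesis
    proof (cases "p dvd b")
      case False
      then have "v (of_int b) = 1" using coprime_unit[OF assms] by simp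
      then show ?thesis using vr ultrametric_of_int[of a] ab False by simp
    next
      case True
      then have "\<not> p dvd a" using cop assms(1) by (meson coprime_common_divisor not_prime_unit)
      then have va: "v (of_int a) = 1" using coprime_unit[OF assms] by simp
      obtain k where "b = p * k" using True by auto
      then have "v (of_int b) = v (of_int p) * v (of_int k)" by (simp add: mult)
      also have "\<dots> \<le> v (of_int p) * 1" using ultrametric_of_int by (intro mult_left_mono) auto
      finally have "v (of_int b) < 1" using assms by simp
      then have "v (of_rat r) > 1" using vr va vb by simp
      then show ?thesis using True ab by simp
    qed
  qed
  then show ?thesis by (auto simp: rational_unit_ball_def)
qed

lemma ex_prime_less_1:
  assumes "v (of_int n) < 1" "n > 0"
  obtains p where "prime p" "p dvd n" "v (of_int p) < 1"
proof -
  have "\<exists>p. prime p \<and> p dvd int k \<and> v (of_int p) < 1" if "v (of_nat k) < 1" "k > 0" for k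
    using that
  proof (induction k rule: less_induct)
    case (less k)
    have "k \<noteq> 1" using less.prems by auto
    then obtain q where q: "prime q" "q dvd k" using prime_factor_nat by blast
    obtain l where l: "k = q * l" using q by auto
    show ?case
    proof (cases "v (of_nat q) < 1")
      case True
      then show ?thesis using q by (intro exI[of _ "int q"]) auto
    next
      case False
      then have "v (of_nat q) = 1" using ultrametric_of_nat[of q] by simp
      then have "v (of_nat l) < 1" using less.prems l by (simp add: mult)
      moreover have "l > 0" "l < k" using less.prems l q prime_gt_1_nat[OF q(1)] by auto
      ultimately obtain p where "prime p" "p dvd int l" "v (of_int p) < 1" using less.IH by blast
      then show ?thesis using l by auto
    qed
  qed
  from this[of "nat n"] assms that show thesis by auto
qed

end

end

section \<open>Finitely many places at which given elements fail to be integral\<close>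

lemma finite_archimedean_places:
  assumes K: "number_field K" shows "finite (archimedean_places K)"
proof (rule finite_places_over[OF K])
  fix \<nu> assume "\<nu> \<in> archimedean_places K"
  then have \<nu>: "\<nu> \<in> places K" "\<not> nonarchimedean K \<nu>" by (auto simp: archimedean_places_def)
  then obtain v x y where v: "v \<in> \<nu>" "x \<in> K" "y \<in> K" "v (x + y) > max (v x) (v y)"
    unfolding nonarchimedean_def by (meson not_le_imp_less)
  interpret absolute_value K v using places_absolute_value[OF K \<nu>(1) v(1)] .
  show "\<nu> \<in> places K \<and> (\<exists>v\<in>\<nu>. rational_unit_ball v = {r. \<bar>r\<bar> \<le> 1})"
    using archimedean_unit_ball[OF v(2,3,4)] \<nu> v by blast
qed

definition places_above :: "qbar set \<Rightarrow> int \<Rightarrow> place set" where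
  "places_above K p = {\<nu> \<in> places K. nonarchimedean K \<nu> \<and> (\<exists>v\<in>\<nu>. v (of_int p) < 1)}"

lemma finite_places_above:
  assumes K: "number_field K" and p: "prime p" shows "finite (places_above K p)"
proof (rule finite_places_over[OF K])
  fix \<nu> assume "\<nu> \<in> places_above K p"
  then obtain v where v: "\<nu> \<in> places K" "nonarchimedean K \<nu>" "v \<in> \<nu>" "v (of_int p) < 1"
    by (auto simp: places_above_def)
  interpret absolute_value K v using places_absolute_value[OF K v(1,3)] .
  show "\<nu> \<in> places K \<and> (\<exists>v\<in>\<nu>. rational_unit_ball v = {r. \<not> p dvd snd (quotient_of r)})"
    using nonarchimedean_unit_ball[OF _ p v(4)] v unfolding nonarchimedean_def by blast
qed

text \<open>
  Multiplication by \<open>a\<close> has a matrix with rational entries; where these are integral, \<open>a\<close> is integral as well.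
\<close>

lemma finite_denominators:
  assumes K: "number_field K" and a: "a \<in> K"
  obtains C :: "rat set" where "finite C"
    "\<And>v. absolute_value K v \<Longrightarrow> (\<And>x y. x \<in> K \<Longrightarrow> y \<in> K \<Longrightarrow> v (x + y) \<le> max (v x) (v y)) \<Longrightarrow>
       (\<And>c. c \<in> C \<Longrightarrow> v (of_rat c) \<le> 1) \<Longrightarrow> v a \<le> 1"
proof -
  obtain B where B: "finite B" "K = Q.span B" using number_field_span[OF K] .
  have BK: "b \<in> B \<Longrightarrow> b \<in> K" for b using B Q.span_base by auto
  have "\<exists>u. a * b = (\<Sum>x\<in>B. of_rat (u x) * x)" if "b \<in> B" for b
    using number_field_mult[OF K a BK[OF that]] unfolding B(2) Q.span_finite[OF B(1)] by auto
  then obtain u where u: "\<And>b. b \<in> B \<Longrightarrow> a * b = (\<Sum>x\<in>B. of_rat (u b x) * x)" by metis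
  define C where "C = (\<lambda>(b, x). u b x) ` (B \<times> B)"
  show thesis
  proof (rule that[of C])
    show "finite C" using B by (simp add: C_def)
    fix v assume v: "absolute_value K v"
      and ultra: "\<And>x y. x \<in> K \<Longrightarrow> y \<in> K \<Longrightarrow> v (x + y) \<le> max (v x) (v y)"
      and C: "\<And>c. c \<in> C \<Longrightarrow> v (of_rat c) \<le> 1"
    interpret absolute_value K v by fact
    have "\<exists>b\<in>B. b \<noteq> 0"
    proof (rule ccontr)
      assume "\<not> (\<exists>b\<in>B. b \<noteq> 0)"
      then have "B \<subseteq> {0}" by auto
      then have "Q.span B \<subseteq> {0}" using Q.span_mono[of B "{0}"] by auto
      then show False using number_field_1[OF K] B by auto
    qed
    then obtain b1 where b1: "b1 \<in> B" "b1 \<noteq> 0" by auto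
    \<comment> \<open>For the generator \<open>b\<close> of largest absolute value, the integral
      matrix entries bound the value at \<open>a * b\<close> by \<open>v b\<close>, which can then
      be cancelled.\<close>
    have "Max (v ` B) \<in> v ` B" using B b1 by (intro Max_in) auto
    then obtain b where b: "b \<in> B" "v b = Max (v ` B)" by auto
    have max: "v x \<le> v b" if "x \<in> B" for x unfolding b using B that by simp
    have vb: "v b > 0" using max[OF b1(1)] pos[OF BK[OF b1(1)] b1(2)] by simp
    have "v a * v b = v (\<Sum>x\<in>B. of_rat (u b x) * x)" using u[OF b(1)] mult[OF a BK[OF b(1)]] by simp
    also have "\<dots> \<le> v b"
    proof (rule ultrametric_sum[OF ultra])
      fix x assume x: "x \<in> B"
      have "u b x \<in> C" using b x by (auto simp: C_def)
      then have "v (of_rat (u b x)) * v x \<le> 1 * v b"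
        using C max[OF x] BK[OF x] by (intro mult_mono) auto
      then show "of_rat (u b x) * x \<in> K \<and> v (of_rat (u b x) * x) \<le> v b" using BK[OF x] by (simp add: mult)
    qed (use vb in auto)
    finally show "v a \<le> 1" using vb by simp
  qed
qed

text \<open>Only primes in the denominators of the finitely many rational numbers supplied by
  \<open>finite_denominators\<close> can spoil integrality, and each of them has finitely many
  places above it.\<close>

lemma finite_exceptional_places:
  assumes K: "number_field K" and "a \<in> K"
  obtains S where "finite S" "\<And>\<nu>. \<nu> \<in> places K - S \<Longrightarrow> nonarchimedean K \<nu> \<Longrightarrow> a \<in> valuation_ring_of K \<nu>"
proof -
  obtain C :: "rat set" where C: "finite C"
    "\<And>v. absolute_value K v \<Longrightarrow> (\<And>x y. x \<in> K \<Longrightarrow> y \<in> K \<Longrightarrow> v (x + y) \<le> max (v x) (v y)) \<Longrightarrow>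
       (\<And>c. c \<in> C \<Longrightarrow> v (of_rat c) \<le> 1) \<Longrightarrow> v a \<le> 1" by (rule finite_denominators[OF assms]) blast
  define P where "P = (\<Union>c\<in>C. {p. prime p \<and> p dvd snd (quotient_of c)})"
  have "finite {p. prime p \<and> p dvd snd (quotient_of c)}" for c
    by (rule finite_subset[of _ "{p. p dvd snd (quotient_of c)}"])
      (use quotient_of_denom_pos'[of c] in \<open>auto intro!: finite_divisors_int\<close>)
  then have P: "finite P" using C(1) by (simp add: P_def)
  show thesis
  proof (rule that[of "\<Union>p\<in>P. places_above K p"])
    show "finite (\<Union>p\<in>P. places_above K p)"
      by (rule finite_UN_I[OF P], rule finite_places_above[OF K]) (auto simp: P_def)
    fix \<nu> assume \<nu>: "\<nu> \<in> places K - (\<Union>p\<in>P. places_above K p)" "nonarchimedean K \<nu>"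
    have "v a \<le> 1" if v: "v \<in> \<nu>" for v
    proof (rule C(2))
      show "absolute_value K v" using places_absolute_value[OF K _ v] \<nu> by auto
      interpret absolute_value K v by fact
      show ultra: "v (x + y) \<le> max (v x) (v y)" if "x \<in> K" "y \<in> K" for x y
        using \<nu>(2) v that unfolding nonarchimedean_def by blast
      fix c assume c: "c \<in> C"
      obtain m n where mn: "quotient_of c = (m, n)" by fastforce
      have n: "n > 0" using quotient_of_denom_pos[OF mn] .
      have "v (of_int n) = 1"
      proof (rule ccontr)
        assume "v (of_int n) \<noteq> 1"
        then have "v (of_int n) < 1" using ultrametric_of_int[OF ultra, of n] by simp
        from ex_prime_less_1[OF ultra this n] obtain p where p: "prime p" "p dvd n" "v (of_int p) < 1" .
        then have "p \<in> P" "\<nu> \<in> places_above K p" using c mn \<nu> v by (auto simp: P_def places_above_def)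
        then show False using \<nu> by auto
      qed
      moreover have "v (of_rat c) = v (of_int m) / v (of_int n)"
        using quotient_of_div[OF mn] by (simp add: of_rat_divide at_divide)
      ultimately show "v (of_rat c) \<le> 1" using ultrametric_of_int[OF ultra, of m] by simp
    qed
    then show "a \<in> valuation_ring_of K \<nu>" using assms by (simp add: valuation_ring_of_def)
  qed
qed

lemma ex_places_integral:
  assumes K: "number_field K" and A: "finite A" "A \<subseteq> K"
  obtains S where "finite S" "archimedean_places K \<subseteq> S" "S \<subseteq> places K"
    "\<And>\<nu> a. \<nu> \<in> places K - S \<Longrightarrow> a \<in> A \<Longrightarrow> a \<in> valuation_ring_of K \<nu>"
proof -
  have "\<forall>a\<in>A. \<exists>S. finite S \<and> (\<forall>\<nu>\<in>places K - S. nonarchimedean K \<nu> \<longrightarrow> a \<in> valuation_ring_of K \<nu>)"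
  proof
    fix a assume "a \<in> A"
    then have "a \<in> K" using A by auto
    from finite_exceptional_places[OF K this]
    show "\<exists>S. finite S \<and> (\<forall>\<nu>\<in>places K - S. nonarchimedean K \<nu> \<longrightarrow> a \<in> valuation_ring_of K \<nu>)" by metis
  qed
  then obtain T where T: "\<And>a. a \<in> A \<Longrightarrow> finite (T a) \<and> (\<forall>\<nu>\<in>places K - T a. nonarchimedean K \<nu> \<longrightarrow> a \<in> valuation_ring_of K \<nu>)"
    by metis
  show thesis
  proof (rule that[of "archimedean_places K \<union> (places K \<inter> (\<Union>a\<in>A. T a))"])
    show "finite (archimedean_places K \<union> (places K \<inter> (\<Union>a\<in>A. T a)))"
      using finite_archimedean_places[OF K] A T by auto
    show "archimedean_places K \<union> (places K \<inter> (\<Union>a\<in>A. T a)) \<subseteq> places K"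
      by (auto simp: archimedean_places_def)
    fix \<nu> a assume "\<nu> \<in> places K - (archimedean_places K \<union> (places K \<inter> (\<Union>a\<in>A. T a)))" "a \<in> A"
    then show "a \<in> valuation_ring_of K \<nu>" using T[of a] by (auto simp: archimedean_places_def)
  qed auto
qed

lemma valuation_ring_closed:
  assumes K: "number_field K" and \<nu>: "\<nu> \<in> places K" "nonarchimedean K \<nu>"
  shows "0 \<in> valuation_ring_of K \<nu>" "1 \<in> valuation_ring_of K \<nu>"
    and "x \<in> valuation_ring_of K \<nu> \<Longrightarrow> - x \<in> valuation_ring_of K \<nu>"
    and "x \<in> valuation_ring_of K \<nu> \<Longrightarrow> y \<in> valuation_ring_of K \<nu> \<Longrightarrow> x * y \<in> valuation_ring_of K \<nu>"
    and "x \<in> valuation_ring_of K \<nu> \<Longrightarrow> y \<in> valuation_ring_of K \<nu> \<Longrightarrow> x + y \<in> valuation_ring_of K \<nu>"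
proof -
  have av: "absolute_value K v" if "v \<in> \<nu>" for v using places_absolute_value[OF K \<nu>(1) that] .
  have "v 0 \<le> 1" "v 1 \<le> 1" if "v \<in> \<nu>" for v
    using absolute_value.at_0[OF av[OF that]] absolute_value.at_1[OF av[OF that]] by auto
  then show "0 \<in> valuation_ring_of K \<nu>" "1 \<in> valuation_ring_of K \<nu>"
    using number_field_0[OF K] number_field_1[OF K] by (auto simp: valuation_ring_of_def)
  assume x: "x \<in> valuation_ring_of K \<nu>"
  then have xK: "x \<in> K" "v x \<le> 1" if "v \<in> \<nu>" for v using that by (auto simp: valuation_ring_of_def)
  have "v (- x) \<le> 1" if "v \<in> \<nu>" for v
    using absolute_value.at_minus[OF av[OF that] xK(1)[OF that]] xK(2)[OF that] by simp
  then show "- x \<in> valuation_ring_of K \<nu>"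
    using x number_field_minus[OF K] by (auto simp: valuation_ring_of_def)
  assume y: "y \<in> valuation_ring_of K \<nu>"
  then have yK: "y \<in> K" "v y \<le> 1" if "v \<in> \<nu>" for v using that by (auto simp: valuation_ring_of_def)
  have "v (x * y) \<le> 1" "v (x + y) \<le> 1" if "v \<in> \<nu>" for v
  proof -
    interpret absolute_value K v using av[OF that] .
    show "v (x * y) \<le> 1" using mult xK[OF that] yK[OF that] nonneg by (simp add: mult_le_one)
    have "v (x + y) \<le> max (v x) (v y)" using \<nu>(2) that xK[OF that] yK[OF that] unfolding nonarchimedean_def by blast
    then show "v (x + y) \<le> 1" using xK[OF that] yK[OF that] by simp
  qed
  then show "x * y \<in> valuation_ring_of K \<nu>" "x + y \<in> valuation_ring_of K \<nu>"
    using x y number_field_mult[OF K] number_field_add[OF K] by (auto simp: valuation_ring_of_def)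
qed

section \<open>Evaluation of polynomials\<close>

text \<open>Polynomial dependence on one variable, as a property of functions. It passes through
  evaluation of forms and through determinants without writing the polynomial down, and only the
  number of zeros is ever exploited.\<close>

definition polyfun :: "('a::comm_ring_1 \<Rightarrow> 'a) \<Rightarrow> bool" where
  "polyfun f \<longleftrightarrow> (\<exists>p. \<forall>x. f x = poly p x)"

lemma polyfunI: "(\<And>x. f x = poly p x) \<Longrightarrow> polyfun f"
  unfolding polyfun_def by blast

lemma polyfun_const [simp, intro]: "polyfun (\<lambda>x. c)"
  by (rule polyfunI[of _ "[:c:]"]) simp

lemma polyfun_id [simp, intro]: "polyfun (\<lambda>x. x)"
  by (rule polyfunI[of _ "[:0, 1:]"]) simp

lemma polyfun_add [intro]: "polyfun f \<Longrightarrow> polyfun g \<Longrightarrow> polyfun (\<lambda>x. f x + g x)"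
  unfolding polyfun_def by (metis poly_add)

lemma polyfun_mult [intro]: "polyfun f \<Longrightarrow> polyfun g \<Longrightarrow> polyfun (\<lambda>x. f x * g x)"
  unfolding polyfun_def by (metis poly_mult)

lemma polyfun_minus [intro]: "polyfun f \<Longrightarrow> polyfun (\<lambda>x. - f x)"
  unfolding polyfun_def by (metis poly_minus)

lemma polyfun_diff [intro]: "polyfun f \<Longrightarrow> polyfun g \<Longrightarrow> polyfun (\<lambda>x. f x - g x)"
  unfolding polyfun_def by (metis poly_diff)

lemma polyfun_power [intro]: "polyfun f \<Longrightarrow> polyfun (\<lambda>x. f x ^ n)"
  by (induction n) auto

lemma polyfun_sum [intro]: "(\<And>i. i \<in> I \<Longrightarrow> polyfun (f i)) \<Longrightarrow> polyfun (\<lambda>x. \<Sum>i\<in>I. f i x)"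
  by (induction I rule: infinite_finite_induct) auto

lemma polyfun_prod [intro]: "(\<And>i. i \<in> I \<Longrightarrow> polyfun (f i)) \<Longrightarrow> polyfun (\<lambda>x. \<Prod>i\<in>I. f i x)"
  by (induction I rule: infinite_finite_induct) auto

lemma polyfun_eq_0:
  fixes f :: "'a::idom \<Rightarrow> 'a"
  assumes "polyfun f" "infinite {x. f x = 0}"
  shows "f x = 0"
proof -
  obtain p where p: "\<And>x. f x = poly p x" using assms by (auto simp: polyfun_def)
  have "p = 0" using poly_roots_finite[of p] assms(2) unfolding p by blast
  then show ?thesis using p by simp
qed

definition monomial_value :: "('n::finite \<Rightarrow>\<^sub>0 nat) \<Rightarrow> qbar ^ 'n \<Rightarrow> qbar" where
  "monomial_value m x = (\<Prod>i\<in>UNIV. (x $ i) ^ lookup m i)"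

lemma peval_eq: "peval f x = (\<Sum>m\<in>keys f. lookup f m * monomial_value m x)"
  by (simp add: peval_def monomial_value_def)

lemma peval_superset:
  assumes "finite A" "keys f \<subseteq> A"
  shows "peval f x = (\<Sum>m\<in>A. lookup f m * monomial_value m x)"
  unfolding peval_eq
  by (rule sum.mono_neutral_left[OF assms]) (auto simp: in_keys_iff)

lemma peval_add [simp]: "peval (f + g) x = peval f x + peval g x"
proof -
  have "keys (f + g) \<subseteq> keys f \<union> keys g" by (rule keys_add)
  then show ?thesis
    using peval_superset[of "keys f \<union> keys g" "f + g" x] peval_superset[of "keys f \<union> keys g" f x]
      peval_superset[of "keys f \<union> keys g" g x]
    by (simp add: lookup_add algebra_simps sum.distrib)
qed

lemma peval_zero [simp]: "peval 0 x = 0"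
  by (simp add: peval_eq)

lemma peval_single [simp]: "peval (Poly_Mapping.single m c) x = c * monomial_value m x"
  by (subst peval_superset[of "{m}"]) auto

lemma peval_sum: "peval (\<Sum>i\<in>I. f i) x = (\<Sum>i\<in>I. peval (f i) x)"
  by (induction I rule: infinite_finite_induct) auto

lemma monomial_value_add: "monomial_value (m + n) x = monomial_value m x * monomial_value n x"
  by (simp add: monomial_value_def lookup_add power_add prod.distrib)

lemma monomial_value_single [simp]: "monomial_value (Poly_Mapping.single i 1) x = x $ i"
proof -
  have "monomial_value (Poly_Mapping.single i 1) x = (\<Prod>j\<in>UNIV. if j = i then x $ i else 1)"
    unfolding monomial_value_def by (rule prod.cong) (auto simp: lookup_single when_def)
  then show ?thesis by simp
qed

lemma poly_mapping_eq_sum_single: "(f :: 'a \<Rightarrow>\<^sub>0 'b::comm_monoid_add) = (\<Sum>m\<in>keys f. Poly_Mapping.single m (lookup f m))"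
proof (rule poly_mapping_eqI)
  fix k
  show "lookup f k = lookup (\<Sum>m\<in>keys f. Poly_Mapping.single m (lookup f m)) k"
    by (simp add: lookup_sum lookup_single when_def in_keys_iff)
qed

lemma peval_mult [simp]: "peval (f * g) x = peval f x * peval g x"
proof -
  have "f * g = (\<Sum>m\<in>keys f. \<Sum>n\<in>keys g. Poly_Mapping.single (m + n) (lookup f m * lookup g n))"
    by (subst poly_mapping_eq_sum_single[of f], subst poly_mapping_eq_sum_single[of g])
      (simp add: sum_product mult_single)
  then have "peval (f * g) x = (\<Sum>m\<in>keys f. \<Sum>n\<in>keys g. lookup f m * lookup g n * (monomial_value m x * monomial_value n x))"
    by (simp add: peval_sum monomial_value_add)
  also have "\<dots> = peval f x * peval g x"
    by (simp add: peval_eq sum_product mult_ac)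
  finally show ?thesis .
qed

lemma peval_uminus [simp]: "peval (- f) x = - peval f x"
  using peval_add[of f "- f" x] by (simp add: eq_neg_iff_add_eq_0 add.commute)

lemma peval_diff [simp]: "peval (f - g) x = peval f x - peval g x"
  using peval_add[of f "- g" x] by simp

lemma peval_homogeneous:
  assumes "homogeneous_of_degree d f"
  shows "peval f (c *s x) = c ^ d * peval f x"
proof -
  have "monomial_value m (c *s x) = c ^ d * monomial_value m x" if "m \<in> keys f" for m
  proof -
    have "monomial_value m (c *s x) = (\<Prod>i\<in>UNIV. c ^ lookup m i) * monomial_value m x"
      by (simp add: monomial_value_def power_mult_distrib prod.distrib)
    also have "(\<Prod>i\<in>UNIV. c ^ lookup m i) = c ^ d"
      using assms that by (simp add: power_sum[symmetric] homogeneous_of_degree_def)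
    finally show ?thesis .
  qed
  then show ?thesis by (simp add: peval_eq sum_distrib_left mult_ac)
qed

lemma polyfun_peval:
  fixes \<gamma> :: "qbar \<Rightarrow> qbar ^ 'n::finite"
  assumes "\<And>i. polyfun (\<lambda>t. \<gamma> t $ i)"
  shows "polyfun (\<lambda>t. peval f (\<gamma> t))"
  unfolding peval_def using assms by (intro polyfun_sum polyfun_mult polyfun_const polyfun_prod polyfun_power) auto

lemma homogeneous_add:
  "homogeneous_of_degree d f \<Longrightarrow> homogeneous_of_degree d g \<Longrightarrow> homogeneous_of_degree d (f + g)"
  unfolding homogeneous_of_degree_def using keys_add[of f g] by blast

lemma homogeneous_uminus: "homogeneous_of_degree d f \<Longrightarrow> homogeneous_of_degree d (- f)"
  unfolding homogeneous_of_degree_def by simp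

lemma homogeneous_diff:
  "homogeneous_of_degree d f \<Longrightarrow> homogeneous_of_degree d g \<Longrightarrow> homogeneous_of_degree d (f - g)"
  using homogeneous_add[OF _ homogeneous_uminus, of d f g] by simp

lemma homogeneous_mult:
  assumes "homogeneous_of_degree d f" "homogeneous_of_degree e g"
  shows "homogeneous_of_degree (d + e) (f * g)"
  unfolding homogeneous_of_degree_def
proof
  fix k assume "k \<in> keys (f * g)"
  then obtain a b where "k = a + b" "a \<in> keys f" "b \<in> keys g" using keys_mult[of f g] by blast
  then show "(\<Sum>i\<in>UNIV. lookup k i) = d + e"
    using assms by (simp add: homogeneous_of_degree_def lookup_add sum.distrib)
qed

definition linear_form :: "qbar ^ 'n \<Rightarrow> ('n::finite) mpol" where
  "linear_form c = (\<Sum>i\<in>UNIV. Poly_Mapping.single (Poly_Mapping.single i 1) (c $ i))"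

lemma peval_linear_form [simp]: "peval (linear_form c) x = (\<Sum>i\<in>UNIV. c $ i * x $ i)"
  by (simp add: linear_form_def peval_sum del: monomial_value_single One_nat_def)
    (simp add: monomial_value_single[unfolded One_nat_def])

lemma homogeneous_linear_form [simp]: "homogeneous_of_degree 1 (linear_form c)"
  unfolding homogeneous_of_degree_def
proof
  fix m assume "m \<in> keys (linear_form c)"
  then obtain i where "m \<in> keys (Poly_Mapping.single (Poly_Mapping.single i (1::nat)) (c $ i))"
    unfolding linear_form_def using subsetD[OF keys_sum] by (metis (no_types, lifting) UN_E)
  then have "m = Poly_Mapping.single i 1" by (cases "c $ i = 0") auto
  then show "(\<Sum>i\<in>UNIV. lookup m i) = 1" by (simp add: lookup_single when_def)
qed

lemma monomial_split:
  fixes m :: "'n::finite \<Rightarrow>\<^sub>0 nat"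
  assumes "(\<Sum>i\<in>UNIV. lookup m i) = Suc d"
  obtains i m' where "m = Poly_Mapping.single i 1 + m'" "(\<Sum>i\<in>UNIV. lookup m' i) = d"
proof -
  have "\<exists>i. lookup m i \<noteq> 0" using assms by (metis (no_types, lifting) nat.distinct(1) sum.neutral)
  then obtain i where i: "lookup m i \<noteq> 0" by blast
  define m' where "m' = m - Poly_Mapping.single i 1"
  have m: "m = Poly_Mapping.single i 1 + m'"
    by (rule poly_mapping_eqI) (use i in \<open>auto simp: m'_def lookup_add lookup_minus lookup_single when_def\<close>)
  have "(\<Sum>j\<in>UNIV. lookup m j) = (\<Sum>j\<in>UNIV. lookup (Poly_Mapping.single i (1::nat)) j) + (\<Sum>j\<in>UNIV. lookup m' j)"
    by (subst m) (simp add: lookup_add sum.distrib)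
  also have "(\<Sum>j\<in>UNIV. lookup (Poly_Mapping.single i (1::nat)) j) = 1" by (simp add: lookup_single when_def)
  finally show thesis using that m assms by simp
qed

lemma monomial_degree_0:
  fixes m :: "'n::finite \<Rightarrow>\<^sub>0 nat"
  assumes "(\<Sum>i\<in>UNIV. lookup m i) = 0" shows "m = 0"
  by (rule poly_mapping_eqI) (use assms in simp)

lemma degree_1_linear_form:
  assumes "homogeneous_of_degree 1 f"
  obtains c where "f = linear_form c"
proof -
  have k: "\<exists>i. m = Poly_Mapping.single i 1" if "m \<in> keys f" for m
  proof -
    have "(\<Sum>i\<in>UNIV. lookup m i) = Suc 0" using assms that by (simp add: homogeneous_of_degree_def)
    then obtain i m' where m: "m = Poly_Mapping.single i 1 + m'" "(\<Sum>i\<in>UNIV. lookup m' i) = 0" by (rule monomial_split)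
    show ?thesis using m(1) monomial_degree_0[OF m(2)] by auto
  qed
  define c where "c = (\<chi> i. lookup f (Poly_Mapping.single i 1))"
  have inj: "inj (\<lambda>i. Poly_Mapping.single i (1::nat))"
    by (rule injI) (metis keys_single singleton_inject zero_neq_one)
  have "f = (\<Sum>m\<in>keys f. Poly_Mapping.single m (lookup f m))" by (rule poly_mapping_eq_sum_single)
  also have "\<dots> = (\<Sum>m\<in>range (\<lambda>i. Poly_Mapping.single i 1). Poly_Mapping.single m (lookup f m))"
    by (rule sum.mono_neutral_left) (use k in \<open>auto simp: in_keys_iff\<close>)
  also have "\<dots> = linear_form c"
    unfolding linear_form_def c_def by (subst sum.reindex[OF inj]) simp
  finally show thesis using that by blast
qed


subsection \<open>Symmetric bilinear forms\<close>

locale symmetric_bilinear =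
  fixes B :: "'a::field ^ 'n \<Rightarrow> 'a ^ 'n \<Rightarrow> 'a"
  assumes add_left: "B (x + y) z = B x z + B y z"
    and scale_left: "B (c *s x) z = c * B x z"
    and sym: "B x y = B y x"
begin

lemma add_right: "B z (x + y) = B z x + B z y"
  using add_left sym by metis

lemma scale_right: "B z (c *s x) = c * B z x"
  using scale_left sym by metis

lemmas bilinear_simps = add_left add_right scale_left scale_right

lemma zero_left [simp]: "B 0 z = 0" and zero_right [simp]: "B z 0 = 0"
  using scale_left[of 0 0 z] scale_right[of z 0 0] by auto

end

lemma symmetric_bilinear_combination:
  assumes "symmetric_bilinear A" "symmetric_bilinear B"
  shows "symmetric_bilinear (\<lambda>x y. c * A x y + d * B x y)"
proof -
  interpret A: symmetric_bilinear A by fact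
  interpret B: symmetric_bilinear B by fact
  show ?thesis
  proof
    show "c * A x y + d * B x y = c * A y x + d * B y x" for x y using A.sym B.sym by metis
  qed (simp_all add: A.add_left B.add_left A.scale_left B.scale_left algebra_simps)
qed

text \<open>Each monomial x_i x_j is polarised to (x_i y_j + y_i x_j) / 2.\<close>

lemma quadratic_form_bilinear:
  fixes q :: "('n::finite) mpol"
  assumes "homogeneous_of_degree 2 q"
  obtains B where "symmetric_bilinear B" "\<And>x. peval q x = B x x"
proof -
  have "\<exists>i j. m = Poly_Mapping.single i 1 + Poly_Mapping.single j 1" if "m \<in> keys q" for m
  proof -
    have "(\<Sum>i\<in>UNIV. lookup m i) = Suc (Suc 0)" using assms that by (simp add: homogeneous_of_degree_def)
    then obtain i m' where 1: "m = Poly_Mapping.single i 1 + m'" "(\<Sum>i\<in>UNIV. lookup m' i) = Suc 0" by (rule monomial_split)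
    from 1(2) obtain j m'' where 2: "m' = Poly_Mapping.single j 1 + m''" "(\<Sum>i\<in>UNIV. lookup m'' i) = 0" by (rule monomial_split)
    show ?thesis using 1(1) 2(1) monomial_degree_0[OF 2(2)] by auto
  qed
  then obtain i j where ij: "\<And>m. m \<in> keys q \<Longrightarrow> m = Poly_Mapping.single (i m) 1 + Poly_Mapping.single (j m) 1" by metis
  have mv: "monomial_value m x = x $ i m * x $ j m" if "m \<in> keys q" for m x
    by (subst ij[OF that]) (simp only: monomial_value_add monomial_value_single)
  define B where "B x y = (\<Sum>m\<in>keys q. lookup q m * ((x $ i m * y $ j m + y $ i m * x $ j m) / 2))" for x y :: "qbar ^ 'n"
  show thesis
  proof (rule that[of B])
    show "symmetric_bilinear B"
      by standard (simp_all add: B_def sum.distrib[symmetric] sum_distrib_left algebra_simps add_divide_distrib)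
    show "peval q x = B x x" for x
      by (simp add: peval_eq B_def mv)
  qed
qed


subsection \<open>Gradients\<close>

text \<open>The formal derivative is the coefficient of t in f (x + t e_k). As this coefficient is
  unique (\<open>first_order_unique\<close>), gradients are found by expanding values rather than by
  manipulating coefficients.\<close>

lemma peval_partial_deriv:
  "\<exists>p. \<forall>t. peval f (x + t *s axis k 1) = peval f x + t * peval (partial_deriv k f) x + t\<^sup>2 * poly p t"
proof -
  have pow: "\<exists>p. \<forall>t. (a + t) ^ n = a ^ n + t * (of_nat n * a ^ (n - 1)) + t\<^sup>2 * poly p t" for a :: qbar and n
  proof (induction n)
    case 0
    show ?case by (rule exI[of _ 0]) simp
  next
    case (Suc n)
    then obtain p where p: "\<And>t. (a + t) ^ n = a ^ n + t * (of_nat n * a ^ (n - 1)) + t\<^sup>2 * poly p t" by blast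
    have "(a + t) ^ Suc n = a ^ Suc n + t * (of_nat (Suc n) * a ^ (Suc n - 1))
        + t\<^sup>2 * poly ([:a, 1:] * p + [:of_nat n * a ^ (n - 1):]) t" for t
    proof -
      have "(a + t) ^ Suc n = (a + t) * (a ^ n + t * (of_nat n * a ^ (n - 1)) + t\<^sup>2 * poly p t)" by (simp add: p)
      moreover have "of_nat n * a ^ (n - 1) * a = of_nat n * a ^ n" by (cases n) auto
      ultimately show ?thesis by (simp add: algebra_simps power2_eq_square)
    qed
    then show ?case by blast
  qed
  have "\<exists>p. \<forall>t. monomial_value m (x + t *s axis k 1) = monomial_value m x
      + t * (of_nat (lookup m k) * monomial_value (m - Poly_Mapping.single k 1) x) + t\<^sup>2 * poly p t" for m
  proof -
    define R where "R = (\<Prod>i\<in>UNIV - {k}. (x $ i) ^ lookup m i)"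
    obtain p where p: "\<And>t. (x $ k + t) ^ lookup m k = (x $ k) ^ lookup m k + t * (of_nat (lookup m k) * (x $ k) ^ (lookup m k - 1)) + t\<^sup>2 * poly p t"
      using pow by blast
    have split: "monomial_value n y = (y $ k) ^ lookup n k * (\<Prod>i\<in>UNIV - {k}. (y $ i) ^ lookup n i)" for n y
      unfolding monomial_value_def by (rule prod.remove) auto
    have 1: "monomial_value m (x + t *s axis k 1) = (x $ k + t) ^ lookup m k * R" for t
      unfolding split R_def by (auto simp: axis_def intro!: prod.cong)
    have 2: "monomial_value m x = (x $ k) ^ lookup m k * R" unfolding split R_def ..
    have 3: "monomial_value (m - Poly_Mapping.single k 1) x = (x $ k) ^ (lookup m k - 1) * R"
      unfolding split R_def by (auto simp: lookup_minus lookup_single when_def intro!: prod.cong)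
    show ?thesis by (rule exI[of _ "smult R p"]) (unfold 1 2 3 p, simp add: algebra_simps)
  qed
  then obtain P where P: "\<And>m t. monomial_value m (x + t *s axis k 1) = monomial_value m x
      + t * (of_nat (lookup m k) * monomial_value (m - Poly_Mapping.single k 1) x) + t\<^sup>2 * poly (P m) t"
    by metis
  have "peval f (x + t *s axis k 1) = peval f x + t * peval (partial_deriv k f) x
     + t\<^sup>2 * poly (\<Sum>m\<in>keys f. smult (lookup f m) (P m)) t" for t
    unfolding peval_eq[of f] P partial_deriv_def peval_sum peval_single
    by (simp add: sum.distrib[symmetric] sum_distrib_left poly_sum algebra_simps del: One_nat_def)
  then show ?thesis by blast
qed

lemma first_order_unique:
  fixes a b :: "'a::{idom, ring_char_0}"
  assumes "\<And>t. a + t * b + t\<^sup>2 * poly p t = a' + t * b' + t\<^sup>2 * poly p' t"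
  shows "b = b'"
proof -
  have "poly (pCons a (pCons b p)) t = poly (pCons a' (pCons b' p')) t" for t
    using assms[of t] by (simp add: algebra_simps power2_eq_square)
  then have "pCons a (pCons b p) = pCons a' (pCons b' p')" by (simp add: poly_eq_poly_eq_iff[symmetric] fun_eq_iff)
  then show ?thesis by simp
qed

lemma gradient_quadratic:
  assumes "symmetric_bilinear B" "\<And>x. peval q x = B x x"
  shows "gradient q x $ k = 2 * B x (axis k 1)"
proof -
  interpret symmetric_bilinear B by fact
  obtain p where p: "\<And>t. peval q (x + t *s axis k 1) = peval q x + t * peval (partial_deriv k q) x + t\<^sup>2 * poly p t"
    using peval_partial_deriv by blast
  have e: "peval q (x + t *s axis k 1)
    = peval q x + t * (2 * B x (axis k 1)) + t\<^sup>2 * poly [:B (axis k 1) (axis k 1):] t" for t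
    unfolding assms(2) by (simp add: bilinear_simps sym[of "axis k 1" x] algebra_simps power2_eq_square)
  from first_order_unique[OF trans[OF p[symmetric] e]] show ?thesis by (simp add: gradient_def)
qed

text \<open>The product rule at a common zero: the terms in which \<open>a\<close> or
  \<open>b\<close> is differentiated vanish. The gradients of the whole ideal at such a point are
  therefore spanned by two vectors.\<close>

lemma gradient_ideal:
  assumes "peval q1 x = 0" "peval q2 x = 0"
  shows "gradient (a * q1 + b * q2) x = peval a x *s gradient q1 x + peval b x *s gradient q2 x"
proof -
  have "peval (partial_deriv k (a * q1 + b * q2)) x = peval a x * peval (partial_deriv k q1) x + peval b x * peval (partial_deriv k q2) x" for k
  proof -
    obtain p where p: "\<And>t. peval (a * q1 + b * q2) (x + t *s axis k 1) = peval (a * q1 + b * q2) x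
        + t * peval (partial_deriv k (a * q1 + b * q2)) x + t\<^sup>2 * poly p t"
      using peval_partial_deriv by blast
    obtain pa where pa: "\<And>t. peval a (x + t *s axis k 1) = peval a x + t * peval (partial_deriv k a) x + t\<^sup>2 * poly pa t"
      using peval_partial_deriv by blast
    obtain pb where pb: "\<And>t. peval b (x + t *s axis k 1) = peval b x + t * peval (partial_deriv k b) x + t\<^sup>2 * poly pb t"
      using peval_partial_deriv by blast
    obtain p1 where p1: "\<And>t. peval q1 (x + t *s axis k 1) = peval q1 x + t * peval (partial_deriv k q1) x + t\<^sup>2 * poly p1 t"
      using peval_partial_deriv by blast
    obtain p2 where p2: "\<And>t. peval q2 (x + t *s axis k 1) = peval q2 x + t * peval (partial_deriv k q2) x + t\<^sup>2 * poly p2 t"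
      using peval_partial_deriv by blast
    define r where "r = [:peval a x:] * p1 + [:peval (partial_deriv k a) x:] * [:peval (partial_deriv k q1) x:]
       + [:0, 1:] * ([:peval (partial_deriv k a) x:] * p1 + pa * [:peval (partial_deriv k q1) x:]) + [:0, 0, 1:] * pa * p1
       + [:peval b x:] * p2 + [:peval (partial_deriv k b) x:] * [:peval (partial_deriv k q2) x:]
       + [:0, 1:] * ([:peval (partial_deriv k b) x:] * p2 + pb * [:peval (partial_deriv k q2) x:]) + [:0, 0, 1:] * pb * p2"
    have e: "peval (a * q1 + b * q2) (x + t *s axis k 1)
      = 0 + t * (peval a x * peval (partial_deriv k q1) x + peval b x * peval (partial_deriv k q2) x) + t\<^sup>2 * poly r t" for t
      unfolding peval_add peval_mult pa pb p1 p2 assms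
      by (simp add: r_def algebra_simps power2_eq_square)
    from first_order_unique[OF trans[OF p[symmetric] e]] show ?thesis .
  qed
  then show ?thesis by (simp add: gradient_def vec_eq_iff)
qed


subsection \<open>Homogeneous coordinates\<close>

lemma coords_obtain:
  obtains x where "x \<noteq> 0" "coords p = {c *s x | c. c \<noteq> 0}" "subspace_of p = vec.span {x}"
proof -
  obtain x where x: "x \<noteq> 0" "subspace_of p = vec.span {x}" using subspace_of[of p] by auto
  have "coords p = {c *s x | c. c \<noteq> 0}"
    unfolding coords_def x(2) vec.span_singleton using x(1) by auto
  then show thesis using that x by blast
qed

lemma coords_scaled:
  assumes "x \<in> coords p" "y \<in> coords p"
  obtains c where "c \<noteq> 0" "y = c *s x"
proof -
  obtain z where z: "z \<noteq> 0" "coords p = {c *s z | c. c \<noteq> 0}" by (rule coords_obtain)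
  then obtain a b where ab: "a \<noteq> 0" "x = a *s z" "b \<noteq> 0" "y = b *s z" using assms by auto
  then have "y = (b / a) *s x" by simp
  then show thesis using that[of "b / a"] ab by auto
qed

lemma ex_coords: obtains x where "x \<in> coords p"
proof -
  obtain x where x: "coords p = {c *s x | c. c \<noteq> 0}" by (rule coords_obtain)
  have "1 *s x \<in> coords p" unfolding x by (intro CollectI exI[of _ 1]) simp
  then show thesis by (rule that)
qed

lemma point_of_vector:
  fixes x :: "qbar ^ 'n::finite"
  assumes "x \<noteq> 0"
  obtains p where "x \<in> coords p" "subspace_of p = vec.span {x}"
proof -
  have "subspace_of (Abs_proj (vec.span {x})) = vec.span {x}"
    using assms by (intro Abs_proj_inverse) auto
  then show thesis using that[of "Abs_proj (vec.span {x})"] assms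
    by (auto simp: coords_def vec.span_base)
qed

lemma peval_coords:
  assumes "homogeneous_of_degree d f" "x \<in> coords p" "y \<in> coords p" "peval f x = 0"
  shows "peval f y = 0"
proof -
  obtain c where "y = c *s x" using coords_scaled[OF assms(2,3)] .
  then show ?thesis using peval_homogeneous[OF assms(1)] assms(4) by simp
qed

text \<open>The homogeneous ideal of an irreducible set is prime: otherwise the zeros of
  \<open>f\<close> and of \<open>g\<close> would cover \<open>X\<close> by two proper closed
  subsets.\<close>

lemma irreducible_closed_vanishing:
  assumes X: "irreducible_closed X" and f: "homogeneous_of_degree d f" and g: "homogeneous_of_degree e g"
    and fg: "\<And>p x. p \<in> X \<Longrightarrow> x \<in> coords p \<Longrightarrow> peval f x = 0 \<or> peval g x = 0"
  shows "(\<forall>p\<in>X. \<forall>x\<in>coords p. peval f x = 0) \<or> (\<forall>p\<in>X. \<forall>x\<in>coords p. peval g x = 0)"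
proof -
  obtain F where F: "\<forall>f\<in>F. \<exists>d. homogeneous_of_degree d f" "X = zero_locus F"
    using X by (auto simp: irreducible_closed_def zariski_closed_def)
  have closed: "zariski_closed (X \<inter> zero_locus {h})" if "homogeneous_of_degree k h" for h k
    unfolding zariski_closed_def using F that
    by (intro exI[of _ "insert h F"]) (auto simp: zero_locus_def)
  have "X = (X \<inter> zero_locus {f}) \<union> (X \<inter> zero_locus {g})"
  proof -
    have "p \<in> zero_locus {f} \<or> p \<in> zero_locus {g}" if p: "p \<in> X" for p
    proof -
      obtain x where x: "x \<in> coords p" by (rule ex_coords)
      show ?thesis using fg[OF p x] peval_coords[OF f x] peval_coords[OF g x] by (auto simp: zero_locus_def)
    qed
    then show ?thesis by blast
  qed
  then have "X = X \<inter> zero_locus {f} \<or> X = X \<inter> zero_locus {g}"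
    using X closed[OF f] closed[OF g] unfolding irreducible_closed_def by blast
  then show ?thesis by (auto simp: zero_locus_def)
qed

section \<open>Pencils of quadrics containing a line\<close>

definition functional :: "('a::field ^ 'n \<Rightarrow> 'a) \<Rightarrow> bool" where
  "functional f \<longleftrightarrow> (\<forall>x y. f (x + y) = f x + f y) \<and> (\<forall>c x. f (c *s x) = c * f x)"

lemma functional_add: "functional f \<Longrightarrow> f (x + y) = f x + f y"
  and functional_scale: "functional f \<Longrightarrow> f (c *s x) = c * f x"
  by (auto simp: functional_def)

lemma functional_diff: "functional f \<Longrightarrow> f (x - y) = f x - f y"
  using functional_add[of f "x - y" y] by simp

lemmas functional_simps = functional_add functional_scale functional_diff

lemma functional_zero: "functional f \<Longrightarrow> f 0 = 0"
  using functional_scale[of f 0 0] by simp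

lemma functional_combination:
  "functional f \<Longrightarrow> functional g \<Longrightarrow> functional (\<lambda>x. a * f x + b * g x)"
  by (simp add: functional_def algebra_simps)

lemma (in symmetric_bilinear) functional_left: "functional (B x)"
  by (simp add: functional_def bilinear_simps)

lemma rank_one:
  fixes r11 r12 r21 r22 :: "'a::field"
  assumes "r11 * r22 = r12 * r21"
  obtains p1 p2 s1 s2 where "r11 = p1 * s1" "r12 = p1 * s2" "r21 = p2 * s1" "r22 = p2 * s2"
proof (cases "r11 = 0 \<and> r12 = 0")
  case True
  then show thesis using that[of 0 r21 r22 1] by simp
next
  case False
  show thesis
  proof (cases "r11 = 0")
    case True
    then show thesis using that[of 1 0 r12 "r22 / r12"] assms False by simp
  next
    case n: False
    then show thesis using that[of 1 r11 r12 "r21 / r11"] assms by (simp add: field_simps)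
  qed
qed

lemma binary_form_isotropic:
  fixes p q r :: "'a::alg_closed_field"
  obtains \<alpha> \<beta> where "\<alpha> \<noteq> 0 \<or> \<beta> \<noteq> 0" "p * \<alpha>\<^sup>2 + q * \<alpha> * \<beta> + r * \<beta>\<^sup>2 = 0"
proof (cases "p = 0")
  case True
  then show thesis using that[of 1 0] by simp
next
  case False
  then have "degree [:r, q, p:] > 0" by simp
  then obtain z where "poly [:r, q, p:] z = 0" using alg_closed_imp_poly_has_root by blast
  then show thesis using that[of z 1] by (simp add: algebra_simps power2_eq_square)
qed

text \<open>A vector space is not the union of two proper subspaces. With \<open>k\<close> equal to
  \<open>h\<close> this covers a single linear condition as well.\<close>

lemma functional_product_zero:
  assumes h: "functional h" and a: "functional a" and b: "functional b"
    and z: "\<And>x. h x = 0 \<Longrightarrow> k x = 0 \<Longrightarrow> a x * b x = 0" and k: "functional k"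
  shows "(\<forall>x. h x = 0 \<longrightarrow> k x = 0 \<longrightarrow> a x = 0) \<or> (\<forall>x. h x = 0 \<longrightarrow> k x = 0 \<longrightarrow> b x = 0)"
proof (rule ccontr)
  assume "\<not> ?thesis"
  then obtain x y where x: "h x = 0" "k x = 0" "a x \<noteq> 0" and y: "h y = 0" "k y = 0" "b y \<noteq> 0" by auto
  have "b x = 0" "a y = 0" using z[OF x(1,2)] z[OF y(1,2)] x y by auto
  moreover have "a (x + y) * b (x + y) = 0"
    by (rule z) (use x y h k in \<open>simp_all add: functional_simps\<close>)
  ultimately show False using x y a b by (simp add: functional_simps)
qed

lemma functional_proportional:
  assumes h: "functional h" and a: "functional a" and f: "functional f"
    and v: "h v = 0" "a v \<noteq> 0" and z: "\<And>x. h x = 0 \<Longrightarrow> a x = 0 \<Longrightarrow> f x = 0" and x: "h x = 0"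
  shows "f x = f v / a v * a x"
proof -
  have "f (x + (- a x / a v) *s v) = 0"
    using v x by (intro z) (simp_all add: functional_simps[OF h] functional_simps[OF a])
  then show ?thesis using v by (simp add: functional_simps[OF f])
qed

text \<open>The assumption \<open>smooth\<close> is the Jacobian criterion: no nontrivial member of
  the pencil is singular at a common zero. Line and pencil are both given by bases, so that
  invertible 2 by 2 matrices can act on either.\<close>

locale line_pair =
  B1: symmetric_bilinear B1 + B2: symmetric_bilinear B2
  for B1 B2 :: "'a::{alg_closed_field, field_char_0} ^ 'n \<Rightarrow> 'a ^ 'n \<Rightarrow> 'a" +
  fixes e0 e1 :: "'a ^ 'n"
  assumes line: "B1 e0 e0 = 0" "B1 e0 e1 = 0" "B1 e1 e1 = 0" "B2 e0 e0 = 0" "B2 e0 e1 = 0" "B2 e1 e1 = 0"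
    and indep: "s *s e0 + t *s e1 = 0 \<Longrightarrow> s = 0 \<and> t = 0"
    and smooth: "x \<noteq> 0 \<Longrightarrow> B1 x x = 0 \<Longrightarrow> B2 x x = 0 \<Longrightarrow> (\<And>y. p1 * B1 x y + p2 * B2 x y = 0) \<Longrightarrow> p1 = 0 \<and> p2 = 0"
begin

lemma line': "B1 e1 e0 = 0" "B2 e1 e0 = 0"
  using line B1.sym B2.sym by metis+

lemmas bilinear_simps = B1.bilinear_simps B2.bilinear_simps line line'

definition dlt :: "'a ^ 'n \<Rightarrow> 'a" where
  "dlt x = B1 e0 x * B2 e1 x - B1 e1 x * B2 e0 x"

definition polar :: "'a ^ 'n \<Rightarrow> 'a ^ 'n \<Rightarrow> 'a" where
  "polar x y = B1 e0 x * B2 e1 y + B1 e0 y * B2 e1 x - B1 e1 x * B2 e0 y - B1 e1 y * B2 e0 x"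

sublocale polar: symmetric_bilinear polar
  by standard (simp_all add: polar_def bilinear_simps algebra_simps)

lemma dlt_add: "dlt (x + y) = dlt x + dlt y + polar x y"
  and dlt_scale: "dlt (c *s x) = c\<^sup>2 * dlt x"
  by (simp_all add: dlt_def polar_def bilinear_simps algebra_simps power2_eq_square)

lemma dlt_line [simp]: "dlt e0 = 0" "dlt e1 = 0"
  and polar_line [simp]: "polar e0 x = 0" "polar x e0 = 0" "polar e1 x = 0" "polar x e1 = 0"
  by (simp_all add: dlt_def polar_def bilinear_simps)

lemmas dlt_simps = dlt_add dlt_scale polar.bilinear_simps

text \<open>A coefficient matrix of rank one is a product of vectors p and s. The relation then says
  that the member p1 B1 + p2 B2 is singular at the point s1 e0 + s2 e1 of the line.\<close>

lemma no_rank_one_relation: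
  assumes det: "r11 * r22 = r12 * r21"
    and rel: "\<And>y. r11 * B1 e0 y + r12 * B1 e1 y + r21 * B2 e0 y + r22 * B2 e1 y = 0"
  shows "r11 = 0 \<and> r12 = 0 \<and> r21 = 0 \<and> r22 = 0"
proof -
  obtain p1 p2 s1 s2 where r: "r11 = p1 * s1" "r12 = p1 * s2" "r21 = p2 * s1" "r22 = p2 * s2"
    using rank_one[OF det] .
  show ?thesis
  proof (cases "s1 = 0 \<and> s2 = 0")
    case False
    define x where "x = s1 *s e0 + s2 *s e1"
    have "x \<noteq> 0" using indep[of s1 s2] False by (auto simp: x_def)
    moreover have "B1 x x = 0" "B2 x x = 0" by (simp_all add: x_def bilinear_simps)
    moreover have "p1 * B1 x y + p2 * B2 x y = 0" for y
      using rel[of y] by (simp add: x_def bilinear_simps r algebra_simps)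
    ultimately have "p1 = 0 \<and> p2 = 0" by (rule smooth)
    then show ?thesis using r by simp
  qed (use r in simp)
qed

text \<open>
  If \<open>\<Delta>\<close> vanished on a hyperplane, unique factorisation would make two rows or two columns of the matrix of linear
  forms proportional there, and hence produce a rank one relation on the whole space.
\<close>

lemma dlt_nonzero_on_hyperplane:
  assumes h: "functional h" and v: "h v \<noteq> 0"
  obtains x where "h x = 0" "dlt x \<noteq> 0"
proof -
  have False if z: "\<And>x. h x = 0 \<Longrightarrow> dlt x = 0"
  proof -
    note fn = B1.functional_left[of e0] B1.functional_left[of e1] B2.functional_left[of e0] B2.functional_left[of e1]
    have zero: "functional (\<lambda>x. 0)" by (simp add: functional_def)
    have zz: "B1 e0 x * B2 e1 x = B1 e1 x * B2 e0 x" if "h x = 0" for x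
      using z[OF that] by (simp add: dlt_def)
    \<comment> \<open>Both combinations are multiples of \<open>h\<close>, so some p1 f1 + p2 f2
      vanishes on the whole space; its coefficient matrix is the product of p and s, of rank
      one.\<close>
    have rows: False if st: "s \<noteq> 0 \<or> t \<noteq> 0" and s1: "\<And>x. h x = 0 \<Longrightarrow> s * B1 e0 x + t * B1 e1 x = 0"
      and s2: "\<And>x. h x = 0 \<Longrightarrow> s * B2 e0 x + t * B2 e1 x = 0" for s t
    proof -
      define f1 f2 where "f1 x = s * B1 e0 x + t * B1 e1 x" and "f2 x = s * B2 e0 x + t * B2 e1 x" for x
      have f: "functional f1" "functional f2"
        unfolding f1_def f2_def using fn by (auto intro: functional_combination)
      define k1 k2 where "k1 = f1 v" and "k2 = f2 v"
      \<comment> \<open>If both multiples are zero, (1, 0) is taken in place of the zero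
        vector.\<close>
      define p1 p2 where "p1 = (if k1 = 0 \<and> k2 = 0 then 1 else k2)" and "p2 = - k1"
      have "f1 x = k1 / h v * h x" "f2 x = k2 / h v * h x" for x unfolding k1_def k2_def
        by (rule functional_proportional[OF zero h f(1) refl v _ refl], simp add: f1_def s1)
          (rule functional_proportional[OF zero h f(2) refl v _ refl], simp add: f2_def s2)
      then have "p1 * f1 x + p2 * f2 x = 0" for x
        by (simp add: p1_def p2_def)
      then have "p1 * s * B1 e0 y + p1 * t * B1 e1 y + p2 * s * B2 e0 y + p2 * t * B2 e1 y = 0" for y
        by (simp add: f1_def f2_def algebra_simps)
      from no_rank_one_relation[OF _ this] have "p1 * s = 0 \<and> p1 * t = 0 \<and> p2 * s = 0 \<and> p2 * t = 0" by simp
      then have "p1 = 0 \<and> p2 = 0" using st by auto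
      then show False by (auto simp: p1_def p2_def split: if_splits)
    qed
    have cols: False if pq: "p \<noteq> 0 \<or> q \<noteq> 0" and s1: "\<And>x. h x = 0 \<Longrightarrow> p * B1 e0 x + q * B2 e0 x = 0"
      and s2: "\<And>x. h x = 0 \<Longrightarrow> p * B1 e1 x + q * B2 e1 x = 0" for p q
    proof -
      define f1 f2 where "f1 x = p * B1 e0 x + q * B2 e0 x" and "f2 x = p * B1 e1 x + q * B2 e1 x" for x
      have f: "functional f1" "functional f2"
        unfolding f1_def f2_def using fn by (auto intro: functional_combination)
      define k1 k2 where "k1 = f1 v" and "k2 = f2 v"
      define s t where "s = (if k1 = 0 \<and> k2 = 0 then 1 else k2)" and "t = - k1"
      have "f1 x = k1 / h v * h x" "f2 x = k2 / h v * h x" for x unfolding k1_def k2_def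
        by (rule functional_proportional[OF zero h f(1) refl v _ refl], simp add: f1_def s1)
          (rule functional_proportional[OF zero h f(2) refl v _ refl], simp add: f2_def s2)
      then have "s * f1 x + t * f2 x = 0" for x
        by (simp add: s_def t_def)
      then have "p * s * B1 e0 y + p * t * B1 e1 y + q * s * B2 e0 y + q * t * B2 e1 y = 0" for y
        by (simp add: f1_def f2_def algebra_simps)
      from no_rank_one_relation[OF _ this] have "p * s = 0 \<and> p * t = 0 \<and> q * s = 0 \<and> q * t = 0" by simp
      then have "s = 0 \<and> t = 0" using pq by auto
      then show False by (auto simp: s_def t_def split: if_splits)
    qed
    have prod0: "(\<forall>x. h x = 0 \<longrightarrow> a x = 0) \<or> (\<forall>x. h x = 0 \<longrightarrow> b x = 0)"
      if "functional a" "functional b" "\<And>x. h x = 0 \<Longrightarrow> a x * b x = 0" for a b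
      using functional_product_zero[OF h that(1,2), of h] that h by auto
    show False
    proof (cases "\<forall>x. h x = 0 \<longrightarrow> B1 e0 x = 0")
      case True
      then have "h x = 0 \<Longrightarrow> B1 e1 x * B2 e0 x = 0" for x using zz[of x] by simp
      then have "(\<forall>x. h x = 0 \<longrightarrow> B1 e1 x = 0) \<or> (\<forall>x. h x = 0 \<longrightarrow> B2 e0 x = 0)"
        by (intro prod0 fn)
      then show False
      proof
        assume "\<forall>x. h x = 0 \<longrightarrow> B1 e1 x = 0"
        then show False using cols[of 1 0] True by simp
      next
        assume "\<forall>x. h x = 0 \<longrightarrow> B2 e0 x = 0"
        then show False using rows[of 1 0] True by simp
      qed
    next
      case False
      then obtain w where w: "h w = 0" "B1 e0 w \<noteq> 0" by auto
      \<comment> \<open>On the hyperplane \<open>B1 e0\<close> is a nonzero linear form, hence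
        prime, so it divides one factor of \<open>B1 e1 * B2 e0\<close>.\<close>
      have "(\<forall>x. h x = 0 \<longrightarrow> B1 e0 x = 0 \<longrightarrow> B1 e1 x = 0) \<or> (\<forall>x. h x = 0 \<longrightarrow> B1 e0 x = 0 \<longrightarrow> B2 e0 x = 0)"
        by (rule functional_product_zero[OF h fn(2,3) _ fn(1)]) (metis zz mult_zero_left)
      then show False
      proof
        assume *: "\<forall>x. h x = 0 \<longrightarrow> B1 e0 x = 0 \<longrightarrow> B1 e1 x = 0"
        define l where "l = B1 e1 w / B1 e0 w"
        have l: "B1 e1 x = l * B1 e0 x" if "h x = 0" for x
          unfolding l_def by (rule functional_proportional[OF h fn(1,2) w _ that]) (use * in auto)
        define g where "g x = 1 * B2 e1 x + (- l) * B2 e0 x" for x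
        have g: "functional g" unfolding g_def using fn by (intro functional_combination)
        have "h x = 0 \<Longrightarrow> B1 e0 x * g x = 0" for x using zz[of x] l[of x] by (simp add: g_def algebra_simps)
        then have "\<forall>x. h x = 0 \<longrightarrow> g x = 0" using prod0[OF fn(1) g] w by blast
        then show False using rows[of "- l" 1] l by (simp add: g_def algebra_simps)
      next
        assume *: "\<forall>x. h x = 0 \<longrightarrow> B1 e0 x = 0 \<longrightarrow> B2 e0 x = 0"
        define l where "l = B2 e0 w / B1 e0 w"
        have l: "B2 e0 x = l * B1 e0 x" if "h x = 0" for x
          unfolding l_def by (rule functional_proportional[OF h fn(1,3) w _ that]) (use * in auto)
        define g where "g x = 1 * B2 e1 x + (- l) * B1 e1 x" for x
        have g: "functional g" unfolding g_def using fn by (intro functional_combination)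
        have "h x = 0 \<Longrightarrow> B1 e0 x * g x = 0" for x using zz[of x] l[of x] by (simp add: g_def algebra_simps)
        then have "\<forall>x. h x = 0 \<longrightarrow> g x = 0" using prod0[OF fn(1) g] w by blast
        then show False using cols[of "- l" 1] l by (simp add: g_def algebra_simps)
      qed
    qed
  qed
  then show thesis using that by blast
qed

end

lemma line_pair_combination:
  assumes "line_pair B1 B2 e0 e1" and det: "a * d - b * c \<noteq> 0"
  shows "line_pair (\<lambda>x y. a * B1 x y + b * B2 x y) (\<lambda>x y. c * B1 x y + d * B2 x y) e0 e1"
    and "a * B1 x x + b * B2 x x = 0 \<and> c * B1 x x + d * B2 x x = 0 \<longleftrightarrow> B1 x x = 0 \<and> B2 x x = 0"
proof -
  interpret line_pair B1 B2 e0 e1 by fact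
  have det0: "u = 0 \<and> w = 0" if "a * u + b * w = 0" "c * u + d * w = 0" for u w
  proof -
    have "(a * d - b * c) * u = d * (a * u + b * w) - b * (c * u + d * w)"
      "(a * d - b * c) * w = a * (c * u + d * w) - c * (a * u + b * w)" by (simp_all add: algebra_simps)
    then show ?thesis using that det by simp
  qed
  show iff: "a * B1 x x + b * B2 x x = 0 \<and> c * B1 x x + d * B2 x x = 0 \<longleftrightarrow> B1 x x = 0 \<and> B2 x x = 0" for x
    using det0[of "B1 x x" "B2 x x"] by auto
  show "line_pair (\<lambda>x y. a * B1 x y + b * B2 x y) (\<lambda>x y. c * B1 x y + d * B2 x y) e0 e1"
  proof (intro line_pair.intro line_pair_axioms.intro symmetric_bilinear_combination
      B1.symmetric_bilinear_axioms B2.symmetric_bilinear_axioms)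
    fix s t assume "s *s e0 + t *s e1 = 0" then show "s = 0 \<and> t = 0" by (rule indep)
  next
    fix x p1 p2 assume x: "x \<noteq> 0" "a * B1 x x + b * B2 x x = 0" "c * B1 x x + d * B2 x x = 0"
      and p: "\<And>y. p1 * (a * B1 x y + b * B2 x y) + p2 * (c * B1 x y + d * B2 x y) = 0"
    have "(p1 * a + p2 * c) * B1 x y + (p1 * b + p2 * d) * B2 x y = 0" for y
      using p[of y] by (simp add: algebra_simps)
    with x iff[of x] have eq: "p1 * a + p2 * c = 0" "p1 * b + p2 * d = 0"
      using smooth[of x "p1 * a + p2 * c" "p1 * b + p2 * d"] by auto
    have "(a * d - b * c) * p1 = d * (p1 * a + p2 * c) - c * (p1 * b + p2 * d)"
      "(a * d - b * c) * p2 = a * (p1 * b + p2 * d) - b * (p1 * a + p2 * c)" by (simp_all add: algebra_simps)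
    then show "p1 = 0 \<and> p2 = 0" using eq det by simp
  qed (simp_all add: line)
qed

lemma line_pair_change_line:
  assumes "line_pair B1 B2 e0 e1" and det: "a * d - b * c \<noteq> 0"
  shows "line_pair B1 B2 (a *s e0 + b *s e1) (c *s e0 + d *s e1)"
proof -
  interpret line_pair B1 B2 e0 e1 by fact
  show ?thesis
  proof (intro line_pair.intro line_pair_axioms.intro B1.symmetric_bilinear_axioms B2.symmetric_bilinear_axioms)
    fix s t assume "s *s (a *s e0 + b *s e1) + t *s (c *s e0 + d *s e1) = 0"
    then have "(s * a + t * c) *s e0 + (s * b + t * d) *s e1 = 0" by (simp add: vec_eq_iff algebra_simps)
    then have eq: "s * a + t * c = 0" "s * b + t * d = 0" using indep by auto
    have "(a * d - b * c) * s = d * (s * a + t * c) - c * (s * b + t * d)"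
      "(a * d - b * c) * t = a * (s * b + t * d) - b * (s * a + t * c)" by (simp_all add: algebra_simps)
    then show "s = 0 \<and> t = 0" using eq det by simp
  next
    fix x p1 p2 assume "x \<noteq> 0" "B1 x x = 0" "B2 x x = 0" "\<And>y. p1 * B1 x y + p2 * B2 x y = 0"
    then show "p1 = 0 \<and> p2 = 0" by (rule smooth)
  qed (simp_all add: bilinear_simps)
qed


subsection \<open>Adapted frames\<close>

definition combination :: "'a::field ^ 'n \<Rightarrow> 'a ^ 'n \<Rightarrow> 'a ^ 'n \<Rightarrow> 'a ^ 'n \<Rightarrow> 'a ^ 'n \<Rightarrow> 'a ^ 'n \<Rightarrow>
    'a \<Rightarrow> 'a \<Rightarrow> 'a \<Rightarrow> 'a \<Rightarrow> 'a \<Rightarrow> 'a \<Rightarrow> 'a ^ 'n" where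
  "combination e0 e1 e2 e3 e4 e5 x0 x1 y1 y2 y3 y4 =
     x0 *s e0 + x1 *s e1 + y1 *s e2 + y2 *s e3 + y3 *s e4 + y4 *s e5"

text \<open>A basis adapted to the flag: y1 and y2 are the values of \<open>h1\<close> and
  \<open>h2\<close>, and the line is spanned by \<open>e0\<close>, \<open>e1\<close>. Independence
  is stated for the four vectors on which both forms vanish; the coefficients of \<open>e2\<close>
  and \<open>e3\<close> are read off by \<open>h1\<close> and \<open>h2\<close>.\<close>

locale frame =
  fixes h1 h2 :: "'a::field ^ 'n \<Rightarrow> 'a" and e0 e1 e2 e3 e4 e5 :: "'a ^ 'n"
  assumes h: "functional h1" "functional h2"
    and h1: "h1 e0 = 0" "h1 e1 = 0" "h1 e2 = 1" "h1 e3 = 0" "h1 e4 = 0" "h1 e5 = 0"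
    and h2: "h2 e0 = 0" "h2 e1 = 0" "h2 e2 = 0" "h2 e3 = 1" "h2 e4 = 0" "h2 e5 = 0"
    and spanning: "\<exists>x0 x1 y1 y2 y3 y4. x = combination e0 e1 e2 e3 e4 e5 x0 x1 y1 y2 y3 y4"
    and independent: "x0 *s e0 + x1 *s e1 + y3 *s e4 + y4 *s e5 = 0 \<Longrightarrow> x0 = 0 \<and> x1 = 0 \<and> y3 = 0 \<and> y4 = 0"
begin

lemma functional_eq_0:
  assumes f: "functional f" and "f e0 = 0" "f e1 = 0" "f e2 = 0" "f e3 = 0" "f e4 = 0" "f e5 = 0"
  shows "f x = 0"
  using spanning[of x] assms by (auto simp: combination_def functional_simps[OF f])

lemma h_combination:
  "h1 (combination e0 e1 e2 e3 e4 e5 x0 x1 y1 y2 y3 y4) = y1"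
  "h2 (combination e0 e1 e2 e3 e4 e5 x0 x1 y1 y2 y3 y4) = y2"
  by (simp_all add: combination_def functional_simps[OF h(1)] functional_simps[OF h(2)] h1 h2)

lemma change_plane:
  assumes det: "a * d - b * c \<noteq> 0"
  shows "frame h1 h2 e0 e1 e2 e3 (a *s e4 + b *s e5) (c *s e4 + d *s e5)"
proof
  fix x
  obtain x0 x1 y1 y2 y3 y4 where x: "x = combination e0 e1 e2 e3 e4 e5 x0 x1 y1 y2 y3 y4" using spanning by blast
  define D where "D = a * d - b * c"
  define v w where "v = (d * y3 - c * y4) / D" and "w = (a * y4 - b * y3) / D"
  have "v * a + w * c = y3" "v * b + w * d = y4"
    using det unfolding v_def w_def D_def[symmetric] by (simp_all add: field_simps) (simp_all add: D_def algebra_simps)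
  then have "x = combination e0 e1 e2 e3 (a *s e4 + b *s e5) (c *s e4 + d *s e5) x0 x1 y1 y2 v w"
    unfolding x combination_def by (auto simp: vec_eq_iff algebra_simps simp flip: distrib_left)
  then show "\<exists>x0 x1 y1 y2 y3 y4. x = combination e0 e1 e2 e3 (a *s e4 + b *s e5) (c *s e4 + d *s e5) x0 x1 y1 y2 y3 y4" by blast
next
  fix x0 x1 s t
  assume "x0 *s e0 + x1 *s e1 + s *s (a *s e4 + b *s e5) + t *s (c *s e4 + d *s e5) = 0"
  then have "x0 *s e0 + x1 *s e1 + (s * a + t * c) *s e4 + (s * b + t * d) *s e5 = 0"
    by (simp add: vec_eq_iff algebra_simps)
  then have eq: "x0 = 0 \<and> x1 = 0 \<and> s * a + t * c = 0 \<and> s * b + t * d = 0" by (rule independent)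
  have "(a * d - b * c) * s = d * (s * a + t * c) - c * (s * b + t * d)"
      "(a * d - b * c) * t = a * (s * b + t * d) - b * (s * a + t * c)" by (simp_all add: algebra_simps)
  then show "x0 = 0 \<and> x1 = 0 \<and> s = 0 \<and> t = 0" using eq det by simp
qed (use h h1 h2 in \<open>simp_all add: functional_simps\<close>)

lemma change_line:
  assumes det: "a * d - b * c \<noteq> 0"
  shows "frame h1 h2 (a *s e0 + b *s e1) (c *s e0 + d *s e1) e2 e3 e4 e5"
proof
  fix x
  obtain x0 x1 y1 y2 y3 y4 where x: "x = combination e0 e1 e2 e3 e4 e5 x0 x1 y1 y2 y3 y4" using spanning by blast
  define D where "D = a * d - b * c"
  define v w where "v = (d * x0 - c * x1) / D" and "w = (a * x1 - b * x0) / D"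
  have "v * a + w * c = x0" "v * b + w * d = x1"
    using det unfolding v_def w_def D_def[symmetric] by (simp_all add: field_simps) (simp_all add: D_def algebra_simps)
  then have "x = combination (a *s e0 + b *s e1) (c *s e0 + d *s e1) e2 e3 e4 e5 v w y1 y2 y3 y4"
    unfolding x combination_def by (auto simp: vec_eq_iff algebra_simps simp flip: distrib_left)
  then show "\<exists>x0 x1 y1 y2 y3 y4. x = combination (a *s e0 + b *s e1) (c *s e0 + d *s e1) e2 e3 e4 e5 x0 x1 y1 y2 y3 y4" by blast
next
  fix s t y3 y4
  assume "s *s (a *s e0 + b *s e1) + t *s (c *s e0 + d *s e1) + y3 *s e4 + y4 *s e5 = 0"
  then have "(s * a + t * c) *s e0 + (s * b + t * d) *s e1 + y3 *s e4 + y4 *s e5 = 0"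
    by (simp add: vec_eq_iff algebra_simps)
  then have eq: "s * a + t * c = 0 \<and> s * b + t * d = 0 \<and> y3 = 0 \<and> y4 = 0" by (rule independent)
  have "(a * d - b * c) * s = d * (s * a + t * c) - c * (s * b + t * d)"
      "(a * d - b * c) * t = a * (s * b + t * d) - b * (s * a + t * c)" by (simp_all add: algebra_simps)
  then show "s = 0 \<and> t = 0 \<and> y3 = 0 \<and> y4 = 0" using eq det by simp
qed (use h h1 h2 in \<open>simp_all add: functional_simps\<close>)

lemma change_transversal: "frame h1 h2 e0 e1 (e2 + a *s e4) (e3 + b *s e4) e4 e5"
proof
  fix x
  obtain x0 x1 y1 y2 y3 y4 where x: "x = combination e0 e1 e2 e3 e4 e5 x0 x1 y1 y2 y3 y4" using spanning by blast
  have "x = combination e0 e1 (e2 + a *s e4) (e3 + b *s e4) e4 e5 x0 x1 y1 y2 (y3 - a * y1 - b * y2) y4"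
    unfolding x combination_def by (simp add: vec_eq_iff algebra_simps)
  then show "\<exists>x0 x1 y1 y2 y3 y4. x = combination e0 e1 (e2 + a *s e4) (e3 + b *s e4) e4 e5 x0 x1 y1 y2 y3 y4" by blast
qed (use h h1 h2 independent in \<open>simp_all add: functional_simps\<close>)

end

section \<open>Solutions in an adapted frame, according to the shape of the determinant\<close>

locale framed_pair = line_pair B1 B2 e0 e1 + frame h1 h2 e0 e1 e2 e3 e4 e5
  for B1 B2 :: "'a::{alg_closed_field, field_char_0} ^ 'n \<Rightarrow> 'a ^ 'n \<Rightarrow> 'a"
    and h1 h2 e0 e1 e2 e3 e4 e5
begin

definition base_point :: "'a \<Rightarrow> 'a \<Rightarrow> 'a \<Rightarrow> 'a ^ 'n" where
  "base_point u v w = e2 + u *s e3 + v *s e4 + w *s e5"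

definition point :: "'a \<Rightarrow> 'a \<Rightarrow> 'a \<Rightarrow> 'a \<Rightarrow> 'a \<Rightarrow> 'a ^ 'n" where
  "point x0 x1 u v w = x0 *s e0 + x1 *s e1 + base_point u v w"

text \<open>At these points \<open>h1\<close> is 1 and \<open>h2\<close> is \<open>u\<close>, so a
  unit \<open>u\<close> keeps them away from the hyperplane sections modulo every place outside S. A
  nonzero \<open>dlt\<close> allows the point to be recovered from (u, v, w) by Cramer's
  rule.\<close>

definition integral_family :: "'a set \<Rightarrow> bool" where
  "integral_family R \<longleftrightarrow> nested_infinite (\<lambda>u v w. half_ring.is_unit_in R u \<and> v \<in> R \<and> w \<in> R \<and>
     dlt (base_point u v w) \<noteq> 0 \<and>
     (\<exists>x0\<in>R. \<exists>x1\<in>R. B1 (point x0 x1 u v w) (point x0 x1 u v w) = 0 \<and> B2 (point x0 x1 u v w) (point x0 x1 u v w) = 0))"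

text \<open>The finite set of constants comes before the ring: it is found over an algebraically
  closed field, and \<open>R\<close> can later be a ring of S-integers chosen large enough to
  contain it.\<close>

definition has_family :: bool where
  "has_family \<longleftrightarrow> (\<exists>C. finite C \<and> (\<forall>R. half_ring R \<longrightarrow> C \<subseteq> R \<longrightarrow> integral_family R))"

definition form_values :: "'a set" where
  "form_values = (\<lambda>(x, y). B1 x y) ` ({e0, e1, e2, e3, e4, e5} \<times> {e0, e1, e2, e3, e4, e5})
     \<union> (\<lambda>(x, y). B2 x y) ` ({e0, e1, e2, e3, e4, e5} \<times> {e0, e1, e2, e3, e4, e5})"

lemma finite_form_values: "finite form_values"
  by (simp add: form_values_def)

lemma form_values_mem:
  assumes "form_values \<subseteq> R" "x \<in> {e0, e1, e2, e3, e4, e5}" "y \<in> {e0, e1, e2, e3, e4, e5}"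
  shows "B1 x y \<in> R" "B2 x y \<in> R"
proof -
  have "B1 x y \<in> form_values" unfolding form_values_def
    by (rule UnI1, rule image_eqI[of _ _ "(x, y)"], simp, rule SigmaI[OF assms(2,3)])
  moreover have "B2 x y \<in> form_values" unfolding form_values_def
    by (rule UnI2, rule image_eqI[of _ _ "(x, y)"], simp, rule SigmaI[OF assms(2,3)])
  ultimately show "B1 x y \<in> R" "B2 x y \<in> R" using assms(1) by auto
qed

lemma point_values:
  "B1 (point x0 x1 u v w) (point x0 x1 u v w)
     = B1 e0 (base_point u v w) * (2 * x0) + B1 e1 (base_point u v w) * (2 * x1) + B1 (base_point u v w) (base_point u v w)"
  "B2 (point x0 x1 u v w) (point x0 x1 u v w)
     = B2 e0 (base_point u v w) * (2 * x0) + B2 e1 (base_point u v w) * (2 * x1) + B2 (base_point u v w) (base_point u v w)"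
  unfolding point_def
  by (simp_all add: bilinear_simps B1.sym[of "base_point u v w" e0] B2.sym[of "base_point u v w" e0]
    B1.sym[of "base_point u v w" e1] B2.sym[of "base_point u v w" e1] algebra_simps)

context
  fixes R assumes R: "half_ring R" and CR: "form_values \<subseteq> R"
begin

interpretation half_ring R by (rule R)

lemma base_values_mem:
  assumes "u \<in> R" "v \<in> R" "w \<in> R"
  shows "B1 e0 (base_point u v w) \<in> R" "B1 e1 (base_point u v w) \<in> R" "B1 (base_point u v w) (base_point u v w) \<in> R"
    "B2 e0 (base_point u v w) \<in> R" "B2 e1 (base_point u v w) \<in> R" "B2 (base_point u v w) (base_point u v w) \<in> R"
  unfolding base_point_def bilinear_simps
  by (intro add mult assms form_values_mem[OF CR]; simp)+

lemma cramer:
  assumes uvw: "u \<in> R" "v \<in> R" "w \<in> R" and unit: "is_unit_in (dlt (base_point u v w))"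
  shows "\<exists>x0\<in>R. \<exists>x1\<in>R. B1 (point x0 x1 u v w) (point x0 x1 u v w) = 0 \<and> B2 (point x0 x1 u v w) (point x0 x1 u v w) = 0"
proof -
  define y where "y = base_point u v w"
  define d where "d = dlt y"
  have d: "is_unit_in d" "d \<noteq> 0" using unit unit_nz by (auto simp: d_def y_def)
  note mem = base_values_mem[OF uvw, folded y_def]
  define x0 where "x0 = (B1 e1 y * B2 y y - B2 e1 y * B1 y y) / d / 2"
  define x1 where "x1 = (B2 e0 y * B1 y y - B1 e0 y * B2 y y) / d / 2"
  have "x0 \<in> R" "x1 \<in> R" unfolding x0_def x1_def using mem d by auto
  moreover have "B1 e0 y * (2 * x0) + B1 e1 y * (2 * x1) + B1 y y = 0"
    unfolding x0_def x1_def using d(2) by (simp add: field_simps) (simp add: d_def dlt_def algebra_simps)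
  moreover have "B2 e0 y * (2 * x0) + B2 e1 y * (2 * x1) + B2 y y = 0"
    unfolding x0_def x1_def using d(2) by (simp add: field_simps) (simp add: d_def dlt_def algebra_simps)
  ultimately show ?thesis unfolding point_values y_def[symmetric] by blast
qed

lemma dlt_mem:
  "{dlt e2, dlt e3, dlt e4, polar e4 e2, polar e4 e3, polar e5 e2, polar e5 e3, polar e2 e3} \<subseteq> R"
  unfolding dlt_def polar_def insert_subset
  by (intro conjI diff add mult form_values_mem[OF CR] empty_subsetI; simp)

end

lemma dlt_base_point:
  "dlt (base_point u v w) = v\<^sup>2 * dlt e4 + v * w * polar e4 e5 + w\<^sup>2 * dlt e5 + (polar e4 e2 + polar e4 e3 * u) * v
     + (polar e5 e2 + polar e5 e3 * u) * w + (dlt e2 + polar e2 e3 * u + dlt e3 * u\<^sup>2)"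
  by (simp add: base_point_def dlt_simps polar.sym[of e2 e4] polar.sym[of e2 e5] polar.sym[of e3 e4] polar.sym[of e3 e5] algebra_simps)

lemma family_hyperbolic:
  assumes "dlt e4 = 0" "dlt e5 = 0" "polar e4 e5 = 1"
  shows has_family
  unfolding has_family_def
proof (intro exI[of _ form_values] conjI allI impI finite_form_values)
  fix R assume R: "half_ring R" "form_values \<subseteq> R"
  interpret half_ring R by (rule R(1))
  show "integral_family R"
    unfolding integral_family_def
  proof (rule nested_infinite_mono[OF hyperbolic_family[of "polar e4 e2" "polar e4 e3" "polar e5 e2" "polar e5 e3" "dlt e2" "polar e2 e3" "dlt e3"]])
    show "{polar e4 e2, polar e4 e3, polar e5 e2, polar e5 e3, dlt e2, polar e2 e3, dlt e3} \<subseteq> R"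
      using dlt_mem[OF R] by simp
    fix u v w assume *: "is_unit_in u \<and> v \<in> R \<and> w \<in> R \<and> is_unit_in (v * w + (polar e4 e2 + polar e4 e3 * u) * v
      + (polar e5 e2 + polar e5 e3 * u) * w + (dlt e2 + polar e2 e3 * u + dlt e3 * u\<^sup>2))"
    then have "is_unit_in (dlt (base_point u v w))" unfolding dlt_base_point using assms by simp
    then show "is_unit_in u \<and> v \<in> R \<and> w \<in> R \<and> dlt (base_point u v w) \<noteq> 0 \<and>
      (\<exists>x0\<in>R. \<exists>x1\<in>R. B1 (point x0 x1 u v w) (point x0 x1 u v w) = 0 \<and> B2 (point x0 x1 u v w) (point x0 x1 u v w) = 0)"
      using cramer[OF R, of u v w] * unit_nz by auto
  qed
qed

text \<open>Here \<open>dlt\<close> is w (a + b u) + G u v. If a and b are both nonzero, the root s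
  = -a/b needs some c with G s c nonzero; without one, \<open>dlt\<close> would vanish on the
  hyperplane h2 = s h1.\<close>

lemma family_linear:
  assumes "dlt e5 = 0" "polar e4 e5 = 0" and ne: "polar e5 e2 \<noteq> 0 \<or> polar e5 e3 \<noteq> 0"
  shows has_family
proof -
  define a b where "a = polar e5 e2" and "b = polar e5 e3"
  define G where "G s c = dlt e4 * c\<^sup>2 + (polar e4 e2 + polar e4 e3 * s) * c + (dlt e2 + polar e2 e3 * s + dlt e3 * s\<^sup>2)" for s c
  have dl: "dlt (base_point u v w) = w * (a + b * u) + G u v" for u v w
    unfolding dlt_base_point using assms(1,2) by (simp add: a_def b_def G_def algebra_simps)
  have "\<exists>s g c. s \<noteq> 0 \<and> g \<noteq> 0 \<and> ((a \<noteq> 0 \<and> a + b * s = 0 \<and> G s c = g) \<or> (a \<noteq> 0 \<and> b = 0) \<or> (a = 0 \<and> b \<noteq> 0))"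
  proof (cases "a \<noteq> 0 \<and> b \<noteq> 0")
    case False
    then show ?thesis using ne by (intro exI[of _ 1]) (auto simp: a_def b_def)
  next
    case ab: True
    define s where "s = - a / b"
    have s: "s \<noteq> 0" "a + b * s = 0" using ab by (auto simp: s_def)
    define hh where "hh x = (- s) * h1 x + 1 * h2 x" for x
    have fh: "functional hh" unfolding hh_def using h by (rule functional_combination)
    have "hh e3 \<noteq> 0" by (simp add: hh_def h1 h2)
    from dlt_nonzero_on_hyperplane[OF fh this] obtain x where x: "hh x = 0" "dlt x \<noteq> 0" .
    obtain x0 x1 y1 y2 y3 y4 where xc: "x = combination e0 e1 e2 e3 e4 e5 x0 x1 y1 y2 y3 y4" using spanning by blast
    have y2: "y2 = s * y1" using x(1) unfolding hh_def xc h_combination by simp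
    have dx: "dlt x = y1\<^sup>2 * dlt e2 + y1 * y2 * polar e2 e3 + y2\<^sup>2 * dlt e3 + y3\<^sup>2 * dlt e4 + y3 * (y1 * polar e4 e2 + y2 * polar e4 e3)
       + y4 * (y1 * a + y2 * b)"
      unfolding xc combination_def a_def b_def using assms(1,2)
      by (simp add: dlt_simps polar.sym[of e2 e4] polar.sym[of e2 e5] polar.sym[of e3 e4] polar.sym[of e3 e5] algebra_simps)
    have "y1 * a + y2 * b = y1 * (a + b * s)" by (simp add: y2 algebra_simps)
    then have dx': "dlt x = y1\<^sup>2 * dlt e2 + y1 * y2 * polar e2 e3 + y2\<^sup>2 * dlt e3 + y3\<^sup>2 * dlt e4 + y3 * (y1 * polar e4 e2 + y2 * polar e4 e3)"
      using dx s(2) by simp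
    have "\<exists>c. G s c \<noteq> 0"
    proof (cases "y1 = 0")
      case False
      have "dlt x = y1\<^sup>2 * G s (y3 / y1)"
        unfolding dx' y2 G_def using False by (simp add: field_simps power2_eq_square)
      then show ?thesis using x(2) by auto
    next
      \<comment> \<open>With y1 = y2 = 0 only y3^2 * \<open>dlt e4\<close> is left, so
        \<open>G s\<close> has a nonzero leading coefficient.\<close>
      case True
      then have "dlt e4 \<noteq> 0" using dx' x(2) y2 by auto
      then have "finite {c. dlt e4 * c\<^sup>2 + (polar e4 e2 + polar e4 e3 * s) * c + (dlt e2 + polar e2 e3 * s + dlt e3 * s\<^sup>2) = 0}"
        by (intro finite_quadratic_roots) auto
      then have "finite {c. G s c = 0}" by (simp add: G_def)
      then have "{c. G s c = 0} \<noteq> UNIV" using infinite_UNIV_char_0[where 'a='a] by metis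
      then show ?thesis by blast
    qed
    then show ?thesis using s ab by blast
  qed
  then obtain s g c where sgc: "s \<noteq> 0" "g \<noteq> 0" "(a \<noteq> 0 \<and> a + b * s = 0 \<and> G s c = g) \<or> (a \<noteq> 0 \<and> b = 0) \<or> (a = 0 \<and> b \<noteq> 0)"
    by blast
  show ?thesis
    unfolding has_family_def
  proof (intro exI[of _ "form_values \<union> {s, inverse s, g, inverse g, c, inverse a, inverse b}"] conjI allI impI)
    show "finite (form_values \<union> {s, inverse s, g, inverse g, c, inverse a, inverse b})"
      using finite_form_values by simp
    fix R assume R: "half_ring R" and CR: "form_values \<union> {s, inverse s, g, inverse g, c, inverse a, inverse b} \<subseteq> R"
    interpret half_ring R by (rule R)
    have CR': "form_values \<subseteq> R" using CR by simp
    note mem = dlt_mem[OF R CR']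
    have ab: "a \<in> R" "b \<in> R" using mem by (auto simp: a_def b_def)
    have units: "is_unit_in s" "is_unit_in g" "a \<noteq> 0 \<Longrightarrow> is_unit_in a" "b \<noteq> 0 \<Longrightarrow> is_unit_in b"
      unfolding is_unit_in_def using CR sgc(1,2) ab by auto
    show "integral_family R"
      unfolding integral_family_def
    proof (rule nested_infinite_mono[OF linear_family[of a b "dlt e4" "polar e4 e2" "polar e4 e3" "dlt e2" "polar e2 e3" "dlt e3" c s g]])
      show "{a, b, dlt e4, polar e4 e2, polar e4 e3, dlt e2, polar e2 e3, dlt e3, c} \<subseteq> R"
        using mem CR ab by simp
      show "is_unit_in s" "is_unit_in g" by (rule units)+
      show "is_unit_in a \<and> a + b * s = 0 \<and> dlt e4 * c\<^sup>2 + (polar e4 e2 + polar e4 e3 * s) * c + (dlt e2 + polar e2 e3 * s + dlt e3 * s\<^sup>2) = g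
          \<or> is_unit_in a \<and> b = 0 \<or> a = 0 \<and> is_unit_in b"
        using sgc(3) units(3,4) unfolding G_def by blast
      fix u v w assume *: "is_unit_in u \<and> v \<in> R \<and> w \<in> R \<and> is_unit_in (w * (a + b * u)
         + (dlt e4 * v\<^sup>2 + (polar e4 e2 + polar e4 e3 * u) * v + (dlt e2 + polar e2 e3 * u + dlt e3 * u\<^sup>2)))"
      then have "is_unit_in (dlt (base_point u v w))" unfolding dl G_def by simp
      then show "is_unit_in u \<and> v \<in> R \<and> w \<in> R \<and> dlt (base_point u v w) \<noteq> 0 \<and>
        (\<exists>x0\<in>R. \<exists>x1\<in>R. B1 (point x0 x1 u v w) (point x0 x1 u v w) = 0 \<and> B2 (point x0 x1 u v w) (point x0 x1 u v w) = 0)"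
        using cramer[OF R CR', of u v w] * unit_nz by auto
    qed
  qed
qed

text \<open>Otherwise \<open>dlt\<close> would be a binary form in y1 and y2. Over an algebraically
  closed field such a form has a zero (s : t), and \<open>dlt\<close> would vanish on the hyperplane
  t y1 = s y2.\<close>

lemma dlt_plane_nonzero:
  assumes "dlt e4 = 0" "dlt e5 = 0" "polar e4 e5 = 0" "polar e4 e2 = 0" "polar e4 e3 = 0" "polar e5 e2 = 0" "polar e5 e3 = 0"
  shows False
proof -
  obtain s t where st: "s \<noteq> 0 \<or> t \<noteq> 0" "dlt e2 * s\<^sup>2 + polar e2 e3 * s * t + dlt e3 * t\<^sup>2 = 0"
    using binary_form_isotropic by blast
  define hh where "hh x = t * h1 x + (- s) * h2 x" for x
  have fh: "functional hh" unfolding hh_def using h by (rule functional_combination)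
  obtain v where "hh v \<noteq> 0"
  proof (cases "t = 0")
    case True
    then show thesis using that[of e3] st(1) by (simp add: hh_def h1 h2)
  next
    case False
    then show thesis using that[of e2] by (simp add: hh_def h1 h2)
  qed
  from dlt_nonzero_on_hyperplane[OF fh this] obtain x where x: "hh x = 0" "dlt x \<noteq> 0" .
  obtain x0 x1 y1 y2 y3 y4 where xc: "x = combination e0 e1 e2 e3 e4 e5 x0 x1 y1 y2 y3 y4" using spanning by blast
  have y: "t * y1 = s * y2" using x(1) unfolding hh_def xc h_combination by simp
  have dx: "dlt x = y1\<^sup>2 * dlt e2 + y1 * y2 * polar e2 e3 + y2\<^sup>2 * dlt e3"
    unfolding xc combination_def using assms
    by (simp add: dlt_simps polar.sym[of e2 e4] polar.sym[of e2 e5] polar.sym[of e3 e4] polar.sym[of e3 e5] algebra_simps)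
  obtain l where "y1 = l * s" "y2 = l * t"
  proof (cases "s = 0")
    case True
    then show thesis using that[of "y2 / t"] st(1) y by simp
  next
    case False
    then show thesis using that[of "y1 / s"] y by (simp add: field_simps)
  qed
  then have "dlt x = l\<^sup>2 * (dlt e2 * s\<^sup>2 + polar e2 e3 * s * t + dlt e3 * t\<^sup>2)"
    unfolding dx by (simp add: algebra_simps power2_eq_square)
  then show False using st(2) x(2) by simp
qed

end

lemma framed_pair_iff: "framed_pair B1 B2 h1 h2 e0 e1 e2 e3 e4 e5 \<longleftrightarrow> line_pair B1 B2 e0 e1 \<and> frame h1 h2 e0 e1 e2 e3 e4 e5"
  by (simp add: framed_pair_def)

lemma three_equations_four_unknowns:
  fixes a :: "'a::field ^ 4 ^ 3"
  obtains x where "x \<noteq> 0" "a *v x = 0"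
proof -
  have "\<not> inj ((*v) a)"
  proof
    assume inj: "inj ((*v) a)"
    have "vec.dim ((*v) a ` UNIV) = vec.dim (UNIV :: ('a ^ 4) set)"
      by (rule vec.dim_image_eq) (use inj in \<open>simp_all add: inj_on_subset\<close>)
    moreover have "vec.dim ((*v) a ` UNIV) \<le> vec.dim (UNIV :: ('a ^ 3) set)"
      by (rule vec.dim_subset) simp
    ultimately have "CARD(4) \<le> CARD(3)" unfolding vec_dim_card by simp
    then show False by simp
  qed
  then obtain y z where "y \<noteq> z" "a *v y = a *v z" by (auto simp: inj_def)
  then show thesis using that[of "y - z"] by (simp add: matrix_vector_mult_diff_distrib)
qed

text \<open>The matrix of linear forms is now symmetric: y3 off the diagonal, forms in y1 and y2
  alone on the diagonal, and y4 nowhere.\<close>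

locale exceptional_pair = framed_pair +
  assumes normal4: "B1 e0 e4 = 0" "B1 e1 e4 = 1" "B2 e0 e4 = 1" "B2 e1 e4 = 0"
    and normal2: "B1 e1 e2 = 0" "B2 e0 e2 = 0"
    and normal3: "B1 e1 e3 = 0" "B2 e0 e3 = 0"
    and normal5: "B1 e0 e5 = 0" "B1 e1 e5 = 0" "B2 e0 e5 = 0" "B2 e1 e5 = 0"
begin

lemmas normal = normal2 normal3 normal4 normal5

text \<open>The diagonal entries are independent linear forms. From p a + q c = 0 and l^2 = - p q
  one would obtain a relation with matrix rows (p, l) and (-l, q): the two y3 terms cancel, and the
  determinant p q + l^2 is zero.\<close>

lemma transversal_det: "B1 e0 e2 * B2 e1 e3 - B1 e0 e3 * B2 e1 e2 \<noteq> 0"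
proof
  assume d: "B1 e0 e2 * B2 e1 e3 - B1 e0 e3 * B2 e1 e2 = 0"
  have "\<exists>p q. (p \<noteq> 0 \<or> q \<noteq> 0) \<and> p * B1 e0 e2 + q * B2 e1 e2 = 0 \<and> p * B1 e0 e3 + q * B2 e1 e3 = 0"
  proof (cases "B1 e0 e2 = 0 \<and> B2 e1 e2 = 0")
    case False
    then show ?thesis using d by (intro exI[of _ "B2 e1 e2"] exI[of _ "- B1 e0 e2"]) (auto simp: algebra_simps)
  next
    case 0: True
    show ?thesis
    proof (cases "B1 e0 e3 = 0 \<and> B2 e1 e3 = 0")
      case False
      then show ?thesis using 0 by (intro exI[of _ "B2 e1 e3"] exI[of _ "- B1 e0 e3"]) (auto simp: algebra_simps)
    next
      case True
      then show ?thesis using 0 by (intro exI[of _ 1] exI[of _ 0]) simp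
    qed
  qed
  then obtain p q where pq: "p \<noteq> 0 \<or> q \<noteq> 0" "p * B1 e0 e2 + q * B2 e1 e2 = 0" "p * B1 e0 e3 + q * B2 e1 e3 = 0" by blast
  obtain l where l: "l ^ 2 = - (p * q)" using nth_root_exists[of 2 "- (p * q)"] by auto
  define f where "f y = 1 * (p * B1 e0 y + l * B1 e1 y) + 1 * ((- l) * B2 e0 y + q * B2 e1 y)" for y
  have "functional f" unfolding f_def
    by (intro functional_combination B1.functional_left B2.functional_left)
  then have f0: "f y = 0" for y
    by (rule functional_eq_0) (use pq in \<open>simp_all add: f_def normal line line'\<close>)
  have "p * B1 e0 y + l * B1 e1 y + (- l) * B2 e0 y + q * B2 e1 y = 0" for y
    using f0[of y] by (simp only: f_def mult_1_left add.assoc)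
  from no_rank_one_relation[OF _ this] l have "p = 0 \<and> q = 0" by (simp add: power2_eq_square)
  then show False using pq by simp
qed

text \<open>
  Otherwise \<open>X\<close> would contain the plane spanned by \<open>e0\<close>, \<open>e1\<close>, \<open>e5\<close>, and some member of the pencil would be
  singular at a point of that plane.
\<close>

lemma vertex_not_in_base_locus: "B1 e5 e5 \<noteq> 0 \<or> B2 e5 e5 \<noteq> 0"
proof (rule ccontr)
  assume "\<not> ?thesis"
  then have g: "B1 e5 e5 = 0" "B2 e5 e5 = 0" by auto
  define a0 a1 c0 c1 where "a0 = B1 e0 e2" and "a1 = B1 e0 e3" and "c0 = B2 e1 e2" and "c1 = B2 e1 e3"
  define d where "d = a0 * c1 - a1 * c0"
  have d: "d \<noteq> 0" using transversal_det by (simp add: d_def a0_def a1_def c0_def c1_def)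
  \<comment> \<open>Coordinates of \<open>B1 e5\<close> and \<open>B2 e5\<close>, restricted to the
    plane of \<open>e2\<close> and \<open>e3\<close>, in the basis formed by the two diagonal
    entries.\<close>
  define b1a b1c b2a b2c where "b1a = (c1 * B1 e5 e2 - c0 * B1 e5 e3) / d" and "b1c = (a0 * B1 e5 e3 - a1 * B1 e5 e2) / d"
    and "b2a = (c1 * B2 e5 e2 - c0 * B2 e5 e3) / d" and "b2c = (a0 * B2 e5 e3 - a1 * B2 e5 e2) / d"
  have b: "B1 e5 e2 = a0 * b1a + c0 * b1c" "B1 e5 e3 = a1 * b1a + c1 * b1c"
    "B2 e5 e2 = a0 * b2a + c0 * b2c" "B2 e5 e3 = a1 * b2a + c1 * b2c"
    unfolding b1a_def b1c_def b2a_def b2c_def using d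
    by (simp_all add: field_simps) (simp_all add: d_def algebra_simps)
  \<comment> \<open>For x = x0 e0 + x1 e1 + e5 the three equations are the coefficients of the two
    diagonal entries and of y3 in p1 B1 x + p2 B2 x. A nontrivial solution would be a singular
    member at x.\<close>
  have no: "p1 = 0 \<and> p2 = 0"
    if eq: "p1 * (x0 + b1a) + p2 * b2a = 0" "p1 * b1c + p2 * (x1 + b2c) = 0" "p1 * (x1 + B1 e5 e4) + p2 * (x0 + B2 e5 e4) = 0"
    for p1 p2 x0 x1
  proof -
    define x where "x = x0 *s e0 + x1 *s e1 + e5"
    have "x \<noteq> 0" using independent[of x0 x1 0 1] by (auto simp: x_def)
    moreover have "B1 x x = 0" "B2 x x = 0"
      by (simp_all add: x_def bilinear_simps normal g B1.sym[of e5 e0] B1.sym[of e5 e1] B2.sym[of e5 e0] B2.sym[of e5 e1])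
    moreover have "p1 * B1 x y + p2 * B2 x y = 0" for y
    proof (rule functional_eq_0)
      show "functional (\<lambda>y. p1 * B1 x y + p2 * B2 x y)"
        by (intro functional_combination B1.functional_left B2.functional_left)
      show "p1 * B1 x e0 + p2 * B2 x e0 = 0" "p1 * B1 x e1 + p2 * B2 x e1 = 0" "p1 * B1 x e5 + p2 * B2 x e5 = 0"
        by (simp_all add: x_def bilinear_simps normal g B1.sym[of e5 e0] B1.sym[of e5 e1] B2.sym[of e5 e0] B2.sym[of e5 e1])
      show "p1 * B1 x e4 + p2 * B2 x e4 = 0" using eq(3) by (simp add: x_def bilinear_simps normal)
      have "p1 * B1 x e2 + p2 * B2 x e2 = a0 * (p1 * (x0 + b1a) + p2 * b2a) + c0 * (p1 * b1c + p2 * (x1 + b2c))"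
        by (simp add: x_def bilinear_simps normal b a0_def[symmetric] c0_def[symmetric] algebra_simps)
      then show "p1 * B1 x e2 + p2 * B2 x e2 = 0" using eq by simp
      have "p1 * B1 x e3 + p2 * B2 x e3 = a1 * (p1 * (x0 + b1a) + p2 * b2a) + c1 * (p1 * b1c + p2 * (x1 + b2c))"
        by (simp add: x_def bilinear_simps normal b a1_def[symmetric] c1_def[symmetric] algebra_simps)
      then show "p1 * B1 x e3 + p2 * B2 x e3 = 0" using eq by simp
    qed
    ultimately show ?thesis by (rule smooth)
  qed
  show False
  proof (cases "b2a = 0")
    case True
    then show False using no[of 0 "- B2 e5 e4" 1 "- b2c"] by simp
  next
    case False
    \<comment> \<open>With p1 = 1 and p2 = p, the first and the third equation determine x0 and x1,
      and the second becomes this cubic in p.\<close>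
    then have "degree [:b1c, b2c - B1 e5 e4, b1a - B2 e5 e4, b2a:] > 0" by simp
    then obtain p where p: "poly [:b1c, b2c - B1 e5 e4, b1a - B2 e5 e4, b2a:] p = 0" using alg_closed_imp_poly_has_root by blast
    define x0 where "x0 = - b1a - p * b2a"
    define x1 where "x1 = - B1 e5 e4 - p * (x0 + B2 e5 e4)"
    have "1 * b1c + p * (x1 + b2c) = poly [:b1c, b2c - B1 e5 e4, b1a - B2 e5 e4, b2a:] p"
      by (simp add: x1_def x0_def algebra_simps)
    then have "1 * b1c + p * (x1 + b2c) = 0" using p by (simp only:)
    moreover have "1 * (x0 + b1a) + p * b2a = 0" "1 * (x1 + B1 e5 e4) + p * (x0 + B2 e5 e4) = 0"
      by (simp_all add: x0_def x1_def)
    ultimately show False using no[of 1 x0 p x1] by simp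
  qed
qed

lemma family_exceptional: has_family
proof -
  define a0 a1 c0 c1 g1 g2 where "a0 = B1 e0 e2" and "a1 = B1 e0 e3" and "c0 = B2 e1 e2" and "c1 = B2 e1 e3"
    and "g1 = B1 e5 e5" and "g2 = B2 e5 e5"
  have det: "a0 * c1 - a1 * c0 \<noteq> 0" using transversal_det by (simp add: a0_def a1_def c0_def c1_def)
  \<comment> \<open>The quantity \<open>nu\<close> of \<open>fibre_solutions\<close> is n0 + n1 u as
    a function of u.\<close>
  define n0 n1 where "n0 = a0 * g2\<^sup>2 - c0 * g1\<^sup>2" and "n1 = a1 * g2\<^sup>2 - c1 * g1\<^sup>2"
  have n: "n0 \<noteq> 0 \<or> n1 \<noteq> 0"
  proof (rule ccontr)
    assume "\<not> ?thesis"
    then have 0: "n0 = 0" "n1 = 0" by auto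
    have "(a0 * c1 - a1 * c0) * g2\<^sup>2 = c1 * n0 - c0 * n1" "(a0 * c1 - a1 * c0) * g1\<^sup>2 = a1 * n0 - a0 * n1"
      by (simp_all add: n0_def n1_def algebra_simps)
    then show False using 0 det vertex_not_in_base_locus by (simp add: g1_def g2_def)
  qed
  \<comment> \<open>If n0 and n1 are both nonzero this is the root of n0 + n1 u, so
    \<open>nu\<close> at us r is n0 (1 - r). Otherwise \<open>nu\<close> at us r is a unit as soon
    as the nonzero one of n0, n1 is.\<close>
  define us where "us = (if n0 \<noteq> 0 \<and> n1 \<noteq> 0 then - n0 / n1 else 1)"
  have us: "us \<noteq> 0" by (simp add: us_def)
  define ac where "ac = (a0 + a1 * us) * (c0 + c1 * us)"
  \<comment> \<open>With kap = 1 the number \<open>e\<close> is 1 - ac / 4; where this is zero, kap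
    = 2 makes it -3.\<close>
  define kap :: 'a where "kap = (if ac = 4 then 2 else 1)"
  have kap: "kap \<noteq> 0" by (simp add: kap_def)
  define e where "e = 1 - ac * kap\<^sup>2 / 4"
  have e: "e \<noteq> 0" by (auto simp: e_def kap_def)
  define C where "C = form_values \<union> {us, inverse us, kap, inverse kap, inverse e, inverse n0, inverse n1}"
  show ?thesis
    unfolding has_family_def
  proof (intro exI[of _ C] conjI allI impI)
    show "finite C" unfolding C_def using finite_form_values by simp
    fix R assume R: "half_ring R" and CR: "C \<subseteq> R"
    interpret half_ring R by (rule R)
    have CR': "form_values \<subseteq> R" using CR by (simp add: C_def)
    note mem = form_values_mem[OF CR']
    have ac: "a0 \<in> R" "a1 \<in> R" "c0 \<in> R" "c1 \<in> R" "g1 \<in> R" "g2 \<in> R"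
      unfolding a0_def a1_def c0_def c1_def g1_def g2_def by (simp_all add: mem)
    have nR: "n0 \<in> R" "n1 \<in> R" using ac by (auto simp: n0_def n1_def)
    have usR: "us \<in> R" "kap \<in> R" using CR by (auto simp: C_def)
    have eR: "e \<in> R" unfolding e_def ac_def using ac usR by (intro diff one half_mem) auto
    have units: "is_unit_in us" "is_unit_in kap" "is_unit_in e" "n0 \<noteq> 0 \<Longrightarrow> is_unit_in n0" "n1 \<noteq> 0 \<Longrightarrow> is_unit_in n1"
      unfolding is_unit_in_def using us kap e eR usR nR CR by (auto simp: C_def)
    have nudvd: "\<exists>w\<in>R. 1 - r = ((a0 + a1 * (us * r)) * g2\<^sup>2 - (c0 + c1 * (us * r)) * g1\<^sup>2) * w" if r: "is_unit_in r" for r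
    proof -
      have nu: "(a0 + a1 * (us * r)) * g2\<^sup>2 - (c0 + c1 * (us * r)) * g1\<^sup>2 = n0 + n1 * us * r"
        by (simp add: n0_def n1_def algebra_simps)
      have rr: "1 - r \<in> R" "r \<noteq> 0" using r unit_nz by auto
      consider "n0 \<noteq> 0" "n1 \<noteq> 0" | "n0 = 0" "n1 \<noteq> 0" | "n0 \<noteq> 0" "n1 = 0" using n by blast
      then show ?thesis
      proof cases
        case 1
        then have "n1 * us = - n0" by (simp add: us_def)
        then have "n0 + n1 * us * r = n0 * (1 - r)" by (simp add: algebra_simps)
        then show ?thesis unfolding nu using 1 units(4) by (intro bexI[of _ "1 / n0"]) auto
      next
        case 2
        then have "is_unit_in (n1 * r)" using units(5) r by blast
        then show ?thesis unfolding nu using 2 rr by (intro bexI[of _ "(1 - r) / (n1 * r)"]) (auto simp: us_def)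
      next
        case 3
        then show ?thesis unfolding nu using units(4) rr by (intro bexI[of _ "(1 - r) / n0"]) auto
      qed
    qed
    define L1 L2 M1 M2 where "L1 u b = 2 * (B1 e5 e2 + u * B1 e5 e3 + b * B1 e5 e4)"
      and "L2 u b = 2 * (B2 e5 e2 + u * B2 e5 e3 + b * B2 e5 e4)"
      and "M1 u b = B1 e2 e2 + u * (2 * B1 e2 e3) + u * u * B1 e3 e3 + b * (2 * (B1 e2 e4 + u * B1 e3 e4)) + b * b * B1 e4 e4"
      and "M2 u b = B2 e2 e2 + u * (2 * B2 e2 e3) + u * u * B2 e3 e3 + b * (2 * (B2 e2 e4 + u * B2 e3 e4)) + b * b * B2 e4 e4"
    for u b
    have aff: "affine_mod q (L1 u) \<and> affine_mod q (L2 u) \<and> affine_mod q (M1 u) \<and> affine_mod q (M2 u)"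
      if "u \<in> R" "q \<in> R" for u q
      unfolding L1_def[abs_def] L2_def[abs_def] M1_def[abs_def] M2_def[abs_def]
      by (intro conjI affine_mod_add affine_mod_mult affine_mod_const affine_mod_id add mult two that mem; simp)
    have LR: "L1 u b \<in> R \<and> L2 u b \<in> R \<and> M1 u b \<in> R \<and> M2 u b \<in> R" if "u \<in> R" "b \<in> R" for u b
      unfolding L1_def L2_def M1_def M2_def by (intro conjI add mult two that mem; simp)
    have vals: "B1 e0 (base_point u b t) = a0 + a1 * u" "B1 e1 (base_point u b t) = b" "B2 e0 (base_point u b t) = b"
      "B2 e1 (base_point u b t) = c0 + c1 * u" "B1 (base_point u b t) (base_point u b t) = g1 * t\<^sup>2 + L1 u b * t + M1 u b"
      "B2 (base_point u b t) (base_point u b t) = g2 * t\<^sup>2 + L2 u b * t + M2 u b" for u b t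
      by (simp_all add: base_point_def bilinear_simps normal a0_def a1_def c0_def c1_def g1_def g2_def L1_def L2_def M1_def M2_def
        B1.sym[of e2 e5] B1.sym[of e3 e5] B1.sym[of e4 e5] B1.sym[of e3 e2] B1.sym[of e4 e2] B1.sym[of e4 e3]
        B2.sym[of e2 e5] B2.sym[of e3 e5] B2.sym[of e4 e5] B2.sym[of e3 e2] B2.sym[of e4 e2] B2.sym[of e4 e3]
        power2_eq_square algebra_simps)
    show "integral_family R"
      unfolding integral_family_def
    proof (rule nested_infinite_mono[OF exceptional_family[of a0 a1 c0 c1 g1 g2 us kap L1 L2 M1 M2]])
      show "{a0, a1, c0, c1, g1, g2} \<subseteq> R" using ac by simp
      show "is_unit_in us" "is_unit_in kap" by (rule units)+
      show "is_unit_in (1 - (a0 + a1 * us) * (c0 + c1 * us) * kap\<^sup>2 / 4)" using units(3) by (simp add: e_def ac_def)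
      show "a0 \<noteq> 0 \<or> a1 \<noteq> 0" "c0 \<noteq> 0 \<or> c1 \<noteq> 0" using det by auto
      show "\<exists>w\<in>R. 1 - r = ((a0 + a1 * (us * r)) * g2\<^sup>2 - (c0 + c1 * (us * r)) * g1\<^sup>2) * w" if "is_unit_in r" for r
        by (rule nudvd[OF that])
      show "affine_mod q (L1 u) \<and> affine_mod q (L2 u) \<and> affine_mod q (M1 u) \<and> affine_mod q (M2 u)"
        if "u \<in> R" "q \<in> R" for u q by (rule aff[OF that])
      show "L1 u b \<in> R \<and> L2 u b \<in> R \<and> M1 u b \<in> R \<and> M2 u b \<in> R" if "u \<in> R" "b \<in> R" for u b by (rule LR[OF that])
      fix u b t assume *: "is_unit_in u \<and> b \<in> R \<and> t \<in> R \<and> (a0 + a1 * u) * (c0 + c1 * u) - b\<^sup>2 \<noteq> 0 \<and>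
        (\<exists>x0\<in>R. \<exists>x1\<in>R. (a0 + a1 * u) * x0 + b * x1 + (g1 * t\<^sup>2 + L1 u b * t + M1 u b) = 0 \<and>
           b * x0 + (c0 + c1 * u) * x1 + (g2 * t\<^sup>2 + L2 u b * t + M2 u b) = 0)"
      then obtain x0 x1 where x: "x0 \<in> R" "x1 \<in> R" "(a0 + a1 * u) * x0 + b * x1 + (g1 * t\<^sup>2 + L1 u b * t + M1 u b) = 0"
           "b * x0 + (c0 + c1 * u) * x1 + (g2 * t\<^sup>2 + L2 u b * t + M2 u b) = 0" by blast
      \<comment> \<open>The halves absorb the factor 2 of the mixed terms in
        \<open>point_values\<close>.\<close>
      have "B1 (point (x0 / 2) (x1 / 2) u b t) (point (x0 / 2) (x1 / 2) u b t) = 0"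
        "B2 (point (x0 / 2) (x1 / 2) u b t) (point (x0 / 2) (x1 / 2) u b t) = 0"
        unfolding point_values vals using x(3,4) by simp_all
      moreover have "dlt (base_point u b t) = (a0 + a1 * u) * (c0 + c1 * u) - b\<^sup>2"
        by (simp add: dlt_def vals power2_eq_square)
      moreover have "x0 / 2 \<in> R" "x1 / 2 \<in> R" using x by auto
      ultimately show "is_unit_in u \<and> b \<in> R \<and> t \<in> R \<and> dlt (base_point u b t) \<noteq> 0 \<and>
        (\<exists>x0\<in>R. \<exists>x1\<in>R. B1 (point x0 x1 u b t) (point x0 x1 u b t) = 0 \<and> B2 (point x0 x1 u b t) (point x0 x1 u b t) = 0)"
        using * by auto
    qed
  qed
qed

end

text \<open>Take an isotropic vector and a partner pairing to 1 with it; subtracting half the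
  partner's square times the isotropic vector makes the partner isotropic too.\<close>

lemma binary_form_hyperbolic:
  fixes j11 j12 j22 :: "'a::{alg_closed_field, field_char_0}"
  assumes "j11 * j22 - j12 * j12 \<noteq> 0"
  obtains \<alpha> \<beta> \<gamma> \<delta> where "\<alpha> * \<delta> - \<beta> * \<gamma> \<noteq> 0" "j11 * \<alpha>\<^sup>2 + 2 * j12 * \<alpha> * \<beta> + j22 * \<beta>\<^sup>2 = 0"
    "j11 * \<gamma>\<^sup>2 + 2 * j12 * \<gamma> * \<delta> + j22 * \<delta>\<^sup>2 = 0" "j11 * \<alpha> * \<gamma> + j12 * (\<alpha> * \<delta> + \<beta> * \<gamma>) + j22 * \<beta> * \<delta> = 1"
proof -
  obtain \<alpha> \<beta> where ab: "\<alpha> \<noteq> 0 \<or> \<beta> \<noteq> 0" "j11 * \<alpha>\<^sup>2 + 2 * j12 * \<alpha> * \<beta> + j22 * \<beta>\<^sup>2 = 0"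
    using binary_form_isotropic[of j11 "2 * j12" j22] by blast
  define u1 u2 where "u1 = j11 * \<alpha> + j12 * \<beta>" and "u2 = j12 * \<alpha> + j22 * \<beta>"
  have "(j11 * j22 - j12 * j12) * \<alpha> = j22 * u1 - j12 * u2" "(j11 * j22 - j12 * j12) * \<beta> = j11 * u2 - j12 * u1"
    by (simp_all add: u1_def u2_def algebra_simps)
  then have "u1 \<noteq> 0 \<or> u2 \<noteq> 0" using ab(1) assms by auto
  then obtain g d where gd: "u1 * g + u2 * d = 1"
    by (metis add.left_neutral add.right_neutral mult_zero_right right_inverse)
  define k where "k = j11 * g\<^sup>2 + 2 * j12 * g * d + j22 * d\<^sup>2"
  define l where "l = k / 2"
  have k2: "k = 2 * l" by (simp add: l_def)
  define \<gamma> \<delta> where "\<gamma> = g - l * \<alpha>" and "\<delta> = d - l * \<beta>"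
  have one: "j11 * \<alpha> * \<gamma> + j12 * (\<alpha> * \<delta> + \<beta> * \<gamma>) + j22 * \<beta> * \<delta> = 1"
  proof -
    have "j11 * \<alpha> * \<gamma> + j12 * (\<alpha> * \<delta> + \<beta> * \<gamma>) + j22 * \<beta> * \<delta>
      = (u1 * g + u2 * d) - l * (j11 * \<alpha>\<^sup>2 + 2 * j12 * \<alpha> * \<beta> + j22 * \<beta>\<^sup>2)"
      by (simp add: \<gamma>_def \<delta>_def u1_def u2_def algebra_simps power2_eq_square)
    then show ?thesis using gd ab by simp
  qed
  have "j11 * \<gamma>\<^sup>2 + 2 * j12 * \<gamma> * \<delta> + j22 * \<delta>\<^sup>2
      = k - 2 * l * (u1 * g + u2 * d) + l\<^sup>2 * (j11 * \<alpha>\<^sup>2 + 2 * j12 * \<alpha> * \<beta> + j22 * \<beta>\<^sup>2)"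
    by (simp add: \<gamma>_def \<delta>_def u1_def u2_def k_def algebra_simps power2_eq_square)
  then have iso: "j11 * \<gamma>\<^sup>2 + 2 * j12 * \<gamma> * \<delta> + j22 * \<delta>\<^sup>2 = 0" using gd ab k2 by simp
  have "\<alpha> * \<delta> - \<beta> * \<gamma> \<noteq> 0"
  proof
    assume "\<alpha> * \<delta> - \<beta> * \<gamma> = 0"
    then have eq: "\<alpha> * \<delta> = \<beta> * \<gamma>" by simp
    obtain l where l: "\<gamma> = l * \<alpha>" "\<delta> = l * \<beta>"
    proof (cases "\<alpha> = 0")
      case True
      then show thesis using that[of "\<delta> / \<beta>"] ab(1) eq by simp
    next
      case False
      then show thesis using that[of "\<gamma> / \<alpha>"] eq by (simp add: field_simps)
    qed
    have "j11 * \<alpha> * \<gamma> + j12 * (\<alpha> * \<delta> + \<beta> * \<gamma>) + j22 * \<beta> * \<delta> = l * (j11 * \<alpha>\<^sup>2 + 2 * j12 * \<alpha> * \<beta> + j22 * \<beta>\<^sup>2)"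
      by (simp add: l algebra_simps power2_eq_square)
    then show False using one ab by simp
  qed
  then show thesis using that ab one iso by blast
qed

section \<open>Every determinant is hyperbolic, linear or exceptional\<close>

context framed_pair
begin

text \<open>Once the four forms vanish at \<open>e5\<close>, they live on the three-dimensional
  quotient by \<open>e0\<close>, \<open>e1\<close>, \<open>e5\<close>, so a linear relation holds
  among them. Its matrix is invertible because rank one is excluded, and as a change of the pencil
  it makes the matrix of forms symmetric.\<close>

lemma reduce_to_exceptional:
  assumes "dlt e4 \<noteq> 0" "dlt e5 = 0" "polar e5 e4 = 0" "polar e5 e2 = 0" "polar e5 e3 = 0"
  obtains C1 C2 f0 f1 f2 f3 where "exceptional_pair C1 C2 h1 h2 f0 f1 f2 f3 e4 e5"
    "\<And>x. C1 x x = 0 \<and> C2 x x = 0 \<longleftrightarrow> B1 x x = 0 \<and> B2 x x = 0"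
proof -
  have "polar e5 e5 = 0" using assms(2) by (simp add: polar_def dlt_def algebra_simps)
  then have p5: "polar e5 y = 0" for y
    using functional_eq_0[OF polar.functional_left, of e5 y] assms by simp
  \<comment> \<open>The vanishing of \<open>polar e5\<close> is itself a linear relation. Its
    coefficients are the values at \<open>e5\<close> up to sign, and their determinant is
    \<open>dlt e5\<close>, which is 0; hence all four values vanish.\<close>
  have "B2 e1 e5 * B1 e0 y + (- B2 e0 e5) * B1 e1 y + (- B1 e1 e5) * B2 e0 y + B1 e0 e5 * B2 e1 y = polar e5 y" for y
    by (simp add: polar_def algebra_simps)
  then have "B2 e1 e5 * B1 e0 y + (- B2 e0 e5) * B1 e1 y + (- B1 e1 e5) * B2 e0 y + B1 e0 e5 * B2 e1 y = 0" for y
    by (simp only: p5)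
  from no_rank_one_relation[OF _ this] have z5: "B1 e0 e5 = 0" "B1 e1 e5 = 0" "B2 e0 e5 = 0" "B2 e1 e5 = 0"
    using assms(2) by (auto simp: dlt_def algebra_simps)
  define F where "F e = (\<lambda>j::4. if j = 1 then B1 e0 e else if j = 2 then B1 e1 e else if j = 3 then B2 e0 e else B2 e1 e)" for e
  define A :: "'a ^ 4 ^ 3" where "A = (\<chi> i. \<chi> j. F (if i = 1 then e2 else if i = 2 then e3 else e4) j)"
  obtain x where x: "x \<noteq> 0" "A *v x = 0" using three_equations_four_unknowns .
  define r11 r12 r21 r22 where "r11 = x $ 1" and "r12 = x $ 2" and "r21 = x $ 3" and "r22 = x $ 4"
  have r0: "r11 \<noteq> 0 \<or> r12 \<noteq> 0 \<or> r21 \<noteq> 0 \<or> r22 \<noteq> 0"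
    using x(1) by (auto simp: vec_eq_iff forall_4 r11_def r12_def r21_def r22_def)
  have row: "(\<Sum>j\<in>UNIV. F e j * x $ j) = r11 * B1 e0 e + r12 * B1 e1 e + r21 * B2 e0 e + r22 * B2 e1 e" for e
    by (simp add: sum_4 F_def r11_def r12_def r21_def r22_def mult.commute)
  have "(A *v x) $ 1 = 0" "(A *v x) $ 2 = 0" "(A *v x) $ 3 = 0" using x(2) by simp_all
  then have rel0: "r11 * B1 e0 e2 + r12 * B1 e1 e2 + r21 * B2 e0 e2 + r22 * B2 e1 e2 = 0"
    "r11 * B1 e0 e3 + r12 * B1 e1 e3 + r21 * B2 e0 e3 + r22 * B2 e1 e3 = 0"
    "r11 * B1 e0 e4 + r12 * B1 e1 e4 + r21 * B2 e0 e4 + r22 * B2 e1 e4 = 0"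
    unfolding row[symmetric] by (simp_all add: A_def matrix_vector_mult_def)
  define f where "f y = 1 * (r11 * B1 e0 y + r12 * B1 e1 y) + 1 * (r21 * B2 e0 y + r22 * B2 e1 y)" for y
  have "functional f" unfolding f_def
    by (intro functional_combination B1.functional_left B2.functional_left)
  then have f0: "f y = 0" for y
    by (rule functional_eq_0) (use rel0 in \<open>simp_all add: f_def z5 line line' add.assoc\<close>)
  have rel: "r11 * B1 e0 y + r12 * B1 e1 y + r21 * B2 e0 y + r22 * B2 e1 y = 0" for y
    using f0[of y] by (simp add: f_def add.assoc)
  have detr: "r12 * (- r21) - r22 * (- r11) \<noteq> 0"
  proof
    assume "r12 * (- r21) - r22 * (- r11) = 0"
    then have "r11 * r22 = r12 * r21" by (simp add: algebra_simps)
    from no_rank_one_relation[OF this rel] show False using r0 by simp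
  qed
  \<comment> \<open>Chosen so that the difference of \<open>C1 e1\<close> and \<open>C2 e0\<close>
    is exactly the relation found.\<close>
  define C1 C2 where "C1 x y = r12 * B1 x y + r22 * B2 x y" and "C2 x y = (- r11) * B1 x y + (- r21) * B2 x y" for x y
  have lpC: "line_pair C1 C2 e0 e1" and iffC: "C1 x x = 0 \<and> C2 x x = 0 \<longleftrightarrow> B1 x x = 0 \<and> B2 x x = 0" for x
    using line_pair_combination[OF line_pair_axioms detr] unfolding C1_def[abs_def] C2_def[abs_def] by blast+
  have symC: "C2 e0 y = C1 e1 y" for y
  proof -
    have "C1 e1 y - C2 e0 y = r11 * B1 e0 y + r12 * B1 e1 y + r21 * B2 e0 y + r22 * B2 e1 y"
      by (simp add: C1_def C2_def algebra_simps)
    then show ?thesis using rel[of y] by simp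
  qed
  define j11 j12 j22 where "j11 = C1 e0 e4" and "j12 = C1 e1 e4" and "j22 = C2 e1 e4"
  have "j11 * j22 - j12 * j12 = C1 e0 e4 * C2 e1 e4 - C1 e1 e4 * C2 e0 e4" by (simp add: j11_def j12_def j22_def symC)
  also have "\<dots> = (r12 * (- r21) - r22 * (- r11)) * dlt e4" by (simp add: C1_def C2_def dlt_def algebra_simps)
  finally have "j11 * j22 - j12 * j12 \<noteq> 0" using detr assms(1) by simp
  from binary_form_hyperbolic[OF this] obtain \<alpha> \<beta> \<gamma> \<delta> where
    g: "\<alpha> * \<delta> - \<beta> * \<gamma> \<noteq> 0" "j11 * \<alpha>\<^sup>2 + 2 * j12 * \<alpha> * \<beta> + j22 * \<beta>\<^sup>2 = 0"
    "j11 * \<gamma>\<^sup>2 + 2 * j12 * \<gamma> * \<delta> + j22 * \<delta>\<^sup>2 = 0" "j11 * \<alpha> * \<gamma> + j12 * (\<alpha> * \<delta> + \<beta> * \<gamma>) + j22 * \<beta> * \<delta> = 1" .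
  \<comment> \<open>The same matrix acts on the pencil and on the line. This is a congruence of the
    symmetric matrix of forms: symmetry survives, and the value at \<open>e4\<close> becomes the
    hyperbolic plane.\<close>
  define E1 E2 where "E1 x y = \<alpha> * C1 x y + \<beta> * C2 x y" and "E2 x y = \<gamma> * C1 x y + \<delta> * C2 x y" for x y
  define f0 f1 where "f0 = \<alpha> *s e0 + \<beta> *s e1" and "f1 = \<gamma> *s e0 + \<delta> *s e1"
  have lpE': "line_pair E1 E2 e0 e1" and iffE: "E1 x x = 0 \<and> E2 x x = 0 \<longleftrightarrow> C1 x x = 0 \<and> C2 x x = 0" for x
    using line_pair_combination[OF lpC g(1)] unfolding E1_def[abs_def] E2_def[abs_def] by blast+
  have lpE: "line_pair E1 E2 f0 f1" unfolding f0_def f1_def by (rule line_pair_change_line[OF lpE' g(1)])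
  interpret C: line_pair C1 C2 e0 e1 by (rule lpC)
  interpret E: line_pair E1 E2 f0 f1 by (rule lpE)
  have Ef: "E1 f0 y = \<alpha>\<^sup>2 * C1 e0 y + 2 * (\<alpha> * \<beta>) * C1 e1 y + \<beta>\<^sup>2 * C2 e1 y"
    "E1 f1 y = \<alpha> * \<gamma> * C1 e0 y + (\<alpha> * \<delta> + \<beta> * \<gamma>) * C1 e1 y + \<beta> * \<delta> * C2 e1 y"
    "E2 f0 y = \<alpha> * \<gamma> * C1 e0 y + (\<alpha> * \<delta> + \<beta> * \<gamma>) * C1 e1 y + \<beta> * \<delta> * C2 e1 y"
    "E2 f1 y = \<gamma>\<^sup>2 * C1 e0 y + 2 * (\<gamma> * \<delta>) * C1 e1 y + \<delta>\<^sup>2 * C2 e1 y" for y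
    unfolding E1_def E2_def f0_def f1_def
    by (simp_all add: C.B1.bilinear_simps C.B2.bilinear_simps symC algebra_simps power2_eq_square)
  have E4: "E1 f0 e4 = 0" "E1 f1 e4 = 1" "E2 f0 e4 = 1" "E2 f1 e4 = 0"
    unfolding Ef j11_def[symmetric] j12_def[symmetric] j22_def[symmetric] using g(2,3,4) by (simp_all add: mult_ac)
  have C5: "C1 e0 e5 = 0" "C1 e1 e5 = 0" "C2 e1 e5 = 0" by (simp_all add: C1_def C2_def z5)
  have E5: "E1 f0 e5 = 0" "E1 f1 e5 = 0" "E2 f0 e5 = 0" "E2 f1 e5 = 0"
    unfolding Ef by (simp_all add: C5)
  have symE: "E2 f0 y = E1 f1 y" for y unfolding Ef ..
  \<comment> \<open>Multiples of \<open>e4\<close> remove y1 and y2 from the off-diagonal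
    entry.\<close>
  define f2 f3 where "f2 = e2 + (- E1 f1 e2) *s e4" and "f3 = e3 + (- E1 f1 e3) *s e4"
  have "frame h1 h2 f0 f1 e2 e3 e4 e5" unfolding f0_def f1_def by (rule change_line[OF g(1)])
  then have fr: "frame h1 h2 f0 f1 f2 f3 e4 e5" unfolding f2_def f3_def by (rule frame.change_transversal)
  have E2': "E1 f1 f2 = 0" "E1 f1 f3 = 0"
    by (simp_all add: f2_def f3_def functional_simps[OF E.B1.functional_left] E4)
  have "exceptional_pair E1 E2 h1 h2 f0 f1 f2 f3 e4 e5"
    using lpE fr E4 E5 E2' by (simp add: exceptional_pair_def exceptional_pair_axioms_def framed_pair_iff symE)
  then show thesis using that iffE iffC by blast
qed

theorem ex_family:
  obtains C1 C2 f0 f1 f2 f3 f4 f5 where "framed_pair C1 C2 h1 h2 f0 f1 f2 f3 f4 f5"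
    "\<And>x. C1 x x = 0 \<and> C2 x x = 0 \<longleftrightarrow> B1 x x = 0 \<and> B2 x x = 0"
    "framed_pair.has_family C1 C2 f0 f1 f2 f3 f4 f5"
proof -
  obtain \<alpha> \<beta> where ab: "\<alpha> \<noteq> 0 \<or> \<beta> \<noteq> 0" "dlt e4 * \<alpha>\<^sup>2 + polar e4 e5 * \<alpha> * \<beta> + dlt e5 * \<beta>\<^sup>2 = 0"
    using binary_form_isotropic by blast
  \<comment> \<open>The isotropic vector of \<open>dlt\<close> in the plane of \<open>e4\<close> and
    \<open>e5\<close> becomes \<open>f5\<close>; \<open>a\<close> and \<open>b\<close> complete it
    to a basis of that plane.\<close>
  define a b :: 'a where "a = (if \<beta> \<noteq> 0 then 1 else 0)" and "b = (if \<beta> \<noteq> 0 then 0 else 1)"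
  have det: "a * \<beta> - b * \<alpha> \<noteq> 0" using ab(1) by (auto simp: a_def b_def)
  define f4 f5 where "f4 = a *s e4 + b *s e5" and "f5 = \<alpha> *s e4 + \<beta> *s e5"
  have fr: "frame h1 h2 e0 e1 e2 e3 f4 f5" unfolding f4_def f5_def by (rule change_plane[OF det])
  interpret F: framed_pair B1 B2 h1 h2 e0 e1 e2 e3 f4 f5
    using fr line_pair_axioms by (simp add: framed_pair_iff)
  have d5: "dlt f5 = 0" using ab(2) by (simp add: f5_def dlt_simps algebra_simps)
  note result = that
  show thesis
  proof (cases "polar f4 f5 = 0")
    case False
    define q where "q = polar f4 f5"
    have q: "q \<noteq> 0" using False by (simp add: q_def)
    \<comment> \<open>Rescaled to pair to 1 with \<open>f5\<close>, then made isotropic by a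
      multiple of \<open>f5\<close>.\<close>
    define g4 where "g4 = (1 / q) *s f4 + (- dlt f4 / (q * q)) *s f5"
    have "frame h1 h2 e0 e1 e2 e3 g4 (0 *s f4 + 1 *s f5)" unfolding g4_def by (rule F.change_plane) (use q in simp)
    then have fp: "framed_pair B1 B2 h1 h2 e0 e1 e2 e3 g4 f5" using line_pair_axioms by (simp add: framed_pair_iff)
    interpret G: framed_pair B1 B2 h1 h2 e0 e1 e2 e3 g4 f5 by (rule fp)
    have p5: "polar f5 f5 = 0" using d5 by (simp add: polar_def dlt_def algebra_simps)
    have "dlt g4 = (1 / q)\<^sup>2 * dlt f4 + (1 / q) * (- dlt f4 / (q * q)) * q"
      by (simp only: g4_def dlt_simps d5 q_def[symmetric] mult_zero_right mult_zero_left add_0_right mult_ac)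
    then have "dlt g4 = 0" using q by (simp add: field_simps power2_eq_square)
    moreover have "polar g4 f5 = 1" using q by (simp only: g4_def polar.bilinear_simps p5 q_def[symmetric]) simp
    ultimately have "G.has_family" using d5 by (intro G.family_hyperbolic)
    then show thesis using result[OF fp] by blast
  next
    case p45: True
    show thesis
    proof (cases "polar f5 e2 = 0 \<and> polar f5 e3 = 0")
      case False
      then have "F.has_family" using d5 p45 by (intro F.family_linear) auto
      then show thesis using result[OF F.framed_pair_axioms] by blast
    next
      case p5: True
      show thesis
      proof (cases "dlt f4 = 0")
        case False
        have "polar f5 f4 = 0" using p45 polar.sym by simp
        from F.reduce_to_exceptional[OF False d5 this] p5 obtain C1 C2 g0 g1 g2 g3 where
          C: "exceptional_pair C1 C2 h1 h2 g0 g1 g2 g3 f4 f5" "\<And>x. C1 x x = 0 \<and> C2 x x = 0 \<longleftrightarrow> B1 x x = 0 \<and> B2 x x = 0"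
          by blast
        interpret C: exceptional_pair C1 C2 h1 h2 g0 g1 g2 g3 f4 f5 by (rule C(1))
        show thesis by (rule result[OF C.framed_pair_axioms C(2) C.family_exceptional])
      next
        case d4: True
        have p4: "polar f4 e2 \<noteq> 0 \<or> polar f4 e3 \<noteq> 0"
          using F.dlt_plane_nonzero[OF d4 d5 p45] p5 by blast
        \<comment> \<open>Now \<open>f4\<close> is isotropic as well and \<open>dlt\<close> is
          linear along it, so the two vectors exchange their roles.\<close>
        have "frame h1 h2 e0 e1 e2 e3 (0 *s f4 + 1 *s f5) (1 *s f4 + 0 *s f5)" by (rule F.change_plane) simp
        then have fp: "framed_pair B1 B2 h1 h2 e0 e1 e2 e3 f5 f4" using line_pair_axioms by (simp add: framed_pair_iff)
        interpret G: framed_pair B1 B2 h1 h2 e0 e1 e2 e3 f5 f4 by (rule fp)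
        have "polar f5 f4 = 0" using p45 polar.sym by simp
        then have "G.has_family" using d4 p4 by (intro G.family_linear)
        then show thesis using result[OF fp] by blast
      qed
    qed
  qed
qed

end

section \<open>Lines on intersections of two quadrics\<close>

lemma dim_kernel:
  fixes f :: "'a::field ^ 'n \<Rightarrow> 'a"
  assumes S: "vec.subspace S" and f: "functional f"
  shows "vec.dim S \<le> vec.dim (S \<inter> {x. f x = 0}) + 1"
    and "v \<in> S \<Longrightarrow> f v \<noteq> 0 \<Longrightarrow> vec.dim S = vec.dim (S \<inter> {x. f x = 0}) + 1"
proof -
  have sub: "vec.subspace (S \<inter> {x. f x = 0})"
    using S by (auto simp: vec.subspace_def functional_simps[OF f] functional_zero[OF f])
  have eq: "vec.dim S = vec.dim (S \<inter> {x. f x = 0}) + 1" if v: "v \<in> S" "f v \<noteq> 0" for v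
  proof -
    have "S \<subseteq> vec.span (insert v (S \<inter> {x. f x = 0}))"
    proof
      fix x assume x: "x \<in> S"
      have "x - (f x / f v) *s v \<in> S \<inter> {x. f x = 0}"
        using x v S by (auto simp: functional_simps[OF f] vec.subspace_diff vec.subspace_scale)
      then have "x - (f x / f v) *s v \<in> vec.span (S \<inter> {x. f x = 0})" by (rule vec.span_base)
      then show "x \<in> vec.span (insert v (S \<inter> {x. f x = 0}))"
        unfolding vec.span_insert by blast
    qed
    moreover have "insert v (S \<inter> {x. f x = 0}) \<subseteq> S" using v by auto
    ultimately have "vec.dim S = vec.dim (insert v (S \<inter> {x. f x = 0}))"
      using vec.dim_subset[of S "vec.span (insert v (S \<inter> {x. f x = 0}))"] vec.dim_subset[of "insert v (S \<inter> {x. f x = 0})" S]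
      by (simp only: vec.dim_span antisym)
    moreover have "v \<notin> vec.span (S \<inter> {x. f x = 0})"
      unfolding vec.span_eq_iff[THEN iffD2, OF sub] using v by simp
    ultimately show ?thesis by (simp add: vec.dim_insert)
  qed
  then show "v \<in> S \<Longrightarrow> f v \<noteq> 0 \<Longrightarrow> vec.dim S = vec.dim (S \<inter> {x. f x = 0}) + 1" .
  show "vec.dim S \<le> vec.dim (S \<inter> {x. f x = 0}) + 1"
  proof (cases "\<exists>v\<in>S. f v \<noteq> 0")
    case True
    then show ?thesis using eq by auto
  next
    case False
    then have "S \<inter> {x. f x = 0} = S" by auto
    then show ?thesis by simp
  qed
qed

lemma ex_outside_span:
  assumes "vec.dim S > card A" "finite A"
  obtains x where "x \<in> S" "x \<notin> vec.span A"
proof -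
  have "\<not> S \<subseteq> vec.span A"
  proof
    assume "S \<subseteq> vec.span A"
    from vec.dim_le_card[OF this assms(2)] show False using assms(1) by simp
  qed
  then show thesis using that by blast
qed

lemma polyfun_det:
  fixes M :: "'a::comm_ring_1 \<Rightarrow> 'a ^ 'n ^ 'n"
  assumes "\<And>i j. polyfun (\<lambda>s. M s $ i $ j)"
  shows "polyfun (\<lambda>s. det (M s))"
  unfolding det_def
  by (intro polyfun_sum polyfun_mult polyfun_const polyfun_prod assms)

text \<open>A nonconstant F(s, 1) has a root. If it is a constant c, homogeneity gives F(1, t) = c
  t^k for nonzero t, hence also for t = 0, where it vanishes since k > 0. Homogeneity is asked of
  the function, which suits determinants.\<close>

lemma homogeneous_function_zero:
  fixes F :: "'a::{alg_closed_field, field_char_0} \<Rightarrow> 'a \<Rightarrow> 'a"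
  assumes p1: "polyfun (\<lambda>s. F s 1)" and p2: "polyfun (\<lambda>t. F 1 t)"
    and hom: "\<And>l s t. l \<noteq> 0 \<Longrightarrow> F (l * s) (l * t) = l ^ k * F s t" and k: "k > 0"
  obtains s t where "s \<noteq> 0 \<or> t \<noteq> 0" "F s t = 0"
proof -
  obtain p where p: "\<And>s. F s 1 = poly p s" using p1 by (auto simp: polyfun_def)
  show thesis
  proof (cases "degree p > 0")
    case True
    then obtain z where "poly p z = 0" using alg_closed_imp_poly_has_root by blast
    then show thesis using that[of z 1] p by simp
  next
    case False
    then obtain c where c: "p = [:c:]" by (metis degree_eq_zeroE neq0_conv)
    have "F 1 t - c * t ^ k = 0" if "t \<noteq> 0" for t
      using hom[OF that, of "1 / t" 1] that p[of "1 / t"] by (simp add: c)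
    then have "UNIV - {0} \<subseteq> {t. F 1 t - c * t ^ k = 0}" by auto
    moreover have "infinite (UNIV - {0::'a})" by (rule Diff_infinite_finite) (auto simp: infinite_UNIV_char_0)
    ultimately have "infinite {t. F 1 t - c * t ^ k = 0}" using infinite_super by blast
    moreover have "polyfun (\<lambda>t. F 1 t - c * t ^ k)" by (intro polyfun_diff p2 polyfun_mult polyfun_power polyfun_const polyfun_id)
    ultimately have "F 1 0 - c * 0 ^ k = 0" by (rule polyfun_eq_0[rotated])
    then show thesis using that[of 1 0] k by simp
  qed
qed

lemma singular_kernel:
  fixes A :: "'a::field ^ 'n ^ 'n"
  assumes "det A = 0"
  obtains x where "x \<noteq> 0" "A *v x = 0"
proof -
  have "\<not> invertible A" using assms invertible_det_nz by blast
  then have "\<not> (\<exists>B. B ** A = mat 1)" by (simp add: invertible_left_inverse)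
  then show thesis using matrix_left_invertible_ker[of A] that by blast
qed

lemma functional_expand:
  fixes f :: "'a::field ^ 'n \<Rightarrow> 'a"
  assumes "functional f" shows "f x = (\<Sum>i\<in>UNIV. f (axis i 1) * x $ i)"
proof -
  have sum: "f (\<Sum>i\<in>I. g i) = (\<Sum>i\<in>I. f (g i))" for I :: "'n set" and g
    by (induction I rule: infinite_finite_induct) (auto simp: functional_zero[OF assms] functional_simps[OF assms])
  have "f x = f (\<Sum>i\<in>UNIV. x $ i *s axis i 1)" by (simp add: basis_expansion)
  also have "\<dots> = (\<Sum>i\<in>UNIV. f (x $ i *s axis i 1))" by (rule sum)
  finally have "f x = (\<Sum>i\<in>UNIV. f (x $ i *s axis i 1))" .
  then show ?thesis by (simp add: functional_simps[OF assms] mult.commute)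
qed

text \<open>The assumption says that the rank is at most m. Each step splits off the square of
  \<open>B x0\<close> with \<open>B x0 x0\<close> = 1, which adds \<open>x0\<close> to the
  radical.\<close>

lemma sum_of_squares:
  fixes B :: "'a::{alg_closed_field, field_char_0} ^ 'n \<Rightarrow> 'a ^ 'n \<Rightarrow> 'a"
  assumes "symmetric_bilinear B" "vec.dim {v. \<forall>y. B v y = 0} + m \<ge> CARD('n)"
  shows "\<exists>f. (\<forall>k. functional (f k)) \<and> (\<forall>x. B x x = (\<Sum>k<m. (f k x)\<^sup>2))"
  using assms
proof (induction m arbitrary: B)
  case 0
  interpret symmetric_bilinear B by fact
  have sub: "vec.subspace {v. \<forall>y. B v y = 0}" by (simp add: vec.subspace_def bilinear_simps)
  have "vec.dim (UNIV :: ('a ^ 'n) set) \<le> vec.dim {v. \<forall>y. B v y = 0}" using 0 unfolding vec_dim_card by simp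
  then have "{v. \<forall>y. B v y = 0} = UNIV" using vec.subspace_dim_equal[OF sub vec.subspace_UNIV] by simp
  then have "B x x = 0" for x by auto
  then show ?case by (intro exI[of _ "\<lambda>k x. 0"]) (simp add: functional_def)
next
  case (Suc m)
  interpret symmetric_bilinear B by fact
  show ?case
  proof (cases "\<forall>x. B x x = 0")
    case True
    then show ?thesis by (intro exI[of _ "\<lambda>k x. 0"]) (simp add: functional_def)
  next
    case False
    then obtain x1 where x1: "B x1 x1 \<noteq> 0" by auto
    obtain c where c: "c ^ 2 = inverse (B x1 x1)" using nth_root_exists[of 2 "inverse (B x1 x1)"] by auto
    define x0 where "x0 = c *s x1"
    have x0: "B x0 x0 = 1" using c x1 by (simp add: x0_def bilinear_simps power2_eq_square[symmetric] mult.assoc[symmetric])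
    define B' where "B' x y = B x y - B x0 x * B x0 y" for x y
    have bil: "symmetric_bilinear B'"
      by standard (simp_all add: B'_def bilinear_simps sym algebra_simps)
    have "B' x0 y = 0" for y using x0 by (simp add: B'_def)
    moreover have "B' v y = 0" if "\<forall>y. B v y = 0" for v y using that sym[of x0 v] by (simp add: B'_def)
    ultimately have "insert x0 {v. \<forall>y. B v y = 0} \<subseteq> {v. \<forall>y. B' v y = 0}" by blast
    then have "vec.dim (insert x0 {v. \<forall>y. B v y = 0}) \<le> vec.dim {v. \<forall>y. B' v y = 0}" by (rule vec.dim_subset)
    moreover have "x0 \<notin> vec.span {v. \<forall>y. B v y = 0}"
    proof -
      have "vec.subspace {v. \<forall>y. B v y = 0}" by (simp add: vec.subspace_def bilinear_simps)
      then have span: "vec.span {v. \<forall>y. B v y = 0} = {v. \<forall>y. B v y = 0}" by (rule vec.span_eq_iff[THEN iffD2])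
      show ?thesis unfolding span using x0 by (auto intro!: exI[of _ x0])
    qed
    ultimately have "vec.dim {v. \<forall>y. B' v y = 0} + m \<ge> CARD('n)" using Suc.prems(2) by (simp add: vec.dim_insert)
    from Suc.IH[OF bil this] obtain f where f: "\<forall>k. functional (f k)" "\<forall>x. B' x x = (\<Sum>k<m. (f k x)\<^sup>2)" by blast
    have "B x x = (\<Sum>k<Suc m. ((f(m := B x0)) k x)\<^sup>2)" for x
    proof -
      have "(\<Sum>k<m. ((f(m := B x0)) k x)\<^sup>2) = (\<Sum>k<m. (f k x)\<^sup>2)" by (rule sum.cong) auto
      then show ?thesis using f(2)[rule_format, of x] by (simp add: B'_def power2_eq_square algebra_simps)
    qed
    moreover have "functional ((f(m := B x0)) k)" for k
      using f(1) by (simp add: functional_def bilinear_simps)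
    ultimately show ?thesis by blast
  qed
qed

text \<open>A conic that is singular at w contains a line through w: modulo w the form
  \<open>B'\<close> is binary on a plane in S, and an isotropic vector z there spans the line with
  w.\<close>

lemma isotropic_plane_with_radical:
  fixes B B' :: "'a::{alg_closed_field, field_char_0} ^ 'n \<Rightarrow> 'a ^ 'n \<Rightarrow> 'a"
  assumes B: "symmetric_bilinear B" and B': "symmetric_bilinear B'" and S: "vec.subspace S" "vec.dim S \<ge> 3"
    and iso: "\<And>x. x \<in> S \<Longrightarrow> B x x = 0" and w: "w \<in> S" "w \<noteq> 0" "\<And>y. y \<in> S \<Longrightarrow> B' w y = 0"
  obtains z where "z \<notin> vec.span {w}" "\<And>s t. B (s *s w + t *s z) (s *s w + t *s z) = 0 \<and> B' (s *s w + t *s z) (s *s w + t *s z) = 0"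
    "z \<in> S"
proof -
  interpret B: symmetric_bilinear B by fact
  interpret B': symmetric_bilinear B' by fact
  obtain a where a: "a \<in> S" "a \<notin> vec.span {w}" using ex_outside_span[of "{w}" S] S by auto
  have "card {w, a} \<le> 2" by (simp add: card_insert_if)
  then obtain b where b: "b \<in> S" "b \<notin> vec.span {w, a}" using ex_outside_span[of "{w, a}" S] S by auto
  obtain \<alpha> \<beta> where ab: "\<alpha> \<noteq> 0 \<or> \<beta> \<noteq> 0" "B' a a * \<alpha>\<^sup>2 + (2 * B' a b) * \<alpha> * \<beta> + B' b b * \<beta>\<^sup>2 = 0"
    using binary_form_isotropic by blast
  define z where "z = \<alpha> *s a + \<beta> *s b"
  have zS: "z \<in> S" using a b S by (simp add: z_def vec.subspace_add vec.subspace_scale)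
  have zz: "B' z z = 0" using ab(2) by (simp add: z_def B'.bilinear_simps B'.sym[of b a] power2_eq_square algebra_simps)
  have znot: "z \<notin> vec.span {w}"
  proof
    assume zs: "z \<in> vec.span {w}"
    show False
    proof (cases "\<beta> = 0")
      case True
      then have "a = (1 / \<alpha>) *s z" using ab(1) by (simp add: z_def)
      then show False using a(2) vec.span_scale[OF zs] by metis
    next
      case False
      have "b = (1 / \<beta>) *s (\<beta> *s b)" using False by simp
      also have "\<beta> *s b = z - \<alpha> *s a" by (simp add: z_def)
      finally have bz: "b = (1 / \<beta>) *s (z - \<alpha> *s a)" .
      have "z \<in> vec.span {w, a}" using zs vec.span_mono[of "{w}" "{w, a}"] by blast
      moreover have "a \<in> vec.span {w, a}" by (rule vec.span_base) simp
      ultimately have "b \<in> vec.span {w, a}" unfolding bz by (intro vec.span_scale vec.span_diff)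
      then show False using b(2) by simp
    qed
  qed
  have "B (s *s w + t *s z) (s *s w + t *s z) = 0 \<and> B' (s *s w + t *s z) (s *s w + t *s z) = 0" for s t
  proof
    show "B (s *s w + t *s z) (s *s w + t *s z) = 0"
      using w zS S by (intro iso) (simp add: vec.subspace_add vec.subspace_scale)
    show "B' (s *s w + t *s z) (s *s w + t *s z) = 0"
      using w(3)[OF w(1)] w(3)[OF zS] zz by (simp add: B'.bilinear_simps B'.sym[of z w])
  qed
  then show thesis using that znot zS by blast
qed

text \<open>
  A singular member of the pencil can be written as \<open>l1 l2 - l3 l4\<close>, so it contains the planes
  \<open>s l1 = t l3\<close>, \<open>t l2 = s l4\<close>.  The restriction of another member to such a plane is singular for some \<open>(s, t)\<close>, because
  a determinant that is homogeneous of degree 4 in \<open>(s, t)\<close> has to vanish; a singular conic contains a line.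
\<close>

lemma line_in_four_space:
  fixes B1 B2 :: "'a::{alg_closed_field, field_char_0} ^ 5 \<Rightarrow> 'a ^ 5 \<Rightarrow> 'a"
  assumes B1: "symmetric_bilinear B1" and B2: "symmetric_bilinear B2"
  obtains w z where "w \<noteq> 0" "z \<notin> vec.span {w}"
    "\<And>s t. B1 (s *s w + t *s z) (s *s w + t *s z) = 0 \<and> B2 (s *s w + t *s z) (s *s w + t *s z) = 0"
proof -
  interpret B1: symmetric_bilinear B1 by fact
  interpret B2: symmetric_bilinear B2 by fact
  define M :: "'a \<Rightarrow> 'a \<Rightarrow> 'a ^ 5 ^ 5" where
    "M p q = (\<chi> i j. p * B1 (axis i 1) (axis j 1) + q * B2 (axis i 1) (axis j 1))" for p q
  obtain p q where pq: "p \<noteq> 0 \<or> q \<noteq> 0" "det (M p q) = 0"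
  proof (rule homogeneous_function_zero[of "\<lambda>p q. det (M p q)" 5])
    show "polyfun (\<lambda>s. det (M s 1))" "polyfun (\<lambda>t. det (M 1 t))"
      by (intro polyfun_det; simp add: M_def; intro polyfun_add polyfun_mult polyfun_id polyfun_const)+
    fix l s t :: 'a
    have "M (l * s) (l * t) = (\<chi> i. l *s (M s t $ i))" by (simp add: M_def vec_eq_iff algebra_simps)
    then have "det (M (l * s) (l * t)) = (\<Prod>i\<in>(UNIV :: 5 set). l) * det (M s t)"
      using det_rows_mul[of "\<lambda>i. l" "\<lambda>i. M s t $ i"] by simp
    then show "det (M (l * s) (l * t)) = l ^ 5 * det (M s t)" by simp
  qed auto
  define B where "B x y = p * B1 x y + q * B2 x y" for x y
  \<comment> \<open>A second member such that \<open>B\<close> and \<open>B'\<close> together still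
    cut out the same locus.\<close>
  define B' where "B' = (if p \<noteq> 0 then B2 else B1)"
  have bil: "symmetric_bilinear B" unfolding B_def[abs_def] by (rule symmetric_bilinear_combination[OF B1 B2])
  have bil': "symmetric_bilinear B'" using B1 B2 by (simp add: B'_def)
  interpret B: symmetric_bilinear B by (rule bil)
  interpret B': symmetric_bilinear B' by (rule bil')
  have both: "B1 x x = 0 \<and> B2 x x = 0" if "B x x = 0 \<and> B' x x = 0" for x
    using that pq(1) by (auto simp: B_def B'_def split: if_splits)
  obtain v where v: "v \<noteq> 0" "M p q *v v = 0" using singular_kernel[OF pq(2)] .
  have Bv: "B v y = 0" for y
  proof -
    have ax: "B v (axis i 1) = 0" for i
    proof -
      have "B (axis i 1) v = (\<Sum>j\<in>UNIV. B (axis i 1) (axis j 1) * v $ j)"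
        by (rule functional_expand[OF B.functional_left])
      also have "\<dots> = (M p q *v v) $ i" by (simp add: M_def B_def matrix_vector_mult_def)
      finally show ?thesis using v(2) B.sym by simp
    qed
    show ?thesis by (subst functional_expand[OF B.functional_left]) (simp add: ax)
  qed
  have "vec.dim {v} \<le> vec.dim {v. \<forall>y. B v y = 0}" by (rule vec.dim_subset) (use Bv in simp)
  then have "vec.dim {v. \<forall>y. B v y = 0} + 4 \<ge> CARD(5)" using v(1) by (simp add: vec.dim_insert vec.span_empty)
  from sum_of_squares[OF bil this] obtain f where
    f: "\<And>k. functional (f k)" "\<And>x. B x x = (\<Sum>k<(4::nat). (f k x)\<^sup>2)" by blast
  obtain i :: 'a where i: "i ^ 2 = - 1" using nth_root_exists[of 2 "- 1 :: 'a"] by auto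
  \<comment> \<open>With i^2 = -1 the squares pair up as f0^2 + f1^2 = l1 l2 and f2^2 + f3^2 = - l3
    l4.\<close>
  define l1 l2 l3 l4 where "l1 x = 1 * f 0 x + i * f 1 x" and "l2 x = 1 * f 0 x + (- i) * f 1 x"
    and "l3 x = (- 1) * f 2 x + (- i) * f 3 x" and "l4 x = 1 * f 2 x + (- i) * f 3 x" for x
  have l: "functional l1" "functional l2" "functional l3" "functional l4"
    unfolding l1_def[abs_def] l2_def[abs_def] l3_def[abs_def] l4_def[abs_def] by (intro functional_combination f)+
  have Bl: "B x x = l1 x * l2 x - l3 x * l4 x" for x
  proof -
    have "l1 x * l2 x - l3 x * l4 x = (f 0 x)\<^sup>2 - i ^ 2 * (f 1 x)\<^sup>2 + (f 2 x)\<^sup>2 - i ^ 2 * (f 3 x)\<^sup>2"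
      by (simp add: l1_def l2_def l3_def l4_def algebra_simps power2_eq_square)
    then show ?thesis unfolding f(2) i by (simp add: numeral_eq_Suc)
  qed
  define m1 m2 where "m1 s t x = s * l1 x + (- t) * l3 x" and "m2 s t x = t * l2 x + (- s) * l4 x" for s t x
  have m: "functional (m1 s t)" "functional (m2 s t)" for s t
    unfolding m1_def[abs_def] m2_def[abs_def] by (intro functional_combination l)+
  \<comment> \<open>The matrix of \<open>B'\<close> bordered by the linear forms \<open>m1\<close>
    and \<open>m2\<close>; \<open>5 option option\<close> has exactly the two extra indices needed.
    A kernel vector gives a w on which both forms vanish and for which \<open>B' w\<close> is a
    combination of them, that is, a vector in the radical of \<open>B'\<close> on the plane.\<close>
  define entry :: "'a \<Rightarrow> 'a \<Rightarrow> 5 option option \<Rightarrow> 5 option option \<Rightarrow> 'a" where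
    "entry s t a b = (case (a, b) of
        (Some (Some i), Some (Some j)) \<Rightarrow> B' (axis i 1) (axis j 1)
      | (Some (Some i), Some None) \<Rightarrow> m1 s t (axis i 1)
      | (Some (Some i), None) \<Rightarrow> m2 s t (axis i 1)
      | (Some None, Some (Some j)) \<Rightarrow> m1 s t (axis j 1)
      | (None, Some (Some j)) \<Rightarrow> m2 s t (axis j 1)
      | _ \<Rightarrow> 0)" for s t a b
  define N where "N s t = (\<chi> a b. entry s t a b)" for s t
  have UNIV_oo: "(UNIV :: 5 option option set) = insert None (insert (Some None) ((\<lambda>i. Some (Some i)) ` UNIV))"
    by (auto simp: image_iff)
  have sum_oo: "(\<Sum>a\<in>UNIV. g a) = g None + g (Some None) + (\<Sum>i\<in>UNIV. g (Some (Some i)))" for g :: "5 option option \<Rightarrow> 'a"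
    unfolding UNIV_oo by (subst sum.insert, simp, force, subst sum.insert, simp, force, subst sum.reindex) (auto simp: inj_def add.assoc)
  have prod_oo: "(\<Prod>a\<in>UNIV. g a) = g None * g (Some None) * (\<Prod>i\<in>UNIV. g (Some (Some i)))" for g :: "5 option option \<Rightarrow> 'a"
    unfolding UNIV_oo by (subst prod.insert, simp, force, subst prod.insert, simp, force, subst prod.reindex) (auto simp: inj_def mult.assoc)
  obtain s t where st: "s \<noteq> 0 \<or> t \<noteq> 0" "det (N s t) = 0"
  proof (rule homogeneous_function_zero[of "\<lambda>s t. det (N s t)" 4])
    have "polyfun (\<lambda>s. entry s 1 a b)" "polyfun (\<lambda>t. entry 1 t a b)" for a b
      unfolding entry_def m1_def m2_def
      by (cases a; cases b; cases "the a"; cases "the b"; auto intro!: polyfun_add polyfun_diff polyfun_minus polyfun_mult polyfun_id polyfun_const)+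
    then show "polyfun (\<lambda>s. det (N s 1))" "polyfun (\<lambda>t. det (N 1 t))"
      by (intro polyfun_det; simp add: N_def)+
    fix l s t :: 'a
    \<comment> \<open>Scaling (s, t) by l multiplies the two border rows and the two border columns
      by l; this is the degree 4.\<close>
    define c :: "5 option option \<Rightarrow> 'a" where "c a = (case a of Some (Some i) \<Rightarrow> 1 | _ \<Rightarrow> l)" for a
    have e: "entry (l * s) (l * t) a b = c a * (c b * entry s t a b)" for a b
      unfolding entry_def c_def m1_def m2_def by (auto split: option.splits simp: algebra_simps)
    have pc: "prod c UNIV = l * l" unfolding prod_oo by (simp add: c_def)
    have "N (l * s) (l * t) = (\<chi> a. c a *s (\<chi> b. c b * entry s t a b))"
      by (simp add: N_def vec_eq_iff e)
    then have "det (N (l * s) (l * t)) = prod c UNIV * det (\<chi> a. \<chi> b. c b * entry s t a b)"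
      by (simp add: det_rows_mul)
    also have "det (\<chi> a. \<chi> b. c b * entry s t a b) = det (transpose (\<chi> a. \<chi> b. c b * entry s t a b))"
      by (simp add: det_transpose)
    also have "transpose (\<chi> a. \<chi> b. c b * entry s t a b) = (\<chi> b. c b *s transpose (N s t) $ b)"
      by (simp add: transpose_def N_def vec_eq_iff)
    also have "det \<dots> = prod c UNIV * det (N s t)"
      using det_rows_mul[of c "\<lambda>b. transpose (N s t) $ b"] by (simp add: det_transpose)
    finally show "det (N (l * s) (l * t)) = l ^ 4 * det (N s t)" by (simp add: pc numeral_eq_Suc)
  qed auto
  obtain x where x: "x \<noteq> 0" "N s t *v x = 0" using singular_kernel[OF st(2)] .
  define w :: "'a ^ 5" where "w = (\<chi> i. x $ Some (Some i))"
  define \<alpha> \<beta> where "\<alpha> = x $ Some None" and "\<beta> = x $ None"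
  have row: "(\<Sum>b\<in>UNIV. entry s t a b * x $ b) = 0" for a
    using x(2) by (simp add: N_def matrix_vector_mult_def vec_eq_iff)
  have mw: "m1 s t w = 0" "m2 s t w = 0"
    using row[of "Some None"] row[of None] functional_expand[OF m(1), of s t w] functional_expand[OF m(2), of s t w]
    unfolding sum_oo by (simp_all add: entry_def w_def)
  have Bw: "B' w y + \<alpha> * m1 s t y + \<beta> * m2 s t y = 0" for y
  proof -
    define g where "g y = 1 * B' w y + 1 * (\<alpha> * m1 s t y + \<beta> * m2 s t y)" for y
    have fg: "functional g" unfolding g_def by (intro functional_combination B'.functional_left m)
    have "g (axis i 1) = 0" for i
    proof -
      have "B' (axis i 1) w = (\<Sum>j\<in>UNIV. B' (axis i 1) (axis j 1) * w $ j)"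
        by (rule functional_expand[OF B'.functional_left])
      then show ?thesis using row[of "Some (Some i)"] B'.sym[of w "axis i 1"]
        unfolding sum_oo by (simp add: entry_def w_def g_def \<alpha>_def \<beta>_def algebra_simps)
    qed
    then have "g y = 0" by (subst functional_expand[OF fg]) simp
    then show ?thesis by (simp add: g_def algebra_simps)
  qed
  define P where "P = {x. m1 s t x = 0 \<and> m2 s t x = 0}"
  have P: "vec.subspace P"
    by (simp add: P_def vec.subspace_def functional_simps[OF m(1)] functional_simps[OF m(2)] functional_zero[OF m(1)] functional_zero[OF m(2)])
  have Piso: "B x x = 0" if "x \<in> P" for x
  proof -
    have e: "s * l1 x = t * l3 x" "t * l2 x = s * l4 x" using that by (auto simp: P_def m1_def m2_def)
    show ?thesis
    proof (cases "s = 0")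
      case True
      then show ?thesis using e st(1) Bl by simp
    next
      case False
      have "s * (l1 x * l2 x) = s * (l3 x * l4 x)" using e by (metis mult.assoc mult.commute)
      then show ?thesis using False Bl by simp
    qed
  qed
  have d1: "5 \<le> vec.dim {x. m1 s t x = 0} + 1" "5 \<le> vec.dim {x. m2 s t x = 0} + 1"
    using dim_kernel(1)[OF vec.subspace_UNIV m(1), of s t] dim_kernel(1)[OF vec.subspace_UNIV m(2), of s t]
    unfolding vec_dim_card by simp_all
  have "\<exists>S w. vec.subspace S \<and> vec.dim S \<ge> 3 \<and> (\<forall>x\<in>S. B x x = 0) \<and> w \<in> S \<and> w \<noteq> 0 \<and> (\<forall>y\<in>S. B' w y = 0)"
  proof (cases "w = 0")
    case False
    have "vec.subspace {x. m1 s t x = 0}" by (simp add: vec.subspace_def functional_simps[OF m(1)] functional_zero[OF m(1)])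
    from dim_kernel(1)[OF this m(2), of s t] d1 have "vec.dim P \<ge> 3" by (simp add: P_def Int_def)
    moreover have "w \<in> P" using mw by (simp add: P_def)
    moreover have "B' w y = 0" if "y \<in> P" for y using Bw[of y] that by (simp add: P_def)
    ultimately show ?thesis using P Piso False by blast
  next
    \<comment> \<open>Then \<open>m1\<close> and \<open>m2\<close> are dependent and
      \<open>P\<close> has one dimension to spare: an isotropic vector u of \<open>B'\<close> is
      chosen in it, and cutting down to its orthogonal complement puts u into the radical.\<close>
    case True
    have "\<alpha> \<noteq> 0 \<or> \<beta> \<noteq> 0"
    proof (rule ccontr)
      assume "\<not> ?thesis"
      then have "x = 0" using True by (simp add: vec_eq_iff w_def \<alpha>_def \<beta>_def) (metis not_None_eq)
      then show False using x by simp
    qed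
    moreover have rel: "\<alpha> * m1 s t y + \<beta> * m2 s t y = 0" for y using Bw[of y] True by simp
    ultimately have "P = {x. m1 s t x = 0} \<or> P = {x. m2 s t x = 0}"
    proof (cases "\<beta> = 0")
      case True
      then have "m1 s t y = 0" for y using rel[of y] \<open>\<alpha> \<noteq> 0 \<or> \<beta> \<noteq> 0\<close> by simp
      then show ?thesis by (auto simp: P_def)
    next
      case False
      have "m2 s t y = 0" if "m1 s t y = 0" for y using rel[of y] that False by simp
      then show ?thesis by (auto simp: P_def)
    qed
    then have dP: "vec.dim P \<ge> 4" using d1 by auto
    obtain a where a: "a \<in> P" "a \<notin> vec.span {}" using ex_outside_span[of "{}" P] dP by auto
    obtain b where b: "b \<in> P" "b \<notin> vec.span {a}" using ex_outside_span[of "{a}" P] dP by auto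
    obtain \<gamma> \<delta> where gd: "\<gamma> \<noteq> 0 \<or> \<delta> \<noteq> 0" "B' a a * \<gamma>\<^sup>2 + (2 * B' a b) * \<gamma> * \<delta> + B' b b * \<delta>\<^sup>2 = 0"
      using binary_form_isotropic by blast
    define u where "u = \<gamma> *s a + \<delta> *s b"
    have uP: "u \<in> P" using a b P by (simp add: u_def vec.subspace_add vec.subspace_scale)
    have u0: "u \<noteq> 0"
    proof
      assume "u = 0"
      then have e: "\<delta> *s b = (- \<gamma>) *s a" by (simp add: u_def add_eq_0_iff2)
      show False
      proof (cases "\<delta> = 0")
        case True
        then show False using e gd(1) a(2) by (simp add: vec.span_empty)
      next
        case False
        then have "b = (1 / \<delta>) *s (\<delta> *s b)" by simp
        also have "\<dots> = (1 / \<delta>) *s ((- \<gamma>) *s a)" by (simp only: e)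
        also have "\<dots> \<in> vec.span {a}" by (intro vec.span_scale vec.span_base) simp
        finally show False using b(2) by simp
      qed
    qed
    have uu: "B' u u = 0" using gd(2) by (simp add: u_def B'.bilinear_simps B'.sym[of b a] power2_eq_square algebra_simps)
    define S where "S = P \<inter> {y. B' u y = 0}"
    have "vec.subspace S" using P by (auto simp: S_def vec.subspace_def B'.bilinear_simps)
    moreover have "vec.dim S \<ge> 3" using dim_kernel(1)[OF P B'.functional_left[of u]] dP by (simp add: S_def)
    ultimately show ?thesis using Piso uP u0 uu by (intro exI[of _ S] exI[of _ u]) (auto simp: S_def)
  qed
  then obtain S w' where S: "vec.subspace S" "vec.dim S \<ge> 3" "\<And>x. x \<in> S \<Longrightarrow> B x x = 0" "w' \<in> S" "w' \<noteq> 0" "\<And>y. y \<in> S \<Longrightarrow> B' w' y = 0"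
    by blast
  obtain z where "z \<notin> vec.span {w'}"
    "\<And>s t. B (s *s w' + t *s z) (s *s w' + t *s z) = 0 \<and> B' (s *s w' + t *s z) (s *s w' + t *s z) = 0"
    using isotropic_plane_with_radical[OF bil bil' S] by blast
  then show thesis using that[of w' z] S(5) both by blast
qed

lemma line_in_hyperplane:
  fixes B1 B2 :: "'a::{alg_closed_field, field_char_0} ^ 'n \<Rightarrow> 'a ^ 'n \<Rightarrow> 'a"
  assumes B1: "symmetric_bilinear B1" and B2: "symmetric_bilinear B2" and n: "CARD('n) = 6"
    and h: "functional h" "h v \<noteq> 0"
  obtains w z where "\<And>s t. s *s w + t *s z = 0 \<Longrightarrow> s = 0 \<and> t = 0"
    "\<And>s t. h (s *s w + t *s z) = 0 \<and> B1 (s *s w + t *s z) (s *s w + t *s z) = 0 \<and> B2 (s *s w + t *s z) (s *s w + t *s z) = 0"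
proof -
  interpret B1: symmetric_bilinear B1 by fact
  interpret B2: symmetric_bilinear B2 by fact
  define E where "E = {x. h x = 0}"
  have E: "vec.subspace E" by (simp add: E_def vec.subspace_def functional_simps[OF h(1)] functional_zero[OF h(1)])
  have "vec.dim E = 5" using dim_kernel(2)[OF vec.subspace_UNIV h(1) UNIV_I h(2)] n unfolding vec_dim_card by (simp add: E_def)
  then obtain b where b: "b \<subseteq> E" "vec.independent b" "E \<subseteq> vec.span b" "card b = 5" using vec.basis_exists[of E] by metis
  have fb: "finite b" using b(4) card.infinite by fastforce
  have "card (UNIV :: 5 set) = card b" using b(4) by simp
  then obtain g where g: "bij_betw g (UNIV :: 5 set) b" using fb finite_same_card_bij by (metis finite)
  define \<iota> where "\<iota> x = (\<Sum>i\<in>UNIV. x $ i *s g i)" for x :: "'a ^ 5"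
  have add: "\<iota> (x + y) = \<iota> x + \<iota> y" and scale: "\<iota> (c *s x) = c *s \<iota> x" for x y c
    by (simp_all add: \<iota>_def vec.scale_left_distrib sum.distrib vec.scale_sum_right)
  have inj: "x = 0" if "\<iota> x = 0" for x
  proof -
    define u where "u = (\<lambda>v. x $ (the_inv_into UNIV g v))"
    have gi: "the_inv_into UNIV g (g i) = i" for i
      using g by (simp add: bij_betw_def the_inv_into_f_f)
    have "(\<Sum>v\<in>b. u v *s v) = (\<Sum>i\<in>UNIV. u (g i) *s g i)"
      using sum.reindex_bij_betw[OF g, of "\<lambda>v. u v *s v"] by simp
    also have "\<dots> = 0" using that by (simp add: u_def gi \<iota>_def)
    finally have "\<forall>v\<in>b. u v = 0" using b(2) fb vec.dependent_finite by blast
    then have "u (g i) = 0" for i using g by (auto simp: bij_betw_def)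
    then show ?thesis by (simp add: u_def gi vec_eq_iff)
  qed
  have "symmetric_bilinear (\<lambda>x y. B1 (\<iota> x) (\<iota> y))" "symmetric_bilinear (\<lambda>x y. B2 (\<iota> x) (\<iota> y))"
    by (standard; simp add: add scale B1.bilinear_simps B2.bilinear_simps B1.sym B2.sym)+
  from line_in_four_space[OF this] obtain w z where wz: "w \<noteq> 0" "z \<notin> vec.span {w}"
    "\<And>s t. B1 (\<iota> (s *s w + t *s z)) (\<iota> (s *s w + t *s z)) = 0 \<and> B2 (\<iota> (s *s w + t *s z)) (\<iota> (s *s w + t *s z)) = 0"
    by blast
  have "g i \<in> E" for i using g b(1) by (auto simp: bij_betw_def)
  then have iE: "\<iota> x \<in> E" for x unfolding \<iota>_def using E by (intro vec.subspace_sum vec.subspace_scale) auto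
  show thesis
  proof (rule that[of "\<iota> w" "\<iota> z"])
    fix s t assume "s *s \<iota> w + t *s \<iota> z = 0"
    then have "s *s w + t *s z = 0" by (intro inj) (simp add: add scale)
    then have tz: "t *s z = (- s) *s w" by (simp add: add_eq_0_iff)
    have "t = 0"
    proof (rule ccontr)
      assume "t \<noteq> 0"
      then have "z = (1 / t) *s (t *s z)" by simp
      then have "z = (1 / t) *s ((- s) *s w)" by (simp only: tz)
      then show False using wz(2) by (metis vec.span_base vec.span_scale singletonI)
    qed
    then show "s = 0 \<and> t = 0" using tz wz(1) by simp
  next
    fix s t
    show "h (s *s \<iota> w + t *s \<iota> z) = 0 \<and> B1 (s *s \<iota> w + t *s \<iota> z) (s *s \<iota> w + t *s \<iota> z) = 0 \<and> B2 (s *s \<iota> w + t *s \<iota> z) (s *s \<iota> w + t *s \<iota> z) = 0"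
      using wz(3)[of s t] iE[of "s *s w + t *s z"] by (simp add: add scale E_def)
  qed
qed

section \<open>Zariski density\<close>

text \<open>Root counting in one variable at a time, innermost first. The admissible v may depend on
  u, and the admissible w on both, as happens in every family constructed here.\<close>

lemma nested_infinite_polyfun:
  fixes G :: "'a::idom \<Rightarrow> 'a \<Rightarrow> 'a \<Rightarrow> 'a"
  assumes P: "nested_infinite P" "\<And>u v w. P u v w \<Longrightarrow> G u v w = 0"
    and p: "\<And>u v. polyfun (\<lambda>w. G u v w)" "\<And>u w. polyfun (\<lambda>v. G u v w)" "\<And>v w. polyfun (\<lambda>u. G u v w)"
  shows "G u v w = 0"
proof -
  have 1: "G u v w = 0" if "infinite {w. P u v w}" for u v w
  proof (rule polyfun_eq_0[OF p(1)])
    show "infinite {w. G u v w = 0}" by (rule infinite_super[OF _ that]) (use P(2) in auto)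
  qed
  have 2: "G u v w = 0" if "infinite {v. infinite {w. P u v w}}" for u v w
  proof (rule polyfun_eq_0[OF p(2)])
    show "infinite {v. G u v w = 0}" by (rule infinite_super[OF _ that]) (use 1 in auto)
  qed
  show ?thesis
  proof (rule polyfun_eq_0[OF p(3)])
    show "infinite {u. G u v w = 0}"
      by (rule infinite_super[OF _ P(1)[unfolded nested_infinite_def]]) (use 2 in auto)
  qed
qed

text \<open>
  By Cramer's rule a point of \<open>X\<close> with \<open>\<Delta> \<noteq> 0\<close> is a polynomial function of its projection from the line.
\<close>

lemma form_vanishes:
  fixes B1 B2 :: "qbar ^ 'n::finite \<Rightarrow> qbar ^ 'n \<Rightarrow> qbar"
  assumes fp: "framed_pair B1 B2 h1 h2 e0 e1 e2 e3 e4 e5"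
    and fam: "framed_pair.integral_family B1 B2 e0 e1 e2 e3 e4 e5 R"
    and F: "homogeneous_of_degree d F"
    and zero: "\<And>x0 x1 u v w. x0 \<in> R \<Longrightarrow> x1 \<in> R \<Longrightarrow> half_ring.is_unit_in R u \<Longrightarrow> v \<in> R \<Longrightarrow> w \<in> R \<Longrightarrow>
      B1 (framed_pair.point e0 e1 e2 e3 e4 e5 x0 x1 u v w) (framed_pair.point e0 e1 e2 e3 e4 e5 x0 x1 u v w) = 0 \<Longrightarrow>
      B2 (framed_pair.point e0 e1 e2 e3 e4 e5 x0 x1 u v w) (framed_pair.point e0 e1 e2 e3 e4 e5 x0 x1 u v w) = 0 \<Longrightarrow>
      peval F (framed_pair.point e0 e1 e2 e3 e4 e5 x0 x1 u v w) = 0"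
    and x: "B1 x x = 0" "B2 x x = 0" "h1 x \<noteq> 0" "line_pair.dlt B1 B2 e0 e1 x \<noteq> 0"
  shows "peval F x = 0"
proof -
  interpret framed_pair B1 B2 h1 h2 e0 e1 e2 e3 e4 e5 by (rule fp)
  define N0 where "N0 y = B1 e1 y * B2 y y - B2 e1 y * B1 y y" for y
  define N1 where "N1 y = B2 e0 y * B1 y y - B1 e0 y * B2 y y" for y
  \<comment> \<open>Cramer's solution with the denominator 2 dlt cleared, so that the value of
    \<open>F\<close> there is a polynomial in u, v and w.\<close>
  define \<phi> where "\<phi> y = N0 y *s e0 + N1 y *s e1 + (2 * dlt y) *s y" for y
  have cramer: "\<phi> (base_point u v w) = (2 * dlt (base_point u v w)) *s point x0 x1 u v w"
    if "B1 (point x0 x1 u v w) (point x0 x1 u v w) = 0" "B2 (point x0 x1 u v w) (point x0 x1 u v w) = 0" for x0 x1 u v w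
  proof -
    define y where "y = base_point u v w"
    have e1: "B1 y y = - (B1 e0 y * (2 * x0) + B1 e1 y * (2 * x1))" and e2: "B2 y y = - (B2 e0 y * (2 * x0) + B2 e1 y * (2 * x1))"
      using that by (simp_all only: point_values y_def[symmetric] add_eq_0_iff)
    have "N0 y = 2 * dlt y * x0" "N1 y = 2 * dlt y * x1"
      unfolding N0_def N1_def e1 e2 dlt_def by (simp_all add: algebra_simps)
    then show ?thesis unfolding point_def y_def[symmetric] \<phi>_def by (simp add: vec.scale_right_distrib)
  qed
  define G where "G u v w = peval F (\<phi> (base_point u v w))" for u v w
  have G0: "G u v w = 0" for u v w
  proof (rule nested_infinite_polyfun[where G = G, OF fam[unfolded integral_family_def]])
    fix u v w assume *: "half_ring.is_unit_in R u \<and> v \<in> R \<and> w \<in> R \<and> dlt (base_point u v w) \<noteq> 0 \<and>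
       (\<exists>x0\<in>R. \<exists>x1\<in>R. B1 (point x0 x1 u v w) (point x0 x1 u v w) = 0 \<and> B2 (point x0 x1 u v w) (point x0 x1 u v w) = 0)"
    then obtain x0 x1 where x: "x0 \<in> R" "x1 \<in> R" "B1 (point x0 x1 u v w) (point x0 x1 u v w) = 0"
      "B2 (point x0 x1 u v w) (point x0 x1 u v w) = 0" by blast
    then have "peval F (point x0 x1 u v w) = 0" using zero * by blast
    then show "G u v w = 0" unfolding G_def cramer[OF x(3,4)] peval_homogeneous[OF F] by simp
  next
    note unf = G_def \<phi>_def N0_def N1_def dlt_def base_point_def bilinear_simps
    note intros = polyfun_peval polyfun_add polyfun_diff polyfun_mult polyfun_const polyfun_id
    show "polyfun (\<lambda>w. G u v w)" for u v
      unfolding unf by (rule polyfun_peval) (simp, intro intros)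
    show "polyfun (\<lambda>v. G u v w)" for u w
      unfolding unf by (rule polyfun_peval) (simp, intro intros)
    show "polyfun (\<lambda>u. G u v w)" for v w
      unfolding unf by (rule polyfun_peval) (simp, intro intros)
  qed
  obtain x0 x1 y1 y2 y3 y4 where xc: "x = combination e0 e1 e2 e3 e4 e5 x0 x1 y1 y2 y3 y4" using spanning by blast
  have y1: "y1 = h1 x" using h_combination(1) xc by simp
  then have y10: "y1 \<noteq> 0" using x(3) by simp
  define p where "p = point (x0 / y1) (x1 / y1) (y2 / y1) (y3 / y1) (y4 / y1)"
  have xp: "x = y1 *s p" using y10
    by (simp add: xc p_def combination_def point_def base_point_def vec.scale_right_distrib add.assoc)
  have "B1 p p = 0" "B2 p p = 0" using x(1,2) y10 by (simp_all add: xp bilinear_simps)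
  then have "\<phi> (base_point (y2 / y1) (y3 / y1) (y4 / y1)) = (2 * dlt (base_point (y2 / y1) (y3 / y1) (y4 / y1))) *s p"
    unfolding p_def by (rule cramer)
  then have "(2 * dlt (base_point (y2 / y1) (y3 / y1) (y4 / y1))) ^ d * peval F p = 0"
    using G0[of "y2 / y1" "y3 / y1" "y4 / y1"] unfolding G_def by (simp add: peval_homogeneous[OF F])
  moreover have "dlt (base_point (y2 / y1) (y3 / y1) (y4 / y1)) \<noteq> 0"
  proof -
    have "dlt x = y1\<^sup>2 * dlt (base_point (y2 / y1) (y3 / y1) (y4 / y1))"
      by (simp add: xp p_def point_def dlt_simps)
    then show ?thesis using x(4) by auto
  qed
  ultimately have "peval F p = 0" by simp
  then show ?thesis unfolding xp peval_homogeneous[OF F] by simp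
qed


section \<open>Existence of adapted frames\<close>

lemma ex_dual_vector:
  fixes f g :: "'a::field ^ 'n \<Rightarrow> 'a"
  assumes f: "functional f" and g: "functional g" and ind: "\<And>a b. (\<And>x. a * f x + b * g x = 0) \<Longrightarrow> a = 0 \<and> b = 0"
  obtains x where "f x = 1" "g x = 0"
proof -
  have "\<exists>x. g x = 0 \<and> f x \<noteq> 0"
  proof (rule ccontr)
    assume no: "\<not> ?thesis"
    obtain y where y: "g y \<noteq> 0" using ind[of 0 1] by auto
    have z: "functional (\<lambda>x. 0 :: 'a)" by (simp add: functional_def)
    have fx: "f x = f y / g y * g x" for x
      by (rule functional_proportional[OF z g f refl y _ refl]) (use no in auto)
    have "1 * f x + (- (f y / g y)) * g x = 0" for x using fx[of x] by simp
    from ind[OF this] show False by simp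
  qed
  then obtain x where "g x = 0" "f x \<noteq> 0" by blast
  then show thesis using that[of "(1 / f x) *s x"] by (simp add: functional_simps[OF f] functional_simps[OF g])
qed

lemma scale_in_span: "c *s v \<in> vec.span A \<Longrightarrow> v \<notin> vec.span A \<Longrightarrow> c = (0::'a::field)"
  using vec.span_scale[of "c *s v" A "inverse c"] by (cases "c = 0") simp_all

lemma ex_frame:
  fixes h1 h2 :: "'a::field ^ 'n \<Rightarrow> 'a"
  assumes n: "CARD('n) = 6" and h: "functional h1" "functional h2"
    and ind: "\<And>a b. (\<And>x. a * h1 x + b * h2 x = 0) \<Longrightarrow> a = 0 \<and> b = 0"
    and line: "\<And>s t. s *s e0 + t *s e1 = 0 \<Longrightarrow> s = 0 \<and> t = 0"
    and van: "h1 e0 = 0" "h1 e1 = 0" "h2 e0 = 0" "h2 e1 = 0"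
  obtains e2 e3 e4 e5 where "frame h1 h2 e0 e1 e2 e3 e4 e5"
proof -
  obtain e2 where e2: "h1 e2 = 1" "h2 e2 = 0" using ex_dual_vector[OF h ind] by blast
  have ind': "a = 0 \<and> b = 0" if "\<And>x. a * h2 x + b * h1 x = 0" for a b
    using ind[of b a] that by (simp add: add.commute)
  obtain e3 where e3: "h2 e3 = 1" "h1 e3 = 0" using ex_dual_vector[OF h(2,1) ind'] by blast
  define U where "U = {x. h1 x = 0} \<inter> {x. h2 x = 0}"
  have H1: "vec.subspace {x. h1 x = 0}" by (simp add: vec.subspace_def functional_simps[OF h(1)] functional_zero[OF h(1)])
  have "vec.dim {x. h1 x = 0} = 5"
    using dim_kernel(2)[OF vec.subspace_UNIV h(1) UNIV_I, of e2] e2 n unfolding vec_dim_card by simp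
  then have dU: "vec.dim U = 4" using dim_kernel(2)[OF H1 h(2), of e3] e3 by (simp add: U_def)
  have e01: "e0 \<in> U" "e1 \<in> U" using van by (auto simp: U_def)
  have "card {e1, e0} \<le> 2" by (simp add: card_insert_if)
  then obtain e4 where e4: "e4 \<in> U" "e4 \<notin> vec.span {e1, e0}"
    using ex_outside_span[of "{e1, e0}" U] dU by auto
  have "card {e4, e1, e0} \<le> 3" by (simp add: card_insert_if)
  then obtain e5 where e5: "e5 \<in> U" "e5 \<notin> vec.span {e4, e1, e0}"
    using ex_outside_span[of "{e4, e1, e0}" U] dU by auto
  have e00: "e0 \<notin> vec.span {}" using line[of 1 0] by (auto simp: vec.span_empty)
  have e10: "e1 \<notin> vec.span {e0}"
  proof
    assume "e1 \<in> vec.span {e0}"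
    then obtain k where "e1 = k *s e0" by (auto simp: vec.span_singleton)
    then show False using line[of k "- 1"] by simp
  qed
  have "vec.independent {e5, e4, e1, e0}"
    using e00 e10 e4(2) e5(2) by (intro vec.independent_insertI vec.independent_empty)
  moreover have "e0 \<notin> {}" "e1 \<notin> {e0}" "e4 \<notin> {e1, e0}" "e5 \<notin> {e4, e1, e0}"
    using e10 e4(2) e5(2) vec.span_base[of e1 "{e0}"] vec.span_base[of e4 "{e1, e0}"] vec.span_base[of e5 "{e4, e1, e0}"]
    by blast+
  then have "card {e5, e4, e1, e0} = 4" by (simp add: card_insert_if)
  ultimately have span: "U \<subseteq> vec.span {e5, e4, e1, e0}"
    using vec.card_ge_dim_independent[of "{e5, e4, e1, e0}" U] e01 e4 e5 dU by auto
  have "frame h1 h2 e0 e1 e2 e3 e4 e5"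
  proof
    fix x
    have "x - h1 x *s e2 - h2 x *s e3 \<in> U"
      by (simp add: U_def functional_simps[OF h(1)] functional_simps[OF h(2)] e2 e3)
    then have "x - h1 x *s e2 - h2 x *s e3 \<in> vec.span {e5, e4, e1, e0}" using span by blast
    then obtain a b c d where "x - h1 x *s e2 - h2 x *s e3 - a *s e5 - b *s e4 - c *s e1 - d *s e0 = 0"
      unfolding vec.span_breakdown_eq vec.span_empty singleton_iff by (elim exE)
    then have "x = combination e0 e1 e2 e3 e4 e5 d c (h1 x) (h2 x) b a"
      unfolding combination_def by (simp add: algebra_simps)
    then show "\<exists>x0 x1 y1 y2 y3 y4. x = combination e0 e1 e2 e3 e4 e5 x0 x1 y1 y2 y3 y4" by blast
  next
    fix x0 x1 y3 y4 assume 0: "x0 *s e0 + x1 *s e1 + y3 *s e4 + y4 *s e5 = 0"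
    have "y4 *s e5 = - (x0 *s e0 + x1 *s e1 + y3 *s e4)" using minus_unique[OF 0] by (rule sym)
    also have "\<dots> \<in> vec.span {e4, e1, e0}"
      by (intro vec.span_neg vec.span_add vec.span_scale vec.span_base) auto
    finally have y4: "y4 = 0" using scale_in_span e5(2) by blast
    then have "x0 *s e0 + x1 *s e1 + y3 *s e4 = 0" using 0 by simp
    from minus_unique[OF this] have "y3 *s e4 = - (x0 *s e0 + x1 *s e1)" by (rule sym)
    also have "\<dots> \<in> vec.span {e1, e0}"
      by (intro vec.span_neg vec.span_add vec.span_scale vec.span_base) auto
    finally have y3: "y3 = 0" using scale_in_span e4(2) by blast
    then show "x0 = 0 \<and> x1 = 0 \<and> y3 = 0 \<and> y4 = 0" using 0 y4 line[of x0 x1] by simp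
  qed (use h van e2 e3 e4 e5 in \<open>auto simp: U_def\<close>)
  then show thesis by (rule that)
qed


section \<open>Integral points\<close>

lemma coeffs_in_add:
  "coeffs_in R f \<Longrightarrow> coeffs_in R g \<Longrightarrow> (\<And>x y. x \<in> R \<Longrightarrow> y \<in> R \<Longrightarrow> x + y \<in> R) \<Longrightarrow> coeffs_in R (f + g)"
  by (simp add: coeffs_in_def lookup_add)

lemma coeffs_in_sum:
  assumes "\<And>i. i \<in> I \<Longrightarrow> coeffs_in R (f i)" "0 \<in> R" "\<And>x y. x \<in> R \<Longrightarrow> y \<in> R \<Longrightarrow> x + y \<in> R"
  shows "coeffs_in R (\<Sum>i\<in>I. f i)"
  using assms(1)
proof (induction I rule: infinite_finite_induct)
  case (insert i I)
  then have "coeffs_in R (f i)" "coeffs_in R (sum f I)" by simp_all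
  from coeffs_in_add[OF this assms(3)] show ?case using insert.hyps by simp
qed (simp_all add: coeffs_in_def assms(2))

lemma coeffs_in_single: "c \<in> R \<Longrightarrow> 0 \<in> R \<Longrightarrow> coeffs_in R (Poly_Mapping.single m c)"
  by (auto simp: coeffs_in_def lookup_single when_def)

lemma coeffs_in_mult_linear_forms:
  fixes c d :: "qbar ^ 'n::finite"
  assumes "\<And>i. c $ i \<in> R" "\<And>i. d $ i \<in> R" "0 \<in> R" "\<And>x y. x \<in> R \<Longrightarrow> y \<in> R \<Longrightarrow> x + y \<in> R" "\<And>x y. x \<in> R \<Longrightarrow> y \<in> R \<Longrightarrow> x * y \<in> R"
  shows "coeffs_in R (linear_form c * linear_form d)"
  unfolding linear_form_def sum_product mult_single
  by (rule coeffs_in_sum, rule coeffs_in_sum, rule coeffs_in_single, rule assms(5)[OF assms(1,2)], rule assms(3),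
      rule assms(3), rule assms(4), assumption, assumption, rule assms(3), rule assms(4))

lemma homogeneous_2_product: "homogeneous_of_degree 2 (linear_form c * linear_form d)"
  using homogeneous_mult[OF homogeneous_linear_form homogeneous_linear_form, of c d] by (simp add: numeral_2_eq_2)

text \<open>The product of the two linear forms is an integral form vanishing on \<open>D\<close>.
  If coordinates x' = l x witnessed a reduction into \<open>D\<close>, then l^2 u would be in the
  maximal ideal; as u is a unit and x is integral, all of x' would be in it too.\<close>

lemma not_reduces_into:
  fixes p :: "('n::finite) proj" and c1 c2 x :: "qbar ^ 'n"
  assumes K: "number_field K" and \<nu>: "\<nu> \<in> places K" "nonarchimedean K \<nu>"
    and c: "\<And>i. c1 $ i \<in> valuation_ring_of K \<nu>" "\<And>i. c2 $ i \<in> valuation_ring_of K \<nu>"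
    and x: "x \<in> coords p" "\<And>i. x $ i \<in> valuation_ring_of K \<nu>"
    and h: "(\<Sum>i\<in>UNIV. c1 $ i * x $ i) = 1" "(\<Sum>i\<in>UNIV. c2 $ i * x $ i) = u" "u \<in> valuation_ring_of K \<nu>"
      "inverse u \<in> valuation_ring_of K \<nu>" "u \<noteq> 0"
    and D: "\<And>q y. q \<in> D \<Longrightarrow> y \<in> coords q \<Longrightarrow> (\<Sum>i\<in>UNIV. c1 $ i * y $ i) * (\<Sum>i\<in>UNIV. c2 $ i * y $ i) = 0"
  shows "\<not> reduces_into K \<nu> D p"
proof
  assume "reduces_into K \<nu> D p"
  then obtain x' :: "qbar ^ 'n" where x': "x' \<in> coords p" "\<And>i. x' $ i \<in> valuation_ring_of K \<nu>" "\<exists>i. x' $ i \<notin> maximal_ideal_of K \<nu>"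
    "\<And>f d. homogeneous_of_degree d f \<Longrightarrow> coeffs_in (valuation_ring_of K \<nu>) f \<Longrightarrow>
               f \<in> vanishing_ideal D \<Longrightarrow> peval f x' \<in> maximal_ideal_of K \<nu>"
    unfolding reduces_into_def by blast
  note cl = valuation_ring_closed[OF K \<nu>]
  have "linear_form c1 * linear_form c2 \<in> vanishing_ideal D" using D by (simp add: vanishing_ideal_def)
  then have "peval (linear_form c1 * linear_form c2) x' \<in> maximal_ideal_of K \<nu>"
    by (intro x'(4)[OF homogeneous_2_product] coeffs_in_mult_linear_forms c cl)
  then have max: "(\<Sum>i\<in>UNIV. c1 $ i * x' $ i) * (\<Sum>i\<in>UNIV. c2 $ i * x' $ i) \<in> maximal_ideal_of K \<nu>" by simp
  obtain l where l: "x' = l *s x" using coords_scaled[OF x(1) x'(1)] by blast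
  have s: "(\<Sum>i\<in>UNIV. c $ i * x' $ i) = l * (\<Sum>i\<in>UNIV. c $ i * x $ i)" for c
    by (simp add: l sum_distrib_left mult_ac)
  have lK: "l \<in> K"
  proof -
    have "(\<Sum>i\<in>UNIV. c1 $ i * x' $ i) \<in> valuation_ring_of K \<nu>"
    proof -
      have "(\<Sum>i\<in>I. c1 $ i * x' $ i) \<in> valuation_ring_of K \<nu>" for I
        by (induction I rule: infinite_finite_induct) (auto intro: cl c x')
      then show ?thesis .
    qed
    then show ?thesis unfolding s h by (simp add: valuation_ring_of_def)
  qed
  have xK: "x $ i \<in> K" for i using x(2)[of i] by (simp add: valuation_ring_of_def)
  have uK: "u \<in> K" using h(3) by (simp add: valuation_ring_of_def)
  have "x' $ i \<in> maximal_ideal_of K \<nu>" for i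
  proof -
    have "v (x' $ i) < 1" if v: "v \<in> \<nu>" for v
    proof -
      interpret absolute_value K v using places_absolute_value[OF K \<nu>(1) v] .
      have "v u \<le> 1" "v (inverse u) \<le> 1" using h(3,4) v by (auto simp: valuation_ring_of_def)
      moreover have "v u > 0" using uK h(5) by (rule pos)
      ultimately have "v u = 1" using uK by (simp add: at_inverse inverse_le_1_iff)
      moreover have "v (l * 1 * (l * u)) < 1" using max v unfolding s h by (simp add: maximal_ideal_of_def)
      ultimately have "v l * v l < 1" using lK uK by (simp add: mult)
      then have vl: "v l < 1" using nonneg[OF lK] by (metis less_1_mult linorder_neqE_linordered_idom mult_1 order_less_irrefl order.asym)
      have "v (x' $ i) = v l * v (x $ i)" using lK xK by (simp add: l mult)
      also have "\<dots> \<le> v l * 1" using x(2)[of i] v nonneg[OF lK] by (intro mult_left_mono) (auto simp: valuation_ring_of_def)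
      finally show ?thesis using vl by simp
    qed
    then show ?thesis using lK xK number_field_mult[OF K] by (simp add: maximal_ideal_of_def l)
  qed
  then show False using x'(3) by blast
qed

section \<open>From a line on the complex to potential density\<close>

definition smooth_pencil :: "('a::field ^ 'n \<Rightarrow> 'a ^ 'n \<Rightarrow> 'a) \<Rightarrow> ('a ^ 'n \<Rightarrow> 'a ^ 'n \<Rightarrow> 'a) \<Rightarrow> bool" where
  "smooth_pencil B1 B2 \<longleftrightarrow> (\<forall>x p1 p2. x \<noteq> 0 \<longrightarrow> B1 x x = 0 \<longrightarrow> B2 x x = 0 \<longrightarrow>
     (\<forall>y. p1 * B1 x y + p2 * B2 x y = 0) \<longrightarrow> p1 = 0 \<and> p2 = 0)"

lemma dense_of_line:
  fixes X D :: "6 proj set"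
  assumes K: "number_field K" and irr: "irreducible_closed X" and X: "X = zero_locus {q1} \<inter> zero_locus {q2}"
    and B: "symmetric_bilinear B1" "symmetric_bilinear B2" "\<And>x. peval q1 x = B1 x x" "\<And>x. peval q2 x = B2 x x"
    and smooth: "smooth_pencil B1 B2"
    and ind: "\<And>s t. s *s w + t *s z = 0 \<Longrightarrow> s = 0 \<and> t = 0"
    and line: "\<And>s t. B1 (s *s w + t *s z) (s *s w + t *s z) = 0" "\<And>s t. B2 (s *s w + t *s z) (s *s w + t *s z) = 0"
    and h: "functional h1" "functional h2" "\<And>a b. (\<And>x. a * h1 x + b * h2 x = 0) \<Longrightarrow> a = 0 \<and> b = 0"
    and van: "h1 w = 0" "h1 z = 0" "h2 w = 0" "h2 z = 0"
    and D: "\<And>p x. p \<in> D \<Longrightarrow> x \<in> coords p \<Longrightarrow> h1 x = 0 \<or> h2 x = 0"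
  shows "integral_points_potentially_dense K X D"
proof -
  interpret B1: symmetric_bilinear B1 by (rule B)
  interpret B2: symmetric_bilinear B2 by (rule B)
  have ww: "B1 w w = 0" "B2 w w = 0" and zz: "B1 z z = 0" "B2 z z = 0"
    using line[of 1 0] line[of 0 1] by simp_all
  have wz: "B1 w z = 0" "B2 w z = 0"
    using line[of 1 1] ww zz by (simp_all add: B1.bilinear_simps B2.bilinear_simps B1.sym[of z w] B2.sym[of z w])
  have lp: "line_pair B1 B2 w z"
    using ww zz wz ind smooth unfolding smooth_pencil_def
    by (intro line_pair.intro line_pair_axioms.intro B) blast+
  obtain e2 e3 e4 e5 where "frame h1 h2 w z e2 e3 e4 e5" 
    by (rule ex_frame[OF _ h ind van]) (simp, blast+)
  then interpret E: framed_pair B1 B2 h1 h2 w z e2 e3 e4 e5 using lp by (simp add: framed_pair_iff)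
  obtain C1 C2 f0 f1 f2 f3 f4 f5 where F: "framed_pair C1 C2 h1 h2 f0 f1 f2 f3 f4 f5"
    "\<And>x. C1 x x = 0 \<and> C2 x x = 0 \<longleftrightarrow> B1 x x = 0 \<and> B2 x x = 0"
    "framed_pair.has_family C1 C2 f0 f1 f2 f3 f4 f5" by (rule E.ex_family) (rule that)
  interpret F: framed_pair C1 C2 h1 h2 f0 f1 f2 f3 f4 f5 by (rule F(1))
  obtain C where C: "finite C" "\<And>R. half_ring R \<Longrightarrow> C \<subseteq> R \<Longrightarrow> F.integral_family R"
    using F(3) unfolding F.has_family_def by blast
  define c1 :: "qbar ^ 6" where "c1 = (\<chi> i. h1 (axis i 1))"
  define c2 :: "qbar ^ 6" where "c2 = (\<chi> i. h2 (axis i 1))"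
  have hc: "h1 x = (\<Sum>i\<in>UNIV. c1 $ i * x $ i)" "h2 x = (\<Sum>i\<in>UNIV. c2 $ i * x $ i)" for x
    unfolding c1_def c2_def using functional_expand[OF h(1), of x] functional_expand[OF h(2), of x] by simp_all
  \<comment> \<open>Everything that must become integral: the constants of the family, 1/2, the
    coordinates of the frame and the coefficients of \<open>h1\<close> and
    \<open>h2\<close>.\<close>
  define A where "A = C \<union> {inverse 2} \<union> (\<Union>i. {f0 $ i, f1 $ i, f2 $ i, f3 $ i, f4 $ i, f5 $ i, c1 $ i, c2 $ i})"
  have A: "finite A" using C(1) by (simp add: A_def)
  obtain K' where K': "number_field K'" "K \<subseteq> K'" "A \<subseteq> K'" using number_field_finite_extension[OF A K] by blast
  obtain S where S: "finite S" "archimedean_places K' \<subseteq> S" "S \<subseteq> places K'"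
    "\<And>\<nu> a. \<nu> \<in> places K' - S \<Longrightarrow> a \<in> A \<Longrightarrow> a \<in> valuation_ring_of K' \<nu>"
    using ex_places_integral[OF K'(1) A K'(3)] by blast
  have nonarch: "nonarchimedean K' \<nu>" if "\<nu> \<in> places K' - S" for \<nu>
    using that S(2) by (auto simp: archimedean_places_def)
  define R where "R = {x \<in> K'. \<forall>\<nu>\<in>places K' - S. x \<in> valuation_ring_of K' \<nu>}"
  have AR: "A \<subseteq> R" using K'(3) S(4) by (auto simp: R_def)
  have R: "half_ring R"
  proof
    show "0 \<in> R" "1 \<in> R"
      using number_field_0[OF K'(1)] number_field_1[OF K'(1)] valuation_ring_closed(1,2)[OF K'(1) _ nonarch] by (auto simp: R_def)
    show "x + y \<in> R" "x * y \<in> R" if "x \<in> R" "y \<in> R" for x y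
      using that number_field_add[OF K'(1)] number_field_mult[OF K'(1)] valuation_ring_closed(4,5)[OF K'(1) _ nonarch]
      by (auto simp: R_def)
    show "- x \<in> R" if "x \<in> R" for x
      using that number_field_minus[OF K'(1)] valuation_ring_closed(3)[OF K'(1) _ nonarch] by (auto simp: R_def)
    show "inverse 2 \<in> R" using AR by (auto simp: A_def)
  qed
  interpret R: half_ring R by (rule R)
  have fam: "F.integral_family R" using C(2)[OF R] AR by (auto simp: A_def)
  have inX: "p \<in> X \<longleftrightarrow> C1 x x = 0 \<and> C2 x x = 0" if x: "x \<in> coords p" for p x
  proof -
    have "B1 (c *s x) (c *s x) = c * (c * B1 x x)" "B2 (c *s x) (c *s x) = c * (c * B2 x x)" for c
      by (simp_all add: B1.bilinear_simps B2.bilinear_simps)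
    then have scale: "B1 (c *s x) (c *s x) = 0 \<and> B2 (c *s x) (c *s x) = 0" if "B1 x x = 0 \<and> B2 x x = 0" for c
      using that by simp
    have "B1 y y = 0 \<and> B2 y y = 0" if y: "y \<in> coords p" and "B1 x x = 0 \<and> B2 x x = 0" for y
    proof -
      obtain c where "y = c *s x" using coords_scaled[OF x y] by blast
      then show ?thesis using scale[OF that(2)] by simp
    qed
    then have "p \<in> X" if "B1 x x = 0 \<and> B2 x x = 0" using that unfolding X zero_locus_def by (simp add: B(3,4))
    moreover have "B1 x x = 0 \<and> B2 x x = 0" if "p \<in> X" using that x unfolding X zero_locus_def by (simp add: B(3,4))
    ultimately show ?thesis unfolding F(2) by (rule iffI[rotated])
  qed
  define T where "T = integral_points K' S X D"
  have integral: "p \<in> T" if x: "x0 \<in> R" "x1 \<in> R" "R.is_unit_in u" "v \<in> R" "w' \<in> R"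
      "C1 (F.point x0 x1 u v w') (F.point x0 x1 u v w') = 0" "C2 (F.point x0 x1 u v w') (F.point x0 x1 u v w') = 0"
      and p: "F.point x0 x1 u v w' \<in> coords p" for x0 x1 u v w' p
  proof -
    define x where "x = F.point x0 x1 u v w'"
    have uR: "u \<in> R" "inverse u \<in> R" "u \<noteq> 0" using x(3) unfolding R.is_unit_in_def by blast+
    have fR: "f0 $ i \<in> R" "f1 $ i \<in> R" "f2 $ i \<in> R" "f3 $ i \<in> R" "f4 $ i \<in> R" "f5 $ i \<in> R" "c1 $ i \<in> R" "c2 $ i \<in> R" for i
      using AR by (auto simp: A_def)
    have xR: "x $ i \<in> R" for i
      unfolding x_def F.point_def F.base_point_def using fR x(1,2,4,5) uR by simp
    have hx: "h1 x = 1" "h2 x = u"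
      by (simp_all add: x_def F.point_def F.base_point_def functional_simps[OF h(1)] functional_simps[OF h(2)] F.h1 F.h2)
    have pX: "p \<in> X" using inX[OF p] x by simp
    have pD: "p \<notin> D" using D[of p x] p hx uR by (auto simp: x_def)
    have rat: "rational_point K' p" unfolding rational_point_def using p xR by (auto simp: x_def R_def)
    have "\<not> reduces_into K' \<nu> D p" if \<nu>: "\<nu> \<in> places K' - S" for \<nu>
    proof (rule not_reduces_into[of K' \<nu> c1 c2 x p u])
      have RV: "a \<in> valuation_ring_of K' \<nu>" if "a \<in> R" for a using that \<nu> by (simp add: R_def)
      show "number_field K'" "\<nu> \<in> places K'" "nonarchimedean K' \<nu>" using K' \<nu> nonarch by auto
      show "c1 $ i \<in> valuation_ring_of K' \<nu>" "c2 $ i \<in> valuation_ring_of K' \<nu>" "x $ i \<in> valuation_ring_of K' \<nu>"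
        "u \<in> valuation_ring_of K' \<nu>" "inverse u \<in> valuation_ring_of K' \<nu>" for i
        using RV fR xR uR by auto
      show "x \<in> coords p" using p by (simp add: x_def)
      show "u \<noteq> 0" by (rule uR)
      show "(\<Sum>i\<in>UNIV. c1 $ i * x $ i) = 1" "(\<Sum>i\<in>UNIV. c2 $ i * x $ i) = u" using hx by (simp_all add: hc)
      show "(\<Sum>i\<in>UNIV. c1 $ i * y $ i) * (\<Sum>i\<in>UNIV. c2 $ i * y $ i) = 0" if "q \<in> D" "y \<in> coords q" for q y
        using D[OF that] by (auto simp: hc)
    qed
    then show ?thesis using pX pD rat by (simp add: T_def integral_points_def)
  qed
  have pt: "\<exists>p. F.point x0 x1 u v w' \<in> coords p" for x0 x1 u v w'
  proof -
    have "h1 (F.point x0 x1 u v w') = 1"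
      by (simp add: F.point_def F.base_point_def functional_simps[OF h(1)] F.h1)
    then have "F.point x0 x1 u v w' \<noteq> 0" using functional_zero[OF h(1)] by auto
    then show ?thesis using point_of_vector by blast
  qed
  \<comment> \<open>The cubic form h1 * dlt cuts out the locus where the parametrisation fails. A
    form vanishing on the integral points vanishes on \<open>X\<close> wherever \<open>g\<close>
    does not, and irreducibility removes the restriction.\<close>
  define g where "g = linear_form c1 * (linear_form (\<chi> i. C1 f0 (axis i 1)) * linear_form (\<chi> i. C2 f1 (axis i 1))
      - linear_form (\<chi> i. C1 f1 (axis i 1)) * linear_form (\<chi> i. C2 f0 (axis i 1)))"
  have g3: "homogeneous_of_degree (1 + 2) g"
    unfolding g_def by (intro homogeneous_mult homogeneous_diff homogeneous_2_product homogeneous_linear_form)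
  have gval: "peval g x = h1 x * F.dlt x" for x
    unfolding g_def F.dlt_def hc
    using functional_expand[OF F.B1.functional_left[of f0], of x] functional_expand[OF F.B1.functional_left[of f1], of x]
      functional_expand[OF F.B2.functional_left[of f0], of x] functional_expand[OF F.B2.functional_left[of f1], of x]
    by simp
  \<comment> \<open>A single member of the family shows that \<open>g\<close> does not vanish
    identically on \<open>X\<close>.\<close>
  obtain u v w' x0 x1 where w1: "F.dlt (F.base_point u v w') \<noteq> 0"
    "C1 (F.point x0 x1 u v w') (F.point x0 x1 u v w') = 0" "C2 (F.point x0 x1 u v w') (F.point x0 x1 u v w') = 0"
  proof -
    define P where "P u v w \<longleftrightarrow> R.is_unit_in u \<and> v \<in> R \<and> w \<in> R \<and> F.dlt (F.base_point u v w) \<noteq> 0 \<and>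
      (\<exists>x0\<in>R. \<exists>x1\<in>R. C1 (F.point x0 x1 u v w) (F.point x0 x1 u v w) = 0 \<and> C2 (F.point x0 x1 u v w) (F.point x0 x1 u v w) = 0)"
      for u v w
    have "nested_infinite P" using fam unfolding F.integral_family_def P_def .
    then obtain u where "infinite {v. infinite {w. P u v w}}"
      unfolding nested_infinite_def using infinite_imp_nonempty by blast
    then obtain v where "infinite {w. P u v w}" using infinite_imp_nonempty by blast
    then obtain w' where "P u v w'" using infinite_imp_nonempty by blast
    then show thesis using that unfolding P_def by blast
  qed
  obtain p1 where p1: "F.point x0 x1 u v w' \<in> coords p1" using pt by blast
  have p1X: "p1 \<in> X" using inX[OF p1] w1 by simp
  have "peval g (F.point x0 x1 u v w') \<noteq> 0"
    unfolding gval using w1(1) by (simp add: F.point_def F.dlt_simps functional_simps[OF h(1)] F.h1 F.base_point_def)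
  then have gX: "\<not> (\<forall>p\<in>X. \<forall>x\<in>coords p. peval g x = 0)" using p1 p1X by blast
  have "X - D \<subseteq> zariski_closure T"
    unfolding zariski_closure_def
  proof (intro subsetI InterI)
    fix p Z assume p: "p \<in> X - D" and "Z \<in> {Z. zariski_closed Z \<and> T \<subseteq> Z}"
    then obtain FF where FF: "\<forall>f\<in>FF. \<exists>d. homogeneous_of_degree d f" "Z = zero_locus FF" and TZ: "T \<subseteq> Z"
      by (auto simp: zariski_closed_def)
    have "peval f x = 0" if f: "f \<in> FF" and x: "x \<in> coords p" for f x
    proof -
      obtain d where d: "homogeneous_of_degree d f" using FF f by blast
      have zero: "peval f (F.point x0 x1 u v w') = 0"
        if "x0 \<in> R" "x1 \<in> R" "R.is_unit_in u" "v \<in> R" "w' \<in> R" "C1 (F.point x0 x1 u v w') (F.point x0 x1 u v w') = 0"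
          "C2 (F.point x0 x1 u v w') (F.point x0 x1 u v w') = 0" for x0 x1 u v w'
      proof -
        obtain q where q: "F.point x0 x1 u v w' \<in> coords q" using pt by blast
        then have "q \<in> Z" using integral[OF that q] TZ by blast
        then show ?thesis using q f by (simp add: FF(2) zero_locus_def)
      qed
      have fg: "peval f y = 0 \<or> peval g y = 0" if q: "q \<in> X" "y \<in> coords q" for q y
      proof (rule disjCI)
        assume "peval g y \<noteq> 0"
        then have "h1 y \<noteq> 0" "F.dlt y \<noteq> 0" by (auto simp: gval)
        moreover have "C1 y y = 0" "C2 y y = 0" using inX[OF q(2)] q(1) by auto
        ultimately show "peval f y = 0" by (intro form_vanishes[OF F(1) fam d zero])
      qed
      have "(\<forall>p\<in>X. \<forall>x\<in>coords p. peval f x = 0) \<or> (\<forall>p\<in>X. \<forall>x\<in>coords p. peval g x = 0)"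
        by (rule irreducible_closed_vanishing[OF irr d g3]) (rule fg)
      then show ?thesis using gX p x by blast
    qed
    then show "p \<in> Z" by (simp add: FF(2) zero_locus_def)
  qed
  then show ?thesis unfolding integral_points_potentially_dense_def T_def using K' S by blast
qed

text \<open>Since the two forms generate the vanishing ideal, all gradients at a point of
  \<open>X\<close> are combinations of theirs. Jacobian rank 5 - 3 = 2 therefore makes these two
  gradients independent.\<close>

lemma smooth_complex_pencil:
  assumes "smooth_quadric_complex K X"
  obtains q1 q2 B1 B2 where "irreducible_closed X" "X = zero_locus {q1} \<inter> zero_locus {q2}"
    "symmetric_bilinear B1" "symmetric_bilinear B2" "\<And>x. peval q1 x = B1 x x" "\<And>x. peval q2 x = B2 x x"
    "smooth_pencil B1 B2"
proof -
  obtain q1 q2 where q: "homogeneous_of_degree 2 q1" "homogeneous_of_degree 2 q2" "X = zero_locus {q1} \<inter> zero_locus {q2}"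
    "vanishing_ideal X = {a * q1 + b * q2 | a b. True}" and smooth: "smooth_variety_of_dimension X 3"
    using assms unfolding smooth_quadric_complex_def by blast
  obtain B1 where B1: "symmetric_bilinear B1" "\<And>x. peval q1 x = B1 x x" using quadratic_form_bilinear[OF q(1)] by blast
  obtain B2 where B2: "symmetric_bilinear B2" "\<And>x. peval q2 x = B2 x x" using quadratic_form_bilinear[OF q(2)] by blast
  show thesis
  proof (rule that[OF _ q(3) B1(1) B2(1) B1(2) B2(2)])
    show "irreducible_closed X" using smooth by (simp add: smooth_variety_of_dimension_def)
    show "smooth_pencil B1 B2"
      unfolding smooth_pencil_def
    proof (intro allI impI)
      fix x p1 p2 assume x: "x \<noteq> 0" "B1 x x = 0" "B2 x x = 0" and "\<forall>y. p1 * B1 x y + p2 * B2 x y = 0"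
      then have rel: "p1 * B1 x y + p2 * B2 x y = 0" for y by blast
      obtain p where p: "x \<in> coords p" using point_of_vector[OF x(1)] by blast
      have qx: "peval q1 x = 0" "peval q2 x = 0" by (simp_all add: x B1(2) B2(2))
      have "peval q1 y = 0" "peval q2 y = 0" if "y \<in> coords p" for y
        using peval_coords[OF q(1) p that qx(1)] peval_coords[OF q(2) p that qx(2)] by auto
      then have "p \<in> X" unfolding q(3) zero_locus_def by simp
      then have "vec.dim {gradient f x | f. f \<in> vanishing_ideal X} = CARD(6) - 1 - 3"
        using smooth p unfolding smooth_variety_of_dimension_def by blast
      then have dim: "vec.dim {gradient f x | f. f \<in> vanishing_ideal X} = 2" by simp
      have grad: "p1 *s gradient q1 x + p2 *s gradient q2 x = 0"
      proof -
        have "(p1 *s gradient q1 x + p2 *s gradient q2 x) $ k = 2 * (p1 * B1 x (axis k 1) + p2 * B2 x (axis k 1))" for k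
          by (simp add: gradient_quadratic[OF B1] gradient_quadratic[OF B2] algebra_simps)
        then show ?thesis using rel by (simp add: vec_eq_iff)
      qed
      have span: "{gradient f x | f. f \<in> vanishing_ideal X} \<subseteq> vec.span A"
        if "gradient q1 x \<in> vec.span A" "gradient q2 x \<in> vec.span A" for A
      proof
        fix y assume "y \<in> {gradient f x | f. f \<in> vanishing_ideal X}"
        then obtain a b where y: "y = gradient (a * q1 + b * q2) x" unfolding q(4) by blast
        show "y \<in> vec.span A" unfolding y gradient_ideal[OF qx] by (intro vec.span_add vec.span_scale that)
      qed
      have le: "\<not> (gradient q1 x \<in> vec.span {a} \<and> gradient q2 x \<in> vec.span {a})" for a
      proof
        assume "gradient q1 x \<in> vec.span {a} \<and> gradient q2 x \<in> vec.span {a}"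
        then have "vec.dim {gradient f x | f. f \<in> vanishing_ideal X} \<le> card {a}" by (intro vec.dim_le_card span) auto
        then show False using dim by simp
      qed
      show "p1 = 0 \<and> p2 = 0"
      proof (rule ccontr)
        assume "\<not> ?thesis"
        then consider "p1 \<noteq> 0" | "p2 \<noteq> 0" by blast
        then show False
        proof cases
          case 1
          have "p1 *s gradient q1 x = (- p2) *s gradient q2 x" by (simp add: eq_neg_iff_add_eq_0[THEN iffD2, OF grad])
          then have "(1 / p1) *s (p1 *s gradient q1 x) = (1 / p1) *s ((- p2) *s gradient q2 x)" by (simp only:)
          then have "gradient q1 x = (1 / p1) *s ((- p2) *s gradient q2 x)" using 1 by simp
          then have "gradient q1 x \<in> vec.span {gradient q2 x}"
            by (simp only:) (intro vec.span_scale vec.span_base, simp)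
          then show False using le vec.span_base[OF singletonI] by blast
        next
          case 2
          have "p2 *s gradient q2 x = (- p1) *s gradient q1 x" using minus_unique[OF grad] by simp
          then have "(1 / p2) *s (p2 *s gradient q2 x) = (1 / p2) *s ((- p1) *s gradient q1 x)" by (simp only:)
          then have "gradient q2 x = (1 / p2) *s ((- p1) *s gradient q1 x)" using 2 by simp
          then have "gradient q2 x \<in> vec.span {gradient q1 x}"
            by (simp only:) (intro vec.span_scale vec.span_base, simp)
          then show False using le vec.span_base[OF singletonI] by blast
        qed
      qed
    qed
  qed
qed

lemma hyperplane_section_functional:
  assumes "hyperplane_section K X H"
  obtains h where "functional h" "\<exists>v. h v \<noteq> 0" "\<And>p x. p \<in> H \<Longrightarrow> x \<in> coords p \<Longrightarrow> h x = 0" "H \<subseteq> X"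
proof -
  obtain f where f: "f \<noteq> 0" "homogeneous_of_degree 1 f" "H = X \<inter> zero_locus {f}"
    using assms by (auto simp: hyperplane_section_def)
  obtain c where c: "f = linear_form c" using degree_1_linear_form[OF f(2)] .
  have "functional (peval f)" unfolding functional_def
    by (simp add: c sum.distrib sum_distrib_left distrib_left mult.left_commute)
  moreover have "\<exists>v. peval f v \<noteq> 0"
  proof (rule ccontr)
    assume "\<not> ?thesis"
    then have "peval f (axis i 1) = 0" for i by blast
    then have "c $ i = 0" for i by (simp add: c axis_def if_distrib cong: if_cong)
    then show False using f(1) c by (simp add: linear_form_def)
  qed
  moreover have "peval f x = 0" if "p \<in> H" "x \<in> coords p" for p x using that by (simp add: f(3) zero_locus_def)
  ultimately show thesis using that[of "peval f"] f(3) by blast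
qed

text \<open>The two linear forms may be proportional, so a single section and two coinciding
  sections are included.\<close>

lemma dense_of_one_or_two_hyperplanes:
  fixes X D :: "6 proj set"
  assumes K: "number_field K" and X: "smooth_quadric_complex K X"
    and ind: "\<And>s t. s *s w + t *s z = 0 \<Longrightarrow> s = 0 \<and> t = 0"
    and line: "\<And>s t p. s *s w + t *s z \<in> coords p \<Longrightarrow> p \<in> X"
    and h: "functional h1" "functional h2" "\<exists>v. h1 v \<noteq> 0" "\<exists>v. h2 v \<noteq> 0" "h1 w = 0" "h1 z = 0" "h2 w = 0" "h2 z = 0"
    and D: "\<And>p x. p \<in> D \<Longrightarrow> x \<in> coords p \<Longrightarrow> h1 x = 0 \<or> h2 x = 0"
  shows "integral_points_potentially_dense K X D"
proof -
  obtain q1 q2 B1 B2 where irr: "irreducible_closed X" and XX: "X = zero_locus {q1} \<inter> zero_locus {q2}"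
    and B: "symmetric_bilinear B1" "symmetric_bilinear B2" "\<And>x. peval q1 x = B1 x x" "\<And>x. peval q2 x = B2 x x"
    and smooth: "smooth_pencil B1 B2"
    using smooth_complex_pencil[OF X] by blast
  interpret B1: symmetric_bilinear B1 by (rule B)
  interpret B2: symmetric_bilinear B2 by (rule B)
  have lineB: "B1 (s *s w + t *s z) (s *s w + t *s z) = 0 \<and> B2 (s *s w + t *s z) (s *s w + t *s z) = 0" for s t
  proof (cases "s *s w + t *s z = 0")
    case False
    then obtain p where p: "s *s w + t *s z \<in> coords p" using point_of_vector by blast
    then have "p \<in> X" by (rule line)
    then show ?thesis using p unfolding XX zero_locus_def by (auto simp: B(3,4))
  qed simp
  \<comment> \<open>If the two linear forms are proportional, the second one is replaced by any other form vanishing on the line.\<close>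
  obtain h3 where h3: "functional h3" "\<And>a b. (\<And>x. a * h1 x + b * h3 x = 0) \<Longrightarrow> a = 0 \<and> b = 0" "h3 w = 0" "h3 z = 0"
    "\<And>x. h1 x = 0 \<or> h2 x = 0 \<Longrightarrow> h1 x = 0 \<or> h3 x = 0"
  proof (cases "\<exists>k. \<forall>x. h2 x = k * h1 x")
    case False
    have "a = 0 \<and> b = 0" if ab: "\<And>x. a * h1 x + b * h2 x = 0" for a b
    proof (cases "b = 0")
      case True
      then show ?thesis using ab h(3) by auto
    next
      case b: False
      have "h2 x = (- a / b) * h1 x" for x
      proof -
        have "b * h2 x = - (a * h1 x)" using ab[of x] by (simp add: eq_neg_iff_add_eq_0 add.commute)
        then show ?thesis using b by (simp add: field_simps)
      qed
      then show ?thesis using False by blast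
    qed
    then show thesis using that[of h2] h by blast
  next
    case True
    then obtain k where k: "\<And>x. h2 x = k * h1 x" by blast
    obtain v where v: "h1 v \<noteq> 0" using h(3) by blast
    have "card {v, w, z} \<le> 3" by (simp add: card_insert_if)
    \<comment> \<open>The new form vanishes on the line and at \<open>v\<close> and is 1 at
      \<open>y\<close>. As \<open>h1\<close> is nonzero at \<open>v\<close>, no multiple of one form
      is the other.\<close>
    then obtain y where y: "y \<notin> vec.span {v, w, z}"
      using ex_outside_span[of "{v, w, z}" "UNIV :: (qbar ^ 6) set"] unfolding vec_dim_card by auto
    have "\<exists>h3. functional h3 \<and> h3 w = 0 \<and> h3 z = 0 \<and> h3 v = 0 \<and> h3 y = 1"
    proof -
      have zi: "z \<notin> vec.span {}" using ind[of 0 1] by (auto simp: vec.span_empty)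
      have wi: "w \<notin> vec.span {z}"
      proof
        assume "w \<in> vec.span {z}"
        then obtain c where "w = c *s z" by (auto simp: vec.span_singleton)
        then show False using ind[of 1 "- c"] by simp
      qed
      have vi: "v \<notin> vec.span {w, z}"
      proof
        assume "v \<in> vec.span {w, z}"
        then obtain a b where "v - a *s w - b *s z = 0"
          unfolding vec.span_breakdown_eq vec.span_empty singleton_iff by (elim exE)
        then have "v = a *s w + b *s z" by (simp add: algebra_simps)
        then show False using v h(5,6) by (simp add: functional_simps[OF h(1)])
      qed
      have ind4: "vec.independent {y, v, w, z}"
        using y vi wi zi by (intro vec.independent_insertI vec.independent_empty)
      \<comment> \<open>Linear maps into the one-dimensional space \<open>qbar ^ 1\<close> stand for
        functionals.\<close>
      obtain g :: "qbar ^ 6 \<Rightarrow> qbar ^ 1" where g: "Vector_Spaces.linear (*s) (*s) g"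
        "\<forall>x\<in>{y, v, w, z}. g x = (if x = y then 1 else 0)"
        using vec.linear_independent_extend[OF ind4, of "\<lambda>x. if x = y then 1 else 0"] by blast
      have ne: "v \<noteq> y" "w \<noteq> y" "z \<noteq> y" using y vec.span_base[of _ "{v, w, z}"] by auto
      interpret g: Vector_Spaces.linear "(*s)" "(*s)" g by (rule g)
      have "functional (\<lambda>x. g x $ 1)" by (simp add: functional_def g.add g.scale)
      then show ?thesis using g(2) ne by (intro exI[of _ "\<lambda>x. g x $ 1"]) auto
    qed
    then obtain h3 where h3: "functional h3" "h3 w = 0" "h3 z = 0" "h3 v = 0" "h3 y = 1" by blast
    have "a = 0 \<and> b = 0" if ab: "\<And>x. a * h1 x + b * h3 x = 0" for a b
    proof -
      have "a = 0" using ab[of v] v h3(4) by simp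
      then show ?thesis using ab[of y] h3(5) by simp
    qed
    moreover have "h1 x = 0 \<or> h2 x = 0 \<Longrightarrow> h1 x = 0 \<or> h3 x = 0" for x using k h(4) by auto
    ultimately show thesis using that[of h3] h3 by blast
  qed
  show ?thesis
  proof (rule dense_of_line[OF K irr XX B smooth _ _ _ h(1) h3(1) _ h(5,6) h3(3,4)])
    show "h1 x = 0 \<or> h3 x = 0" if "p \<in> D" "x \<in> coords p" for p x using h3(5) D[OF that] .
  qed (use ind lineB h3(2) in blast)+
qed

theorem mainTheorem5:
  fixes K :: "qbar set" and X D :: "6 proj set"
  assumes "number_field K"
    and "smooth_quadric_complex K X"
    and "hyperplane_section K X D \<or>
         (\<exists>H1 H2 l. hyperplane_section K X H1 \<and> hyperplane_section K X H2 \<and>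
            projective_line l \<and> l \<subseteq> H1 \<inter> H2 \<and> D = H1 \<union> H2)"
  shows "integral_points_potentially_dense K X D"
  using assms(3)
proof (elim disjE exE conjE)
  assume "hyperplane_section K X D"
  then obtain h v where h: "functional h" "h v \<noteq> 0" "\<And>p x. p \<in> D \<Longrightarrow> x \<in> coords p \<Longrightarrow> h x = 0"
    by (rule hyperplane_section_functional) blast
  obtain q1 q2 B1 B2 where XX: "X = zero_locus {q1} \<inter> zero_locus {q2}"
    and B: "symmetric_bilinear B1" "symmetric_bilinear B2" "\<And>x. peval q1 x = B1 x x" "\<And>x. peval q2 x = B2 x x"
    by (rule smooth_complex_pencil[OF assms(2)]) (rule that)
  interpret B1: symmetric_bilinear B1 by (rule B)
  interpret B2: symmetric_bilinear B2 by (rule B)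
  obtain w z where wz: "\<And>s t. s *s w + t *s z = 0 \<Longrightarrow> s = 0 \<and> t = 0"
    "\<And>s t. h (s *s w + t *s z) = 0 \<and> B1 (s *s w + t *s z) (s *s w + t *s z) = 0 \<and> B2 (s *s w + t *s z) (s *s w + t *s z) = 0"
    by (rule line_in_hyperplane[OF B(1,2) _ h(1,2)]) (simp, blast)
  have hw: "h w = 0" "h z = 0" using conjunct1[OF wz(2)[of 1 0]] conjunct1[OF wz(2)[of 0 1]] by simp_all
  have line: "p \<in> X" if "s *s w + t *s z \<in> coords p" for s t p
  proof -
    have "peval q1 y = 0 \<and> peval q2 y = 0" if y: "y \<in> coords p" for y
    proof -
      obtain c where "y = c *s (s *s w + t *s z)" using coords_scaled[OF \<open>s *s w + t *s z \<in> coords p\<close> y] by blast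
      then show ?thesis using wz(2)[of s t] unfolding B(3,4) by (simp only: B1.scale_left B1.scale_right B2.scale_left B2.scale_right) simp
    qed
    then show ?thesis by (simp add: XX zero_locus_def)
  qed
  \<comment> \<open>A single section is the case of two equal linear forms, with a line found inside
    the section.\<close>
  show ?thesis
    by (rule dense_of_one_or_two_hyperplanes[OF assms(1,2) _ _ h(1) h(1) _ _ hw hw])
      (use wz(1) line h(2,3) in blast)+
next
  fix H1 H2 l assume H: "hyperplane_section K X H1" "hyperplane_section K X H2" "projective_line l" "l \<subseteq> H1 \<inter> H2" "D = H1 \<union> H2"
  obtain h1 where h1: "functional h1" "\<exists>v. h1 v \<noteq> 0" "\<And>p x. p \<in> H1 \<Longrightarrow> x \<in> coords p \<Longrightarrow> h1 x = 0" "H1 \<subseteq> X"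
    by (rule hyperplane_section_functional[OF H(1)]) (rule that)
  obtain h2 where h2: "functional h2" "\<exists>v. h2 v \<noteq> 0" "\<And>p x. p \<in> H2 \<Longrightarrow> x \<in> coords p \<Longrightarrow> h2 x = 0"
    by (rule hyperplane_section_functional[OF H(2)]) (rule that)
  obtain W where W: "vec.subspace W" "vec.dim W = 2" "l = {p. subspace_of p \<subseteq> W}"
    using H(3) unfolding projective_line_def by blast
  obtain w where w: "w \<in> W" "w \<notin> vec.span {}" 
    by (rule ex_outside_span[of "{}" W]) (simp_all add: W(2))
  obtain z where z: "z \<in> W" "z \<notin> vec.span {w}" 
    by (rule ex_outside_span[of "{w}" W]) (simp_all add: W(2))
  have ind: "s = 0 \<and> t = 0" if "s *s w + t *s z = 0" for s t
  proof -
    have "t *s z = (- s) *s w" using that by (simp add: add_eq_0_iff)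
    also have "\<dots> \<in> vec.span {w}" by (intro vec.span_scale vec.span_base) simp
    finally have "t = 0" using scale_in_span z(2) by blast
    then show ?thesis using that w(2) by (simp add: vec.span_empty)
  qed
  have lineH: "p \<in> H1 \<and> p \<in> H2" if y: "y \<in> W" "y \<in> coords p" for y p
  proof -
    obtain x where x: "x \<noteq> 0" "coords p = {c *s x | c. c \<noteq> 0}" "subspace_of p = vec.span {x}" by (rule coords_obtain)
    obtain c where c: "c \<noteq> 0" "y = c *s x" using y(2) unfolding x(2) by blast
    have "x = (1 / c) *s y" using c by simp
    then have "x \<in> W" using vec.subspace_scale[OF W(1) y(1), of "1 / c"] by simp
    then have "subspace_of p \<subseteq> W" unfolding x(3) using W(1) by (simp add: vec.span_minimal)
    then show ?thesis using H(4) W(3) by blast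
  qed
  have "s *s w + t *s z \<in> W" for s t using w z W(1) by (intro vec.subspace_add vec.subspace_scale)
  then have line: "p \<in> X" if "s *s w + t *s z \<in> coords p" for s t p using lineH[OF _ that] h1(4) by blast
  have van: "h1 y = 0" "h2 y = 0" if y: "y \<in> W" "y \<noteq> 0" for y
  proof -
    obtain p where p: "y \<in> coords p" using point_of_vector[OF y(2)] by blast
    then show "h1 y = 0" "h2 y = 0" using lineH[OF y(1) p] h1(3) h2(3) by auto
  qed
  have "w \<noteq> 0" "z \<noteq> 0" using ind[of 1 0] ind[of 0 1] by auto
  note van = van[OF w(1) this(1)] van[OF z(1) this(2)]
  show ?thesis
  proof (rule dense_of_one_or_two_hyperplanes[OF assms(1,2) _ _ h1(1) h2(1) h1(2) h2(2) van(1,3,2,4)])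
    show "h1 x = 0 \<or> h2 x = 0" if "p \<in> D" "x \<in> coords p" for p x using that h1(3) h2(3) H(5) by blast
  qed (use ind line in blast)+
qed

end
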